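(* Let $M$ be a $1$-connected complex analytic manifold with $\dim M=2$, and let $(M,g,\circ,e,\mathcal E,\kappa)$ be a semi-simple Tate CDV$\oplus$-structure on $M$ such that $g(e,e)=0$. Let $d$ be the constant such that $\nabla\mathcal E+(\nabla\mathcal E)^*=(2-d)\cdot\mathrm{Id}$, where $\nabla\mathcal E$ is the endomorphism $X\mapsto\nabla_X\mathcal E$ and $^*$ is the $g$-adjoint. Then the CDV$\oplus$-structure is strongly potential if and only if $d\in2\mathbb Z$.
   Context: **Frobenius manifold** $(M,g,\circ,e,\mathcal E)$: $M$ is a complex manifold with holomorphic tangent bundle $\mathcal T_M$; $g$ is a holomorphic symmetric nondegenerate bilinear form on $\mathcal T_M$ with flat Levi-Civita connection $\nabla$; $\circ$ is a holomorphic commutative associative product on $\mathcal T_M$ with unit field $e$, $\nabla e=0$, $g(X\circ Y,Z)=g(X,Y\circ Z)$, and the tensor $\nabla(\circ)$ is symmetric in all arguments; $\mathcal E$ is a holomorphic (Euler) vector field with $\mathcal L_{\mathcal E}(\circ)=\circ$ and $\mathcal L_{\mathcal E}(g)=(2-d)\,g$ for a constant $d\in\mathbb C$. Put $\Phi_X(Y)=-X\circ Y$, $\mathcal U(Y)=\mathcal E\circ Y$, $\mathcal V(Y)=\nabla_Y\mathcal E-\frac{2-d}{2}Y$. **Semi-simple**: $\mathcal U$ has pairwise distinct eigenvalues at each point of $M$. "$1$-connected" means connected and simply connected. **CDV-structure** $(M,g,\circ,e,\mathcal E,\kappa)$: a Frobenius manifold together with a $C^\infty$ antilinear involution $\kappa$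 (real structure) of the $C^\infty$ bundle $\mathcal T_M^{(1,0)}$ such that $h(X,Y):=g(X,\kappa Y)$ is a (nondegenerate) Hermitian form and the following hold. Let $D=D'+\overline\partial$ be the Chern connection of $h$, let $^\dagger$ denote the $h$-adjoint (so $\Phi^\dagger=\kappa\Phi\kappa$ and $\mathcal U^\dagger=\kappa\,\mathcal U\kappa$), and let $\mathcal Q:=D_{\mathcal E}-\mathcal L_{\mathcal E}-\frac{2-d}{2}\mathrm{Id}$. Then: $D(\kappa)=0$; $D'(\Phi)=0$; $D'\overline\partial+\overline\partial D'=-(\Phi\wedge\Phi^\dagger+\Phi^\dagger\wedge\Phi)$; $D'(\mathcal U)-[\Phi,\mathcal Q]+\Phi=0$; $D'(\mathcal Q)+[\Phi,\mathcal U^\dagger]=0$; $\mathcal Q^\dagger=\mathcal Q$; $\kappa\mathcal Q\kappa=-\mathcal Q$. It is semi-simple if the Frobenius manifold is; it is a CDV$\oplus$-structure if $h$ is positive definite; it is **Tate** if $\mathcal Q=0$. **The two bundles.** Let $\pi:\mathbb C\times M\to M$ be the projection and $z$ the coordinate on $\mathbb C$; $d'_z,d''_z$ are the $(1,0)$ and $(0,1)$ parts of the differential in $z$. $\mathcal H_1=\pi^*\mathcal T_M$ with its usual holomorphic structure and flat meromorphic connection $\widetilde\nabla=\nabla+d'_z+\frac1z\Phi+\big(\frac1z\mathcal U-\mathcal V\big)\frac{dz}{z}$. $\mathcal H_2$ is the $C^\infty$ bundle $\pi^*\mathcal T_M^{(1,0)}$ with holomorphic structure defined by $\overline\partial+z\Phi^\dagger+d''_z$,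 with flat meromorphic connection $\widetilde D=D'+d'_z+\frac1z\Phi+\big(\frac1z\mathcal U-\mathcal Q-z\,\mathcal U^\dagger\big)\frac{dz}{z}$. The CDV-structure is **strongly potential** if there is a holomorphic isomorphism $\phi:\mathcal H_1\to\mathcal H_2$ with $\phi\,\widetilde\nabla=\widetilde D\,\phi$. *)

theory Defs
  imports "HOL-Analysis.Analysis"
begin

section \<open>Calculus on open subsets of \<open>complex^'n\<close>\<close>

text \<open>All domains \<open>V\<close> below are open.\<close>

definition holo_on :: "(complex^'n::finite) set \<Rightarrow> (complex^'n \<Rightarrow> complex) \<Rightarrow> bool" where
  "holo_on V f \<longleftrightarrow>
     (\<forall>x\<in>V. \<exists>f'. (f has_derivative f') (at x) \<and> (\<forall>c v. f' (c *s v) = c * f' v))"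

primrec Ck_on :: "nat \<Rightarrow> 'a::euclidean_space set \<Rightarrow> ('a \<Rightarrow> 'b::real_normed_vector) \<Rightarrow> bool" where
  "Ck_on 0 V f \<longleftrightarrow> continuous_on V f"
| "Ck_on (Suc k) V f \<longleftrightarrow>
     (\<forall>x\<in>V. f differentiable (at x)) \<and> (\<forall>v. Ck_on k V (\<lambda>x. frechet_derivative f (at x) v))"

definition smooth_on :: "'a::euclidean_space set \<Rightarrow> ('a \<Rightarrow> 'b::real_normed_vector) \<Rightarrow> bool" where
  "smooth_on V f \<longleftrightarrow> (\<forall>k. Ck_on k V f)"

text \<open>The value \<open>u = (u\<^sub>a)\<close> of a field stands for the \<open>(1,0)\<close>-vector \<open>\<Sum>\<^sub>a u\<^sub>a \<partial>\<^sub>a\<close>.\<close>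

type_synonym 'n field = "complex^'n \<Rightarrow> complex^'n"

definition holo_fields :: "(complex^'n::finite) set \<Rightarrow> 'n field set" where
  "holo_fields V = {X. \<forall>c. holo_on V (\<lambda>x. X x $ c)}"

definition smooth_fields :: "(complex^'n::finite) set \<Rightarrow> 'n field set" where
  "smooth_fields V = {X. smooth_on V X}"

text \<open>Wirtinger derivatives: \<open>deriv10 u\<close> is the derivative along \<open>\<Sum>\<^sub>a u\<^sub>a \<partial>\<^sub>a\<close> (complex linear
  in \<open>u\<close>), and \<open>deriv01 u\<close> the derivative along the conjugate vector
  \<open>\<Sum>\<^sub>a cnj u\<^sub>a \<partial>/\<partial>(cnj x\<^sub>a)\<close> (antilinear in \<open>u\<close>).\<close>

definition deriv10 :: "complex^'n::finite \<Rightarrow> (complex^'n \<Rightarrow> complex) \<Rightarrow> complex^'n \<Rightarrow> complex" where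
  "deriv10 u f x =
     (frechet_derivative f (at x) u - \<i> * frechet_derivative f (at x) (\<i> *s u)) / 2"

definition deriv01 :: "complex^'n::finite \<Rightarrow> (complex^'n \<Rightarrow> complex) \<Rightarrow> complex^'n \<Rightarrow> complex" where
  "deriv01 u f x =
     (frechet_derivative f (at x) u + \<i> * frechet_derivative f (at x) (\<i> *s u)) / 2"

definition del :: "('n::finite) field \<Rightarrow> 'n field \<Rightarrow> 'n field" where
  "del X Y = (\<lambda>x. \<chi> c. deriv10 (X x) (\<lambda>y. Y y $ c) x)"

definition delbar :: "('n::finite) field \<Rightarrow> 'n field \<Rightarrow> 'n field" where
  "delbar X Y = (\<lambda>x. \<chi> c. deriv01 (X x) (\<lambda>y. Y y $ c) x)"

text \<open>\<open>lie X Y\<close> is both the bracket and the Lie derivative of \<open>Y\<close> along \<open>X\<close>, for \<open>X\<close> holomorphic and \<open>Y\<close> a smooth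
  field of type \<open>(1,0)\<close>.\<close>

definition lie :: "('n::finite) field \<Rightarrow> 'n field \<Rightarrow> 'n field" where
  "lie X Y = (\<lambda>x. del X Y x - del Y X x)"

definition contract :: "complex^'n::finite^'n^'n \<Rightarrow> complex^'n \<Rightarrow> complex^'n \<Rightarrow> complex^'n" where
  "contract T u v = (\<chi> c. \<Sum>a\<in>UNIV. \<Sum>b\<in>UNIV. T $ c $ a $ b * u $ a * v $ b)"

text \<open>\<open>covd \<Gamma> X\<close> is the \<open>(1,0)\<close>-part of the connection with coefficients \<open>\<Gamma>\<close>, along \<open>X\<close>:
  its value on \<open>\<partial>\<^sub>b\<close> along \<open>\<partial>\<^sub>a\<close> is \<open>\<Sum>\<^sub>c \<Gamma> $ c $ a $ b \<partial>\<^sub>c\<close>.\<close>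

definition covd :: "(complex^'n::finite \<Rightarrow> complex^'n^'n^'n) \<Rightarrow> 'n field \<Rightarrow> 'n field \<Rightarrow> 'n field" where
  "covd \<Gamma> X Y = (\<lambda>x. del X Y x + contract (\<Gamma> x) (X x) (Y x))"

definition conj_vec :: "complex^'n::finite \<Rightarrow> complex^'n" where
  "conj_vec u = (\<chi> a. cnj (u $ a))"

text \<open>Adjoint of an endomorphism with respect to a nondegenerate bilinear or Hermitian form.\<close>

definition adjoint_wrt ::
  "(complex^'n::finite \<Rightarrow> complex^'n \<Rightarrow> complex) \<Rightarrow> (complex^'n \<Rightarrow> complex^'n) \<Rightarrow> complex^'n \<Rightarrow> complex^'n"
where
  "adjoint_wrt b f = (THE f'. \<forall>u v. b (f u) v = b u (f' v))"


section \<open>Frobenius manifolds and CDV-structures in one chart\<close>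

text \<open>Components in the coordinate frame. The connection coefficients \<open>christoffel\<close> and \<open>chern\<close>
  are not additional data: the conditions below force them to be those of the Levi-Civita
  connection of \<open>metric\<close> and of the Chern connection of the Hermitian form.
  The antilinear map \<open>\<kappa>\<close> is \<open>u \<mapsto> real_structure x *v conj_vec u\<close>.\<close>

record ('n::finite) frobenius_chart =
  metric :: "complex^'n \<Rightarrow> complex^'n^'n"
  christoffel :: "complex^'n \<Rightarrow> complex^'n^'n^'n"
  structure_constants :: "complex^'n \<Rightarrow> complex^'n^'n^'n"
  unit_field :: "'n field"
  euler :: "'n field"

record ('n::finite) cdv_chart = "'n frobenius_chart" +
  real_structure :: "complex^'n \<Rightarrow> complex^'n^'n"
  chern :: "complex^'n \<Rightarrow> complex^'n^'n^'n"

definition pairing ::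
  "('n::finite, 'z) frobenius_chart_scheme \<Rightarrow> complex^'n \<Rightarrow> complex^'n \<Rightarrow> complex^'n \<Rightarrow> complex" where
  "pairing S x u v = (\<Sum>a\<in>UNIV. \<Sum>b\<in>UNIV. metric S x $ a $ b * u $ a * v $ b)"

definition mult ::
  "('n::finite, 'z) frobenius_chart_scheme \<Rightarrow> complex^'n \<Rightarrow> complex^'n \<Rightarrow> complex^'n \<Rightarrow> complex^'n" where
  "mult S x u v = contract (structure_constants S x) u v"

definition multf ::
  "('n::finite, 'z) frobenius_chart_scheme \<Rightarrow> 'n field \<Rightarrow> 'n field \<Rightarrow> 'n field" where
  "multf S X Y = (\<lambda>x. mult S x (X x) (Y x))"

definition nabla ::
  "('n::finite, 'z) frobenius_chart_scheme \<Rightarrow> 'n field \<Rightarrow> 'n field \<Rightarrow> 'n field" where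
  "nabla S = covd (christoffel S)"

definition nabla_euler ::
  "('n::finite, 'z) frobenius_chart_scheme \<Rightarrow> complex^'n \<Rightarrow> complex^'n \<Rightarrow> complex^'n" where
  "nabla_euler S x u = nabla S (\<lambda>_. u) (euler S) x"

definition Phi ::
  "('n::finite, 'z) frobenius_chart_scheme \<Rightarrow> complex^'n \<Rightarrow> complex^'n \<Rightarrow> complex^'n \<Rightarrow> complex^'n" where
  "Phi S x u v = - mult S x u v"

definition U_op ::
  "('n::finite, 'z) frobenius_chart_scheme \<Rightarrow> complex^'n \<Rightarrow> complex^'n \<Rightarrow> complex^'n" where
  "U_op S x v = mult S x (euler S x) v"

definition V_op ::
  "('n::finite, 'z) frobenius_chart_scheme \<Rightarrow> complex \<Rightarrow> complex^'n \<Rightarrow> complex^'n \<Rightarrow> complex^'n" where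
  "V_op S d x v = nabla_euler S x v - ((2 - d) / 2) *s v"

definition flat_metric_on ::
  "(complex^'n) set \<Rightarrow> ('n::finite, 'z) frobenius_chart_scheme \<Rightarrow> bool" where
  "flat_metric_on V S \<longleftrightarrow>
     (\<forall>a b. holo_on V (\<lambda>x. metric S x $ a $ b)) \<and>
     (\<forall>x\<in>V. transpose (metric S x) = metric S x \<and> invertible (metric S x)) \<and>
     (\<forall>X\<in>holo_fields V. \<forall>Y\<in>holo_fields V. \<forall>x\<in>V.
        nabla S X Y x - nabla S Y X x = lie X Y x) \<and>
     (\<forall>X\<in>holo_fields V. \<forall>Y\<in>holo_fields V. \<forall>Z\<in>holo_fields V. \<forall>x\<in>V.
        deriv10 (X x) (\<lambda>y. pairing S y (Y y) (Z y)) x =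
          pairing S x (nabla S X Y x) (Z x) + pairing S x (Y x) (nabla S X Z x)) \<and>
     (\<forall>X\<in>holo_fields V. \<forall>Y\<in>holo_fields V. \<forall>Z\<in>holo_fields V. \<forall>x\<in>V.
        nabla S X (nabla S Y Z) x - nabla S Y (nabla S X Z) x - nabla S (lie X Y) Z x = 0)"

definition nabla_mult ::
  "('n::finite, 'z) frobenius_chart_scheme \<Rightarrow> 'n field \<Rightarrow> 'n field \<Rightarrow> 'n field \<Rightarrow> 'n field" where
  "nabla_mult S X Y Z =
     (\<lambda>x. nabla S X (multf S Y Z) x - multf S (nabla S X Y) Z x - multf S Y (nabla S X Z) x)"

definition frobenius_on ::
  "(complex^'n) set \<Rightarrow> complex \<Rightarrow> ('n::finite, 'z) frobenius_chart_scheme \<Rightarrow> bool" where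
  "frobenius_on V d S \<longleftrightarrow>
     flat_metric_on V S \<and>
     (\<forall>a b c. holo_on V (\<lambda>x. structure_constants S x $ c $ a $ b)) \<and>
     unit_field S \<in> holo_fields V \<and>
     euler S \<in> holo_fields V \<and>
     (\<forall>x\<in>V. \<forall>u v w.
        mult S x u v = mult S x v u \<and>
        mult S x (mult S x u v) w = mult S x u (mult S x v w) \<and>
        mult S x (unit_field S x) u = u \<and>
        pairing S x (mult S x u v) w = pairing S x u (mult S x v w)) \<and>
     (\<forall>X\<in>holo_fields V. \<forall>x\<in>V. nabla S X (unit_field S) x = 0) \<and>
     (\<forall>X\<in>holo_fields V. \<forall>Y\<in>holo_fields V. \<forall>Z\<in>holo_fields V. \<forall>x\<in>V.
        nabla_mult S X Y Z x = nabla_mult S Y X Z x \<and>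
        nabla_mult S X Y Z x = nabla_mult S X Z Y x) \<and>
     (\<forall>X\<in>holo_fields V. \<forall>Y\<in>holo_fields V. \<forall>x\<in>V.
        lie (euler S) (multf S X Y) x
          - multf S (lie (euler S) X) Y x - multf S X (lie (euler S) Y) x = multf S X Y x) \<and>
     (\<forall>X\<in>holo_fields V. \<forall>Y\<in>holo_fields V. \<forall>x\<in>V.
        deriv10 (euler S x) (\<lambda>y. pairing S y (X y) (Y y)) x
          - pairing S x (lie (euler S) X x) (Y x) - pairing S x (X x) (lie (euler S) Y x)
          = (2 - d) * pairing S x (X x) (Y x))"

definition kappa ::
  "('n::finite, 'z) cdv_chart_scheme \<Rightarrow> complex^'n \<Rightarrow> complex^'n \<Rightarrow> complex^'n" where
  "kappa S x u = real_structure S x *v conj_vec u"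

definition herm ::
  "('n::finite, 'z) cdv_chart_scheme \<Rightarrow> complex^'n \<Rightarrow> complex^'n \<Rightarrow> complex^'n \<Rightarrow> complex" where
  "herm S x u v = pairing S x u (kappa S x v)"

definition D' ::
  "('n::finite, 'z) cdv_chart_scheme \<Rightarrow> 'n field \<Rightarrow> 'n field \<Rightarrow> 'n field" where
  "D' S = covd (chern S)"

text \<open>\<open>Phi_dag S x u\<close> is the value of the \<open>(0,1)\<close>-form \<open>\<Phi>\<^sup>\<dagger>\<close> on the conjugate of \<open>u\<close>.\<close>

definition Phi_dag ::
  "('n::finite, 'z) cdv_chart_scheme \<Rightarrow> complex^'n \<Rightarrow> complex^'n \<Rightarrow> complex^'n \<Rightarrow> complex^'n" where
  "Phi_dag S x u = adjoint_wrt (herm S x) (Phi S x u)"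

definition U_dag ::
  "('n::finite, 'z) cdv_chart_scheme \<Rightarrow> complex^'n \<Rightarrow> complex^'n \<Rightarrow> complex^'n" where
  "U_dag S x = adjoint_wrt (herm S x) (U_op S x)"

definition Q_op ::
  "('n::finite, 'z) cdv_chart_scheme \<Rightarrow> complex \<Rightarrow> 'n field \<Rightarrow> 'n field" where
  "Q_op S d Y = (\<lambda>x. D' S (euler S) Y x - lie (euler S) Y x - ((2 - d) / 2) *s Y x)"

definition real_structure_on ::
  "(complex^'n) set \<Rightarrow> ('n::finite, 'z) cdv_chart_scheme \<Rightarrow> bool" where
  "real_structure_on V S \<longleftrightarrow>
     smooth_on V (real_structure S) \<and> (\<forall>x\<in>V. \<forall>u. kappa S x (kappa S x u) = u)"

definition hermitian_on ::
  "(complex^'n) set \<Rightarrow> ('n::finite, 'z) cdv_chart_scheme \<Rightarrow> bool" where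
  "hermitian_on V S \<longleftrightarrow>
     (\<forall>x\<in>V. (\<forall>u v. herm S x v u = cnj (herm S x u v)) \<and>
             (\<forall>u. (\<forall>v. herm S x u v = 0) \<longrightarrow> u = 0))"

text \<open>The connection \<open>D' + delbar\<close> is compatible with \<open>h\<close>; its \<open>(0,1)\<close>-part is by construction
  the one of the holomorphic tangent bundle.\<close>

definition chern_on ::
  "(complex^'n) set \<Rightarrow> ('n::finite, 'z) cdv_chart_scheme \<Rightarrow> bool" where
  "chern_on V S \<longleftrightarrow>
     (\<forall>X\<in>smooth_fields V. \<forall>Y\<in>smooth_fields V. \<forall>Z\<in>smooth_fields V. \<forall>x\<in>V.
        deriv10 (X x) (\<lambda>y. herm S y (Y y) (Z y)) x =
          herm S x (D' S X Y x) (Z x) + herm S x (Y x) (delbar X Z x) \<and>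
        deriv01 (X x) (\<lambda>y. herm S y (Y y) (Z y)) x =
          herm S x (delbar X Y x) (Z x) + herm S x (Y x) (D' S X Z x))"

text \<open>The equations between endomorphism-valued forms are evaluated on \<open>(1,0)\<close>-fields \<open>X\<close>, \<open>Y\<close>
  and applied to a smooth section \<open>Z\<close>. The \<open>(1,1)\<close>-form equation is evaluated on a constant
  field \<open>u\<close> and the conjugate of a constant field \<open>v\<close>, which commute; there
  \<open>\<Phi>\<and>\<Phi>\<^sup>\<dagger> + \<Phi>\<^sup>\<dagger>\<and>\<Phi>\<close> is the commutator of \<open>\<Phi>\<^sub>u\<close> with the adjoint of \<open>\<Phi>\<^sub>v\<close>.\<close>

definition cdv_on ::
  "(complex^'n) set \<Rightarrow> complex \<Rightarrow> ('n::finite, 'z) cdv_chart_scheme \<Rightarrow> bool" where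
  "cdv_on V d S \<longleftrightarrow>
     frobenius_on V d S \<and> real_structure_on V S \<and> hermitian_on V S \<and> chern_on V S \<and>
     \<comment> \<open>\<open>D(\<kappa>) = 0\<close>\<close>
     (\<forall>X\<in>smooth_fields V. \<forall>Y\<in>smooth_fields V. \<forall>x\<in>V.
        D' S X (\<lambda>y. kappa S y (Y y)) x = kappa S x (delbar X Y x) \<and>
        delbar X (\<lambda>y. kappa S y (Y y)) x = kappa S x (D' S X Y x)) \<and>
     \<comment> \<open>\<open>D'(\<Phi>) = 0\<close>\<close>
     (\<forall>X\<in>smooth_fields V. \<forall>Y\<in>smooth_fields V. \<forall>Z\<in>smooth_fields V. \<forall>x\<in>V.
        (D' S X (\<lambda>y. Phi S y (Y y) (Z y)) x - Phi S x (Y x) (D' S X Z x))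
        - (D' S Y (\<lambda>y. Phi S y (X y) (Z y)) x - Phi S x (X x) (D' S Y Z x))
        - Phi S x (lie X Y x) (Z x) = 0) \<and>
     \<comment> \<open>\<open>D' delbar + delbar D' = -(\<Phi>\<and>\<Phi>\<^sup>\<dagger> + \<Phi>\<^sup>\<dagger>\<and>\<Phi>)\<close>\<close>
     (\<forall>Z\<in>smooth_fields V. \<forall>u v. \<forall>x\<in>V.
        D' S (\<lambda>_. u) (delbar (\<lambda>_. v) Z) x - delbar (\<lambda>_. v) (D' S (\<lambda>_. u) Z) x =
        - (Phi S x u (Phi_dag S x v (Z x)) - Phi_dag S x v (Phi S x u (Z x)))) \<and>
     \<comment> \<open>\<open>D'(U) - [\<Phi>,Q] + \<Phi> = 0\<close>\<close>
     (\<forall>X\<in>smooth_fields V. \<forall>Z\<in>smooth_fields V. \<forall>x\<in>V.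
        (D' S X (\<lambda>y. U_op S y (Z y)) x - U_op S x (D' S X Z x))
        - (Phi S x (X x) (Q_op S d Z x) - Q_op S d (\<lambda>y. Phi S y (X y) (Z y)) x)
        + Phi S x (X x) (Z x) = 0) \<and>
     \<comment> \<open>\<open>D'(Q) + [\<Phi>,U\<^sup>\<dagger>] = 0\<close>\<close>
     (\<forall>X\<in>smooth_fields V. \<forall>Z\<in>smooth_fields V. \<forall>x\<in>V.
        (D' S X (Q_op S d Z) x - Q_op S d (D' S X Z) x)
        + (Phi S x (X x) (U_dag S x (Z x)) - U_dag S x (Phi S x (X x) (Z x))) = 0) \<and>
     \<comment> \<open>\<open>Q\<^sup>\<dagger> = Q\<close>\<close>
     (\<forall>Y\<in>smooth_fields V. \<forall>Z\<in>smooth_fields V. \<forall>x\<in>V.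
        herm S x (Q_op S d Y x) (Z x) = herm S x (Y x) (Q_op S d Z x)) \<and>
     \<comment> \<open>\<open>\<kappa> Q \<kappa> = -Q\<close>\<close>
     (\<forall>Y\<in>smooth_fields V. \<forall>x\<in>V.
        kappa S x (Q_op S d (\<lambda>y. kappa S y (Y y)) x) = - Q_op S d Y x)"


section \<open>Complex manifolds and global structures\<close>

text \<open>A complex atlas is a family of charts indexed by the type \<open>'i\<close>.\<close>

record ('i, 'm, 'n) atlas =
  chart_dom :: "'i \<Rightarrow> 'm set"
  chart :: "'i \<Rightarrow> 'm \<Rightarrow> complex^'n"

definition coord_dom :: "('i, 'm, 'n::finite) atlas \<Rightarrow> 'i \<Rightarrow> (complex^'n) set" where
  "coord_dom A i = chart A i ` chart_dom A i"

definition overlap :: "('i, 'm, 'n::finite) atlas \<Rightarrow> 'i \<Rightarrow> 'i \<Rightarrow> (complex^'n) set" where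
  "overlap A i j = chart A i ` (chart_dom A i \<inter> chart_dom A j)"

definition transition :: "('i, 'm, 'n::finite) atlas \<Rightarrow> 'i \<Rightarrow> 'i \<Rightarrow> complex^'n \<Rightarrow> complex^'n" where
  "transition A i j = chart A j \<circ> inv_into (chart_dom A i) (chart A i)"

definition d_transition ::
  "('i, 'm, 'n::finite) atlas \<Rightarrow> 'i \<Rightarrow> 'i \<Rightarrow> complex^'n \<Rightarrow> complex^'n \<Rightarrow> complex^'n" where
  "d_transition A i j x = frechet_derivative (transition A i j) (at x)"

definition complex_manifold ::
  "'m::{t2_space, second_countable_topology} set \<Rightarrow> ('i, 'm, 'n::finite) atlas \<Rightarrow> bool" where
  "complex_manifold M A \<longleftrightarrow>
     (\<Union>i. chart_dom A i) = M \<and>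
     (\<forall>i. openin (top_of_set M) (chart_dom A i) \<and> open (coord_dom A i) \<and>
          homeomorphism (chart_dom A i) (coord_dom A i)
            (chart A i) (inv_into (chart_dom A i) (chart A i))) \<and>
     (\<forall>i j. transition A i j \<in> holo_fields (overlap A i j))"

definition one_connected :: "'m::topological_space set \<Rightarrow> bool" where
  "one_connected M \<longleftrightarrow> M \<noteq> {} \<and> connected M \<and> simply_connected M"

text \<open>The local expressions of \<open>g\<close>, \<open>\<circ>\<close>, \<open>e\<close>, \<open>E\<close> and \<open>\<kappa>\<close> agree on overlaps. For the connection
  coefficients this follows from the uniqueness of the Levi-Civita and Chern connections.\<close>

definition frobenius_manifold ::
  "'m::{t2_space, second_countable_topology} set \<Rightarrow> ('i, 'm, 'n::finite) atlas \<Rightarrow> complex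
   \<Rightarrow> ('i \<Rightarrow> ('n, 'z) frobenius_chart_scheme) \<Rightarrow> bool" where
  "frobenius_manifold M A d S \<longleftrightarrow>
     complex_manifold M A \<and>
     (\<forall>i. frobenius_on (coord_dom A i) d (S i)) \<and>
     (\<forall>i j. \<forall>x\<in>overlap A i j.
        let y = transition A i j x; J = d_transition A i j x in
        (\<forall>u v. pairing (S j) y (J u) (J v) = pairing (S i) x u v) \<and>
        (\<forall>u v. mult (S j) y (J u) (J v) = J (mult (S i) x u v)) \<and>
        unit_field (S j) y = J (unit_field (S i) x) \<and>
        euler (S j) y = J (euler (S i) x))"

definition cdv_structure ::
  "'m::{t2_space, second_countable_topology} set \<Rightarrow> ('i, 'm, 'n::finite) atlas \<Rightarrow> complex
   \<Rightarrow> ('i \<Rightarrow> ('n, 'z) cdv_chart_scheme) \<Rightarrow> bool" where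
  "cdv_structure M A d S \<longleftrightarrow>
     frobenius_manifold M A d S \<and>
     (\<forall>i. cdv_on (coord_dom A i) d (S i)) \<and>
     (\<forall>i j. \<forall>x\<in>overlap A i j. \<forall>u.
        kappa (S j) (transition A i j x) (d_transition A i j x u) =
          d_transition A i j x (kappa (S i) x u))"

definition cdv_plus_structure ::
  "'m::{t2_space, second_countable_topology} set \<Rightarrow> ('i, 'm, 'n::finite) atlas \<Rightarrow> complex
   \<Rightarrow> ('i \<Rightarrow> ('n, 'z) cdv_chart_scheme) \<Rightarrow> bool" where
  "cdv_plus_structure M A d S \<longleftrightarrow>
     cdv_structure M A d S \<and>
     (\<forall>i. \<forall>x\<in>coord_dom A i. \<forall>u. u \<noteq> 0 \<longrightarrow> 0 < Re (herm (S i) x u u))"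

definition semisimple ::
  "('i, 'm, 'n::finite) atlas \<Rightarrow> ('i \<Rightarrow> ('n, 'z) frobenius_chart_scheme) \<Rightarrow> bool" where
  "semisimple A S \<longleftrightarrow>
     (\<forall>i. \<forall>x\<in>coord_dom A i. card {l. \<exists>v. v \<noteq> 0 \<and> U_op (S i) x v = l *s v} = CARD('n))"

definition tate ::
  "('i, 'm, 'n::finite) atlas \<Rightarrow> complex \<Rightarrow> ('i \<Rightarrow> ('n, 'z) cdv_chart_scheme) \<Rightarrow> bool" where
  "tate A d S \<longleftrightarrow>
     (\<forall>i. \<forall>Y\<in>smooth_fields (coord_dom A i). \<forall>x\<in>coord_dom A i. Q_op (S i) d Y x = 0)"


section \<open>The bundles on \<open>\<complex> \<times> M\<close> and strong potentiality\<close>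

text \<open>Sections of the pull-back of the tangent bundle to \<open>\<complex> \<times> V\<close> are curried functions
  \<open>s z x\<close>; operators along \<open>M\<close> act on \<open>s z\<close> for fixed \<open>z\<close>.\<close>

type_synonym 'n pb_section = "complex \<Rightarrow> 'n field"

definition smooth_sections :: "(complex^'n::finite) set \<Rightarrow> 'n pb_section set" where
  "smooth_sections V = {s. smooth_on (UNIV \<times> V) (\<lambda>(z, x). s z x)}"

definition del_z :: "('n::finite) pb_section \<Rightarrow> 'n pb_section" where
  "del_z s z x = (\<chi> c. (frechet_derivative (\<lambda>w. s w x $ c) (at z) 1
                         - \<i> * frechet_derivative (\<lambda>w. s w x $ c) (at z) \<i>) / 2)"

definition delbar_z :: "('n::finite) pb_section \<Rightarrow> 'n pb_section" where
  "delbar_z s z x = (\<chi> c. (frechet_derivative (\<lambda>w. s w x $ c) (at z) 1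
                            + \<i> * frechet_derivative (\<lambda>w. s w x $ c) (at z) \<i>) / 2)"

text \<open>Components along \<open>u\<close> (tangent to \<open>M\<close>) and along \<open>\<partial>/\<partial>z\<close> of the \<open>(1,0)\<close>-parts of the two
  meromorphic connections, for \<open>z \<noteq> 0\<close>.\<close>

definition nabla_tilde_M ::
  "('n::finite, 'z) frobenius_chart_scheme \<Rightarrow> complex^'n \<Rightarrow> 'n pb_section \<Rightarrow> 'n pb_section" where
  "nabla_tilde_M S u s z x = nabla S (\<lambda>_. u) (s z) x + (1 / z) *s Phi S x u (s z x)"

definition nabla_tilde_z ::
  "('n::finite, 'z) frobenius_chart_scheme \<Rightarrow> complex \<Rightarrow> 'n pb_section \<Rightarrow> 'n pb_section" where
  "nabla_tilde_z S d s z x =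
     del_z s z x + (1 / z) *s ((1 / z) *s U_op S x (s z x) - V_op S d x (s z x))"

definition D_tilde_M ::
  "('n::finite, 'z) cdv_chart_scheme \<Rightarrow> complex^'n \<Rightarrow> 'n pb_section \<Rightarrow> 'n pb_section" where
  "D_tilde_M S u s z x = D' S (\<lambda>_. u) (s z) x + (1 / z) *s Phi S x u (s z x)"

definition D_tilde_z ::
  "('n::finite, 'z) cdv_chart_scheme \<Rightarrow> complex \<Rightarrow> 'n pb_section \<Rightarrow> 'n pb_section" where
  "D_tilde_z S d s z x =
     del_z s z x
     + (1 / z) *s ((1 / z) *s U_op S x (s z x) - Q_op S d (s z) x - z *s U_dag S x (s z x))"

text \<open>In each chart a bundle morphism is given by the matrices \<open>\<phi> z x\<close>. It is holomorphic if it
  intertwines \<open>delbar + d''\<^sub>z\<close> with \<open>delbar + z \<Phi>\<^sup>\<dagger> + d''\<^sub>z\<close>.\<close>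

definition holo_iso_on ::
  "(complex^'n) set \<Rightarrow> ('n::finite, 'z) cdv_chart_scheme
   \<Rightarrow> (complex \<Rightarrow> complex^'n \<Rightarrow> complex^'n^'n) \<Rightarrow> bool" where
  "holo_iso_on V S \<phi> \<longleftrightarrow>
     smooth_on (UNIV \<times> V) (\<lambda>(z, x). \<phi> z x) \<and>
     (\<forall>z. \<forall>x\<in>V. invertible (\<phi> z x)) \<and>
     (\<forall>s\<in>smooth_sections V. \<forall>z. \<forall>x\<in>V.
        (\<forall>u. \<phi> z x *v delbar (\<lambda>_. u) (s z) x =
               delbar (\<lambda>_. u) (\<lambda>y. \<phi> z y *v s z y) x + z *s Phi_dag S x u (\<phi> z x *v s z x)) \<and>
        \<phi> z x *v delbar_z s z x = delbar_z (\<lambda>w y. \<phi> w y *v s w y) z x)"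

definition intertwines_on ::
  "(complex^'n) set \<Rightarrow> complex \<Rightarrow> ('n::finite, 'z) cdv_chart_scheme
   \<Rightarrow> (complex \<Rightarrow> complex^'n \<Rightarrow> complex^'n^'n) \<Rightarrow> bool" where
  "intertwines_on V d S \<phi> \<longleftrightarrow>
     (\<forall>s\<in>smooth_sections V. \<forall>z. \<forall>x\<in>V. z \<noteq> 0 \<longrightarrow>
        (\<forall>u. \<phi> z x *v nabla_tilde_M S u s z x =
               D_tilde_M S u (\<lambda>w y. \<phi> w y *v s w y) z x) \<and>
        \<phi> z x *v nabla_tilde_z S d s z x = D_tilde_z S d (\<lambda>w y. \<phi> w y *v s w y) z x)"

definition strongly_potential ::
  "('i, 'm, 'n::finite) atlas \<Rightarrow> complex \<Rightarrow> ('i \<Rightarrow> ('n, 'z) cdv_chart_scheme) \<Rightarrow> bool" where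
  "strongly_potential A d S \<longleftrightarrow>
     (\<exists>\<phi> :: 'i \<Rightarrow> complex \<Rightarrow> complex^'n \<Rightarrow> complex^'n^'n.
        (\<forall>i. holo_iso_on (coord_dom A i) (S i) (\<phi> i) \<and>
             intertwines_on (coord_dom A i) d (S i) (\<phi> i)) \<and>
        (\<forall>i j z. \<forall>x\<in>overlap A i j. \<forall>v.
           \<phi> j z (transition A i j x) *v d_transition A i j x v =
             d_transition A i j x (\<phi> i z x *v v)))"

end

theory Submission
  imports Defs "HOL-Complex_Analysis.Cauchy_Integral_Formula" "HOL-Computational_Algebra.Polynomial"
begin

text \<open>
  Work in a chart. Let \<open>W = U - tr U / 2\<close>, so that \<open>W\<^sup>2 = \<delta>\<close> is a nowhere vanishing scalar. The operator \<open>V\<close> is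
  \<open>g\<close>-skew with \<open>V e = (d/2) e\<close>; in dimension two this gives \<open>V\<^sup>2 = d\<^sup>2/4\<close>, \<open>V W = - W V\<close> and \<open>\<nabla>V = 0\<close>. Since
  \<open>Q = 0\<close>, \<open>U\<^sup>\<dagger>\<close> commutes with all multiplications \<open>X\<circ> = a(X) + c(X) W\<close>, and \<open>D' = \<nabla> - c V\<close>.

  An isomorphism \<open>\<phi>\<close> can be written \<open>exp (z U\<^sup>\<dagger>) R\<close>, where \<open>R\<close> is entire in \<open>z\<close> and
  \<open>z R' + [U, R] / z + R V = 0\<close>. Comparing Taylor coefficients at a single point, such an invertible \<open>R\<close> exists
  only if \<open>d\<^sup>2/4\<close> is the square of an integer. Conversely, if \<open>d = \<plusminus>2k\<close>, there is a solution \<open>R\<close>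
  polynomial in \<open>z\<close> with \<open>R = 1\<close> at \<open>z = 0\<close>, given by a universal expression in \<open>W\<close>, \<open>V\<close> and \<open>1/\<delta>\<close>.
  It also satisfies the equations along \<open>M\<close>, and being expressed by the structure alone it is compatible
  with changes of charts, so that no choice of global canonical coordinates is involved.
\<close>

section \<open>Smooth functions\<close>

text \<open>Dimension two enters through one fact: the \<open>g\<close>-skew operators form a line.
  Hence a skew operator is traceless, is orthogonal to all self-adjoint ones for the trace form, and
  vanishes once it kills \<open>e\<close>. The identities for \<open>V\<close> and for
  \<open>D'\<close> are obtained by exhibiting a skew operator and testing it by a trace or by its
  value on \<open>e\<close>.

  The factor \<open>exp (z U\<^sup>\<dagger>)\<close> is parallel for \<open>D'\<close>, and its
  \<open>delbar\<close> produces the term with \<open>z \<Phi>\<^sup>\<dagger>\<close>. Splitting it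
  off removes the irregular pole at infinity: what is left behaves there like \<open>z\<close> to
  the power \<open>- V\<close>, with exponents \<open>d/2\<close> and \<open>- d/2\<close>. An
  entire solution is then a polynomial whose degree is an exponent, which is the origin of the
  parity condition.\<close>

lemma has_derivative_cong_open:
  assumes "open V" "x \<in> V" "\<And>y. y \<in> V \<Longrightarrow> f y = g y"
  shows "(f has_derivative f') (at x) \<longleftrightarrow> (g has_derivative f') (at x)"
  using assms has_derivative_transform_within_open[of _ _ _ _ V] by metis

lemma frechet_cong_open:
  assumes "open V" "x \<in> V" "\<And>y. y \<in> V \<Longrightarrow> f y = g y"
  shows "frechet_derivative f (at x) = frechet_derivative g (at x)"
  unfolding frechet_derivative_def using has_derivative_cong_open[OF assms] by simp

lemma frechet_eq: "(f has_derivative f') (at x) \<Longrightarrow> frechet_derivative f (at x) = f'"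
  using frechet_derivative_at by metis

lemma frechet_works: "f differentiable (at x) \<Longrightarrow> (f has_derivative frechet_derivative f (at x)) (at x)"
  using frechet_derivative_works by blast

lemma Ck_on_cong:
  assumes "open V" "\<And>y. y \<in> V \<Longrightarrow> f y = g y"
  shows "Ck_on k V f \<longleftrightarrow> Ck_on k V g"
  using assms(2)
proof (induction k arbitrary: f g)
  case 0
  then show ?case unfolding Ck_on.simps by (intro continuous_on_cong) auto
next
  case (Suc k)
  have "frechet_derivative f (at x) = frechet_derivative g (at x)" if "x \<in> V" for x
    using frechet_cong_open[OF assms(1) that] Suc.prems by blast
  then have "Ck_on k V (\<lambda>x. frechet_derivative f (at x) v) \<longleftrightarrow> Ck_on k V (\<lambda>x. frechet_derivative g (at x) v)" for v
    using Suc.IH[of "\<lambda>x. frechet_derivative f (at x) v" "\<lambda>x. frechet_derivative g (at x) v"] by metis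
  moreover have "f differentiable (at x) \<longleftrightarrow> g differentiable (at x)" if "x \<in> V" for x
    unfolding differentiable_def using has_derivative_cong_open[OF assms(1) that, of f g] Suc.prems by metis
  ultimately show ?case unfolding Ck_on.simps by metis
qed

lemma smooth_on_cong:
  assumes "open V" "\<And>y. y \<in> V \<Longrightarrow> f y = g y"
  shows "smooth_on V f \<longleftrightarrow> smooth_on V g"
  unfolding smooth_on_def using Ck_on_cong[OF assms(1), of f g] assms(2) by auto

lemma smooth_on_differentiable: "smooth_on V f \<Longrightarrow> x \<in> V \<Longrightarrow> f differentiable (at x)"
  unfolding smooth_on_def by (metis Ck_on.simps(2))

lemma smooth_on_frechet: "smooth_on V f \<Longrightarrow> smooth_on V (\<lambda>x. frechet_derivative f (at x) v)"
  unfolding smooth_on_def by (metis Ck_on.simps(2))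

lemma smooth_on_has_derivative:
  "smooth_on V f \<Longrightarrow> x \<in> V \<Longrightarrow> (f has_derivative frechet_derivative f (at x)) (at x)"
  using smooth_on_differentiable frechet_derivative_works by blast

lemma Ck_on_continuous: "Ck_on k V f \<Longrightarrow> continuous_on V f"
  by (cases k) (auto simp: continuous_on_eq_continuous_at differentiable_imp_continuous_within
      intro!: continuous_at_imp_continuous_on)

lemma Ck_on_Suc_D: "Ck_on (Suc k) V f \<Longrightarrow> Ck_on k V f"
proof (induction k arbitrary: f)
  case 0
  then show ?case using Ck_on_continuous[of "Suc 0"] by simp
qed auto

text \<open>\<open>P\<close> serves as an invariant for induction on the order of differentiability.
  Holomorphic functions become smooth through this rule, their directional derivatives being
  holomorphic again.\<close>

lemma smooth_on_coinduct:
  assumes "P f"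
    and "\<And>f. P f \<Longrightarrow> (\<forall>x\<in>V. f differentiable (at x)) \<and> (\<forall>v. P (\<lambda>x. frechet_derivative f (at x) v))"
  shows "smooth_on V f"
proof -
  have "P f \<Longrightarrow> Ck_on k V f" for k f
  proof (induction k arbitrary: f)
    case 0
    then show ?case using assms(2)[of f]
      by (auto intro!: continuous_at_imp_continuous_on differentiable_imp_continuous_within)
  next
    case (Suc k)
    then show ?case using assms(2)[of f] by auto
  qed
  then show ?thesis using assms(1) unfolding smooth_on_def by blast
qed

lemma smooth_on_const [simp]: "smooth_on V (\<lambda>x. c)"
  by (rule smooth_on_coinduct[where P = "\<lambda>f. \<exists>c. f = (\<lambda>x. c)"]) auto

lemma smooth_on_bounded_linear: "bounded_linear L \<Longrightarrow> smooth_on V L"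
proof (rule smooth_on_coinduct[where P = "\<lambda>f. bounded_linear f \<or> (\<exists>c. f = (\<lambda>x. c))"], simp)
  fix f :: "'a \<Rightarrow> 'b" assume "bounded_linear f \<or> (\<exists>c. f = (\<lambda>x. c))"
  then show "(\<forall>x\<in>V. f differentiable at x) \<and>
         (\<forall>v. bounded_linear (\<lambda>x. frechet_derivative f (at x) v) \<or>
              (\<exists>c. (\<lambda>x. frechet_derivative f (at x) v) = (\<lambda>x. c)))"
  proof
    assume "bounded_linear f"
    then show ?thesis
      using frechet_eq[OF bounded_linear_imp_has_derivative] bounded_linear_imp_differentiable by auto
  next
    assume "\<exists>c. f = (\<lambda>x. c)"
    then show ?thesis by auto
  qed
qed

lemma Ck_on_SucI:
  assumes "open V" "\<And>x. x \<in> V \<Longrightarrow> (f has_derivative f' x) (at x)" "\<And>v. Ck_on k V (\<lambda>x. f' x v)"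
  shows "Ck_on (Suc k) V f"
proof -
  have "Ck_on k V (\<lambda>x. frechet_derivative f (at x) v)" for v
    using Ck_on_cong[OF assms(1), of "\<lambda>x. frechet_derivative f (at x) v" "\<lambda>x. f' x v" k] assms(3)[of v]
    by (simp add: frechet_eq[OF assms(2)])
  then show ?thesis using assms(2) by (auto intro: differentiableI)
qed

lemma Ck_on_linear_compose:
  assumes "bounded_linear L" "open V" "Ck_on k V f"
  shows "Ck_on k V (\<lambda>x. L (f x))"
  using assms(3)
proof (induction k arbitrary: f)
  case 0
  then show ?case using bounded_linear.continuous_on[OF assms(1)] by auto
next
  case (Suc k)
  show ?case
  proof (rule Ck_on_SucI[OF assms(2)])
    show "((\<lambda>x. L (f x)) has_derivative (\<lambda>v. L (frechet_derivative f (at x) v))) (at x)" if "x \<in> V" for x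
      using Suc.prems that by (intro bounded_linear.has_derivative[OF assms(1)] frechet_works) auto
  qed (use Suc in auto)
qed

lemma smooth_on_linear_compose:
  "bounded_linear L \<Longrightarrow> open V \<Longrightarrow> smooth_on V f \<Longrightarrow> smooth_on V (\<lambda>x. L (f x))"
  unfolding smooth_on_def using Ck_on_linear_compose by blast

lemma Ck_on_compose_affine:
  fixes L :: "'a::euclidean_space \<Rightarrow> 'b::euclidean_space"
  assumes "bounded_linear L" "open V" "open W" "\<And>x. x \<in> V \<Longrightarrow> L x + a \<in> W" "Ck_on k W f"
  shows "Ck_on k V (\<lambda>x. f (L x + a))"
  using assms(5)
proof (induction k arbitrary: f)
  case 0
  have "continuous_on V (\<lambda>x. L x + a)"
    by (intro continuous_intros bounded_linear.continuous_on[OF assms(1)])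
  then show ?case using 0 continuous_on_compose2[of W f V "\<lambda>x. L x + a"] assms(4) by auto
next
  case (Suc k)
  show ?case
  proof (rule Ck_on_SucI[OF assms(2)])
    fix x assume x: "x \<in> V"
    have "((\<lambda>x. L x + a) has_derivative L) (at x)"
      using bounded_linear_imp_has_derivative[OF assms(1)] by (auto intro!: derivative_eq_intros)
    moreover have "(f has_derivative frechet_derivative f (at (L x + a))) (at (L x + a))"
      using Suc.prems assms(4)[OF x] by (intro frechet_works) auto
    ultimately show "((\<lambda>x. f (L x + a)) has_derivative (\<lambda>v. frechet_derivative f (at (L x + a)) (L v))) (at x)"
      using diff_chain_at[of "\<lambda>x. L x + a"] by (fastforce simp: o_def)
  next
    show "Ck_on k V (\<lambda>x. frechet_derivative f (at (L x + a)) (L v))" for v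
      using Suc.prems Suc.IH[of "\<lambda>x. frechet_derivative f (at x) (L v)"] by simp
  qed
qed

lemma smooth_on_compose_affine:
  fixes L :: "'a::euclidean_space \<Rightarrow> 'b::euclidean_space"
  shows "bounded_linear L \<Longrightarrow> open V \<Longrightarrow> open W \<Longrightarrow> (\<And>x. x \<in> V \<Longrightarrow> L x + a \<in> W) \<Longrightarrow>
    smooth_on W f \<Longrightarrow> smooth_on V (\<lambda>x. f (L x + a))"
  unfolding smooth_on_def using Ck_on_compose_affine by blast

lemma Ck_on_add:
  assumes "open V" "Ck_on k V f" "Ck_on k V g"
  shows "Ck_on k V (\<lambda>x. f x + g x)"
  using assms(2,3)
proof (induction k arbitrary: f g)
  case 0
  then show ?case by (auto intro: continuous_intros)
next
  case (Suc k)
  show ?case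
  proof (rule Ck_on_SucI[OF assms(1)])
    show "((\<lambda>x. f x + g x) has_derivative (\<lambda>v. frechet_derivative f (at x) v + frechet_derivative g (at x) v)) (at x)"
      if "x \<in> V" for x
      using Suc.prems that by (intro has_derivative_add frechet_works) auto
  qed (use Suc in auto)
qed

lemma smooth_on_add: "open V \<Longrightarrow> smooth_on V f \<Longrightarrow> smooth_on V g \<Longrightarrow> smooth_on V (\<lambda>x. f x + g x)"
  unfolding smooth_on_def using Ck_on_add by blast

lemma smooth_on_uminus: "open V \<Longrightarrow> smooth_on V f \<Longrightarrow> smooth_on V (\<lambda>x. - f x)"
  using smooth_on_linear_compose[OF bounded_linear_minus[OF bounded_linear_ident]] by blast

lemma smooth_on_diff: "open V \<Longrightarrow> smooth_on V f \<Longrightarrow> smooth_on V g \<Longrightarrow> smooth_on V (\<lambda>x. f x - g x)"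
  using smooth_on_add[of V f "\<lambda>x. - g x"] smooth_on_uminus[of V g] by simp

lemma smooth_on_sum:
  "open V \<Longrightarrow> (\<And>i. i \<in> I \<Longrightarrow> smooth_on V (f i)) \<Longrightarrow> smooth_on V (\<lambda>x. \<Sum>i\<in>I. f i x)"
  by (induction I rule: infinite_finite_induct) (auto intro: smooth_on_add)

lemma Ck_on_mult:
  fixes f g :: "'a::euclidean_space \<Rightarrow> 'b::real_normed_algebra"
  assumes "open V" "Ck_on k V f" "Ck_on k V g"
  shows "Ck_on k V (\<lambda>x. f x * g x)"
  using assms(2,3)
proof (induction k arbitrary: f g)
  case 0
  then show ?case by (auto intro: continuous_intros)
next
  case (Suc k)
  show ?case
  proof (rule Ck_on_SucI[OF assms(1)])
    show "((\<lambda>x. f x * g x) has_derivative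
        (\<lambda>v. f x * frechet_derivative g (at x) v + frechet_derivative f (at x) v * g x)) (at x)"
      if "x \<in> V" for x
      using Suc.prems that by (intro has_derivative_mult frechet_works) auto
    show "Ck_on k V (\<lambda>x. f x * frechet_derivative g (at x) v + frechet_derivative f (at x) v * g x)" for v
      using Suc.prems Ck_on_Suc_D[of k V f] Ck_on_Suc_D[of k V g]
      by (intro Ck_on_add[OF assms(1)] Suc.IH) simp_all
  qed
qed

lemma smooth_on_mult:
  fixes f g :: "'a::euclidean_space \<Rightarrow> 'b::real_normed_algebra"
  shows "open V \<Longrightarrow> smooth_on V f \<Longrightarrow> smooth_on V g \<Longrightarrow> smooth_on V (\<lambda>x. f x * g x)"
  unfolding smooth_on_def using Ck_on_mult by blast

text \<open>The induction varies \<open>h\<close> and keeps \<open>f\<close> fixed: the chain rule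
  replaces \<open>h\<close> by \<open>deriv h\<close>, which is holomorphic on the same
  \<open>T\<close>.\<close>

lemma Ck_on_holomorphic_compose:
  fixes f :: "'a::euclidean_space \<Rightarrow> complex"
  assumes "open V" "open T" "h holomorphic_on T" "f ` V \<subseteq> T" "smooth_on V f"
  shows "Ck_on k V (\<lambda>x. h (f x))"
  using assms(3)
proof (induction k arbitrary: h)
  case 0
  have "continuous_on V f" using assms(5) Ck_on_continuous unfolding smooth_on_def by blast
  then show ?case using 0 assms(4) continuous_on_compose2[OF holomorphic_on_imp_continuous_on] by auto
next
  case (Suc k)
  show ?case
  proof (rule Ck_on_SucI[OF assms(1)])
    fix x assume x: "x \<in> V"
    have "(h has_field_derivative deriv h (f x)) (at (f x))"
      using assms(2,4) Suc.prems x holomorphic_derivI by blast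
    then have "(h has_derivative (\<lambda>v. deriv h (f x) * v)) (at (f x))"
      by (simp add: has_field_derivative_def)
    then show "((\<lambda>x. h (f x)) has_derivative (\<lambda>v. deriv h (f x) * frechet_derivative f (at x) v)) (at x)"
      using diff_chain_at[OF smooth_on_has_derivative[OF assms(5) x]] by (fastforce simp: o_def)
  next
    show "Ck_on k V (\<lambda>x. deriv h (f x) * frechet_derivative f (at x) v)" for v
      using Suc.IH[OF holomorphic_deriv[OF Suc.prems assms(2)]] smooth_on_frechet[OF assms(5)]
      by (intro Ck_on_mult[OF assms(1)]) (simp_all add: smooth_on_def)
  qed
qed

lemma smooth_on_holomorphic_compose:
  fixes f :: "'a::euclidean_space \<Rightarrow> complex"
  shows "open V \<Longrightarrow> open T \<Longrightarrow> h holomorphic_on T \<Longrightarrow> f ` V \<subseteq> T \<Longrightarrow> smooth_on V f \<Longrightarrow> smooth_on V (\<lambda>x. h (f x))"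
  unfolding smooth_on_def[of V "\<lambda>x. h (f x)"] using Ck_on_holomorphic_compose by blast

lemma smooth_on_power:
  fixes f :: "'a::euclidean_space \<Rightarrow> complex"
  shows "open V \<Longrightarrow> smooth_on V f \<Longrightarrow> smooth_on V (\<lambda>x. f x ^ n)"
  by (induction n) (auto intro: smooth_on_mult)

lemma smooth_on_cnj: "open V \<Longrightarrow> smooth_on V f \<Longrightarrow> smooth_on V (\<lambda>x. cnj (f x))"
  using smooth_on_linear_compose[OF bounded_linear_cnj] by blast

lemma smooth_on_inverse:
  fixes f :: "'a::euclidean_space \<Rightarrow> complex"
  shows "open V \<Longrightarrow> smooth_on V f \<Longrightarrow> (\<And>x. x \<in> V \<Longrightarrow> f x \<noteq> 0) \<Longrightarrow> smooth_on V (\<lambda>x. inverse (f x))"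
  by (rule smooth_on_holomorphic_compose[of V "- {0}" inverse]) (auto intro!: holomorphic_intros)

lemma axis_eq_basis_sum:
  fixes y :: "'b::euclidean_space^'n"
  shows "y = (\<Sum>i\<in>UNIV. axis i (y $ i))"
  by (simp add: vec_eq_iff axis_def)

lemma bounded_linear_axis: "bounded_linear (axis i :: 'b::euclidean_space \<Rightarrow> 'b^'n)"
  by (intro linear_conv_bounded_linear[THEN iffD1] linearI) (auto simp: vec_eq_iff axis_def)

lemma smooth_on_vec:
  fixes f :: "'a::euclidean_space \<Rightarrow> 'b::euclidean_space^'n"
  assumes "open V"
  shows "smooth_on V f \<longleftrightarrow> (\<forall>i. smooth_on V (\<lambda>x. f x $ i))"
proof
  assume "smooth_on V f"
  then show "\<forall>i. smooth_on V (\<lambda>x. f x $ i)"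
    using smooth_on_linear_compose[OF bounded_linear_vec_nth assms] by blast
next
  assume "\<forall>i. smooth_on V (\<lambda>x. f x $ i)"
  then have "smooth_on V (\<lambda>x. \<Sum>i\<in>UNIV. axis i (f x $ i))"
    by (intro smooth_on_sum assms smooth_on_linear_compose[OF bounded_linear_axis]) auto
  then show "smooth_on V f" by (subst (asm) axis_eq_basis_sum[symmetric]) simp
qed

section \<open>Holomorphic functions of several variables\<close>

lemma holo_onD:
  assumes "holo_on V f" "x \<in> V"
  shows "(f has_derivative frechet_derivative f (at x)) (at x)"
    and "frechet_derivative f (at x) (c *s v) = c * frechet_derivative f (at x) v"
proof -
  from assms obtain f' where f': "(f has_derivative f') (at x)" "\<forall>c v. f' (c *s v) = c * f' v"
    unfolding holo_on_def by blast
  then show "(f has_derivative frechet_derivative f (at x)) (at x)"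
    "frechet_derivative f (at x) (c *s v) = c * frechet_derivative f (at x) v"
    using frechet_eq[OF f'(1)] by auto
qed

lemma holo_on_continuous: "holo_on V f \<Longrightarrow> continuous_on V f"
  using holo_onD(1) has_derivative_continuous by (blast intro: continuous_at_imp_continuous_on)

lemma bounded_linear_smult_left: "bounded_linear (\<lambda>c::complex. c *s (v::complex^'n::finite))"
  by (intro linear_conv_bounded_linear[THEN iffD1] linearI)
     (auto simp: vec_eq_iff distrib_right)

lemma norm_smult: "norm (c *s (v::complex^'n::finite)) = norm c * norm v"
  by (simp add: norm_vec_def norm_mult L2_set_right_distrib)

text \<open>Cauchy's formula for the derivative along a complex line.\<close>

lemma holo_on_frechet_integral:
  fixes v :: "complex^'n::finite"
  assumes "open V" "holo_on V f" "\<rho> > 0" "\<And>\<zeta>. norm \<zeta> \<le> \<rho> \<Longrightarrow> x + \<zeta> *s v \<in> V"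
  shows "frechet_derivative f (at x) v =
    integral {0..1} (\<lambda>t. exp (- (2 * of_real pi * \<i> * of_real t)) / \<rho> * f (x + (\<rho> * exp (2 * of_real pi * \<i>
        * of_real t)) *s v))"
proof -
  define g where "g \<zeta> = f (x + \<zeta> *s v)" for \<zeta>
  have gd: "(g has_field_derivative frechet_derivative f (at (x + \<zeta> *s v)) v) (at \<zeta>)" if "norm \<zeta> \<le> \<rho>" for \<zeta>
  proof -
    have 1: "((\<lambda>\<zeta>. x + \<zeta> *s v) has_derivative (\<lambda>h. h *s v)) (at \<zeta>)"
      using bounded_linear_imp_has_derivative[OF bounded_linear_smult_left] by (auto intro!: derivative_eq_intros)
    have "(g has_derivative (\<lambda>h. frechet_derivative f (at (x + \<zeta> *s v)) (h *s v))) (at \<zeta>)"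
      using diff_chain_at[OF 1 holo_onD(1)[OF assms(2) assms(4)[OF that]]] by (simp add: o_def g_def[abs_def])
    then show ?thesis
      by (simp add: has_field_derivative_def holo_onD(2)[OF assms(2) assms(4)[OF that]] mult.commute[of _
          "frechet_derivative f (at (x + \<zeta> *s v)) v"])
  qed
  have hol: "g holomorphic_on ball 0 \<rho>"
    unfolding holomorphic_on_def field_differentiable_def using gd DERIV_subset by (meson UNIV_I
        has_field_derivative_at_within less_imp_le mem_ball_0)
  have cont: "continuous_on (cball 0 \<rho>) g"
    by (intro continuous_at_imp_continuous_on) (use gd DERIV_isCont in force)
  have "(g has_field_derivative (1 / (2 * of_real pi * \<i>) * contour_integral (circlepath 0 \<rho>) (\<lambda>u. g u /
      (u-0)^2))) (at 0)"
    using Cauchy_derivative_integral_circlepath(2)[OF cont hol, of 0] \<open>\<rho> > 0\<close> by simp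
  with gd[of 0] have "frechet_derivative f (at x) v =
      1 / (2 * of_real pi * \<i>) * contour_integral (circlepath 0 \<rho>) (\<lambda>u. g u / u^2)"
    using DERIV_unique \<open>\<rho> > 0\<close> by (simp add: less_imp_le)
  also have "\<dots> = 1 / (2 * of_real pi * \<i>) * integral {0..1} (\<lambda>t. g (circlepath 0 \<rho> t) / (circlepath 0 \<rho> t)^2
      * vector_derivative (circlepath 0 \<rho>) (at t))"
    by (simp add: contour_integral_integral)
  also have "\<dots> = integral {0..1} (\<lambda>t. 1 / (2 * of_real pi * \<i>) * (g (circlepath 0 \<rho> t) / (circlepath 0 \<rho>
      t)^2 * vector_derivative (circlepath 0 \<rho>) (at t)))"
    by (simp only: integral_mult_right)
  also have "\<dots> = integral {0..1} (\<lambda>t. exp (- (2 * of_real pi * \<i> * of_real t)) / \<rho> * g (\<rho> * exp (2 * of_real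
      pi * \<i> * of_real t)))"
    using \<open>\<rho> > 0\<close>
    by (intro integral_cong, simp only: vector_derivative_circlepath)
      (simp add: circlepath field_simps power2_eq_square exp_minus)
  finally show ?thesis by (simp add: g_def)
qed

text \<open>One radius has to serve all base points near \<open>x0\<close>, so that Cauchy's formula
  can be studied as an integral depending on the parameter \<open>x\<close>.\<close>

lemma holo_on_frechet_local:
  fixes v :: "complex^'n::finite"
  assumes "open V" "x0 \<in> V"
  obtains r \<rho> where "r > 0" "\<rho> > 0" "ball x0 r \<subseteq> V" "\<And>x \<zeta>. x \<in> ball x0 r \<Longrightarrow> norm \<zeta> \<le> \<rho> \<Longrightarrow> x + \<zeta> *s v \<in> V"
proof -
  from assms obtain e where e: "e > 0" "ball x0 e \<subseteq> V" using openE by blast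
  \<comment> \<open>The summand 1 covers \<open>v = 0\<close> and keeps the circle within distance
    \<open>e / 2\<close> of its centre.\<close>
  define \<rho> where "\<rho> = e / (2 * (norm v + 1))"
  have *: "\<rho> * norm v < e / 2" "\<rho> > 0" using e by (auto simp: \<rho>_def field_simps add_strict_increasing)
  have "x + \<zeta> *s v \<in> V" if "x \<in> ball x0 (e/2)" "norm \<zeta> \<le> \<rho>" for x \<zeta>
  proof -
    have "norm (\<zeta> *s v) \<le> \<rho> * norm v" using that by (simp add: norm_smult mult_right_mono)
    then have "dist x (x + \<zeta> *s v) < e/2" using * by (simp add: dist_norm)
    then have "dist x0 (x + \<zeta> *s v) < e" using that dist_triangle[of x0 "x + \<zeta> *s v" x] by simp
    then show ?thesis using e by auto
  qed
  moreover have "ball x0 (e/2) \<subseteq> V" using e by auto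
  ultimately show ?thesis using that[of "e/2" \<rho>] e * by auto
qed

text \<open>\<open>holo_on\<close> asks only for complex differentiability at each point, so
  continuity of the derivative has to be drawn from Cauchy's integral.
  \<open>holo_on_frechet\<close> needs it in order to differentiate under the integral sign.\<close>

lemma holo_on_frechet_continuous:
  assumes "open V" "holo_on V f"
  shows "continuous_on V (\<lambda>x. frechet_derivative f (at x) v)"
proof (intro continuous_at_imp_continuous_on ballI)
  fix x0 assume "x0 \<in> V"
  then obtain r \<rho> where r: "r > 0" "\<rho> > 0" "ball x0 r \<subseteq> V" "\<And>x \<zeta>. x \<in> ball x0 r \<Longrightarrow> norm \<zeta> \<le> \<rho> \<Longrightarrow> x + \<zeta> *s v \<in> V"
    using holo_on_frechet_local[OF assms(1), of x0 v] by metis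
  let ?F = "\<lambda>x t. exp (- (2 * of_real pi * \<i> * of_real t)) / \<rho> * f (x + (\<rho> * exp (2 * of_real pi * \<i> *
      of_real t)) *s v)"
  have in_V: "x + (\<rho> * exp (2 * of_real pi * \<i> * of_real t)) *s v \<in> V" if "x \<in> ball x0 r" for x t
    using that r(2) by (intro r(4)) (auto simp: norm_mult)
  have "continuous_on (ball x0 r \<times> cbox 0 1) (\<lambda>(x, t). ?F x t)"
    unfolding case_prod_beta using r(2) in_V
    by (intro continuous_intros continuous_on_compose2[OF holo_on_continuous[OF assms(2)]]
        bounded_linear.continuous_on[OF bounded_linear_smult_left]) auto
  then have "continuous_on (ball x0 r) (\<lambda>x. integral (cbox 0 1) (?F x))"
    by (rule integral_continuous_on_param)
  then have "continuous_on (ball x0 r) (\<lambda>x. frechet_derivative f (at x) v)"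
    by (rule continuous_on_eq) (simp add: holo_on_frechet_integral[OF assms r(2) r(4)])
  then show "isCont (\<lambda>x. frechet_derivative f (at x) v) x0"
    using r(1) by (simp add: continuous_on_eq_continuous_at)
qed

text \<open>Cauchy's formula can be differentiated under the integral, and the integrand has a
  complex linear derivative. This gives the closure that \<open>smooth_on_coinduct\<close> asks
  for.\<close>

lemma holo_on_frechet:
  assumes "open V" "holo_on V f"
  shows "holo_on V (\<lambda>x. frechet_derivative f (at x) v)"
  unfolding holo_on_def
proof
  fix x0 assume "x0 \<in> V"
  then obtain r \<rho> where r: "r > 0" "\<rho> > 0" "ball x0 r \<subseteq> V" "\<And>x \<zeta>. x \<in> ball x0 r \<Longrightarrow> norm \<zeta> \<le> \<rho> \<Longrightarrow> x + \<zeta> *s v \<in> V"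
    using holo_on_frechet_local[OF assms(1), of x0 v] by metis
  let ?e = "\<lambda>t::real. (\<rho> * exp (2 * of_real pi * \<i> * of_real t)) *s v"
  let ?w = "\<lambda>t::real. exp (- (2 * of_real pi * \<i> * of_real t)) / \<rho>"
  let ?F = "\<lambda>x t. ?w t * f (x + ?e t)"
  \<comment> \<open>The Leibniz rule for parameter integrals takes the derivative as a continuous
    map into the space of bounded linear maps; continuity there is checked on basis vectors.\<close>
  define D where "D x = Blinfun (frechet_derivative f (at x))" for x
  have D: "blinfun_apply (D x) = frechet_derivative f (at x)" if "x \<in> V" for x
    unfolding D_def by (rule bounded_linear_Blinfun_apply) (rule has_derivative_bounded_linear[OF
        holo_onD(1)[OF assms(2) that]])
  have cD: "continuous_on V D"
  proof (rule continuous_on_blinfun_componentwise)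
    fix i :: "complex^'a" assume "i \<in> Basis"
    show "continuous_on V (\<lambda>x. blinfun_apply (D x) i)"
      by (rule continuous_on_eq[OF holo_on_frechet_continuous[OF assms, of i]]) (simp add: D)
  qed
  have in_V: "x + ?e t \<in> V" if "x \<in> ball x0 r" for x t
    using that r(2) by (intro r(4)) (auto simp: norm_mult)
  have contF: "continuous_on (ball x0 r \<times> cbox 0 1) (\<lambda>(x, t). ?F x t)"
    unfolding case_prod_beta using r(2) in_V
    by (intro continuous_intros continuous_on_compose2[OF holo_on_continuous[OF assms(2)]]
        bounded_linear.continuous_on[OF bounded_linear_smult_left]) auto
  define fx where "fx x t = blinfun_compose (blinfun_mult_right (?w t)) (D (x + ?e t))" for x t
  have contfx: "continuous_on (ball x0 r \<times> cbox 0 1) (\<lambda>(x, t). fx x t)"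
    unfolding case_prod_beta fx_def using r(2) in_V
    by (intro continuous_intros continuous_on_compose2[OF cD] bounded_linear.continuous_on[OF
        bounded_linear_smult_left]
       bounded_linear.continuous_on[OF bounded_linear_blinfun_mult_right]
       bounded_bilinear.continuous_on[OF bounded_bilinear_blinfun_compose]) auto
  have x0: "x0 \<in> ball x0 r" using r by simp
  have der: "((\<lambda>x. integral (cbox 0 1) (?F x)) has_derivative integral (cbox 0 1) (fx x0)) (at x0 within ball x0 r)"
  proof (rule leibniz_rule[OF _ _ contfx x0 convex_ball])
    fix x t assume x: "x \<in> ball x0 r" and "t \<in> cbox (0::real) 1"
    have "((\<lambda>x. x + ?e t) has_derivative (\<lambda>h. h)) (at x)" by (auto intro!: derivative_eq_intros)
    then have "((\<lambda>x. f (x + ?e t)) has_derivative frechet_derivative f (at (x + ?e t))) (at x)"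
      using diff_chain_at[where f = "\<lambda>x. x + ?e t" and g = f] holo_onD(1)[OF assms(2) in_V[OF x]]
      by (fastforce simp: o_def)
    then have "((\<lambda>x. ?F x t) has_derivative (\<lambda>h. ?w t * frechet_derivative f (at (x + ?e t)) h)) (at x)"
      by (rule has_derivative_mult_right)
    moreover have "blinfun_apply (fx x t) = (\<lambda>h. ?w t * frechet_derivative f (at (x + ?e t)) h)"
      by (rule ext) (simp add: fx_def D[OF in_V[OF x]])
    ultimately show "((\<lambda>x. ?F x t) has_derivative blinfun_apply (fx x t)) (at x within ball x0 r)"
      using has_derivative_at_withinI by simp
  next
    fix x assume "x \<in> ball x0 r"
    then have "continuous_on (cbox 0 1) (\<lambda>t. (\<lambda>(x, t). ?F x t) (x, t))"
      by (intro continuous_on_compose2[OF contF]) (auto intro!: continuous_intros)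
    then show "?F x integrable_on cbox 0 1" unfolding prod.case by (rule integrable_continuous)
  qed
  have "continuous_on (cbox 0 1) (\<lambda>t. (\<lambda>(x, t). fx x t) (x0, t))"
    using x0 by (intro continuous_on_compose2[OF contfx]) (auto intro!: continuous_intros)
  then have int: "fx x0 integrable_on cbox 0 1" unfolding prod.case by (rule integrable_continuous)
  have ev: "blinfun_apply (integral (cbox 0 1) (fx x0)) h = integral (cbox 0 1) (\<lambda>t. blinfun_apply (fx x0 t) h)" for h
    using integral_linear[OF int blinfun.bounded_linear_left[of h]] by (simp add: o_def)
  have lin: "blinfun_apply (integral (cbox 0 1) (fx x0)) (c *s h) =
      c * blinfun_apply (integral (cbox 0 1) (fx x0)) h" for c h
  proof -
    have "blinfun_apply (fx x0 t) (c *s h) = c * blinfun_apply (fx x0 t) h" for t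
      by (simp add: fx_def D[OF in_V[OF x0]] holo_onD(2)[OF assms(2) in_V[OF x0]])
    then show ?thesis unfolding ev by simp
  qed
  have "((\<lambda>x. integral (cbox 0 1) (?F x)) has_derivative integral (cbox 0 1) (fx x0)) (at x0)"
    using der at_within_open[OF x0 open_ball] by simp
  then have "((\<lambda>x. frechet_derivative f (at x) v) has_derivative integral (cbox 0 1) (fx x0)) (at x0)"
    by (rule has_derivative_transform_within_open[OF _ open_ball x0]) (simp add: holo_on_frechet_integral[OF
        assms r(2) r(4)])
  then show "\<exists>f'. ((\<lambda>x. frechet_derivative f (at x) v) has_derivative f') (at x0) \<and> (\<forall>c v. f' (c *s v) = c * f' v)"
    using lin by blast
qed

lemma holo_on_smooth: "open V \<Longrightarrow> holo_on V f \<Longrightarrow> smooth_on V f"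
  by (rule smooth_on_coinduct[where P = "holo_on V"])
     (auto simp: holo_on_frechet intro: differentiableI holo_onD(1))

lemma holo_on_const [simp]: "holo_on V (\<lambda>x. c)"
  unfolding holo_on_def by (auto intro!: exI[of _ "\<lambda>x. 0"])

lemma holo_on_add: "holo_on V f \<Longrightarrow> holo_on V g \<Longrightarrow> holo_on V (\<lambda>x. f x + g x)"
  unfolding holo_on_def
proof
  fix x assume "\<forall>x\<in>V. \<exists>f'. (f has_derivative f') (at x) \<and> (\<forall>c v. f' (c *s v) = c * f' v)"
    "\<forall>x\<in>V. \<exists>f'. (g has_derivative f') (at x) \<and> (\<forall>c v. f' (c *s v) = c * f' v)" "x \<in> V"
  then obtain f' g' where "(f has_derivative f') (at x)" "\<forall>c v. f' (c *s v) = c * f' v"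
    "(g has_derivative g') (at x)" "\<forall>c v. g' (c *s v) = c * g' v" by blast
  then show "\<exists>f'. ((\<lambda>x. f x + g x) has_derivative f') (at x) \<and> (\<forall>c v. f' (c *s v) = c * f' v)"
    by (intro exI[of _ "\<lambda>h. f' h + g' h"]) (auto intro!: has_derivative_add simp: algebra_simps)
qed

lemma holo_on_mult: "holo_on V f \<Longrightarrow> holo_on V g \<Longrightarrow> holo_on V (\<lambda>x. f x * g x)"
  unfolding holo_on_def
proof
  fix x assume "\<forall>x\<in>V. \<exists>f'. (f has_derivative f') (at x) \<and> (\<forall>c v. f' (c *s v) = c * f' v)"
    "\<forall>x\<in>V. \<exists>f'. (g has_derivative f') (at x) \<and> (\<forall>c v. f' (c *s v) = c * f' v)" "x \<in> V"
  then obtain f' g' where "(f has_derivative f') (at x)" "\<forall>c v. f' (c *s v) = c * f' v"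
    "(g has_derivative g') (at x)" "\<forall>c v. g' (c *s v) = c * g' v" by blast
  then show "\<exists>f'. ((\<lambda>x. f x * g x) has_derivative f') (at x) \<and> (\<forall>c v. f' (c *s v) = c * f' v)"
    by (intro exI[of _ "\<lambda>h. f x * g' h + f' h * g x"]) (auto intro!: has_derivative_mult simp: algebra_simps)
qed

lemma holo_on_uminus: "holo_on V f \<Longrightarrow> holo_on V (\<lambda>x. - f x)"
  using holo_on_mult[of V "\<lambda>x. -1" f] by simp

lemma holo_on_diff: "holo_on V f \<Longrightarrow> holo_on V g \<Longrightarrow> holo_on V (\<lambda>x. f x - g x)"
  using holo_on_add[of V f "\<lambda>x. - g x"] holo_on_uminus[of V g] by simp

lemma holo_on_sum: "(\<And>i. i \<in> I \<Longrightarrow> holo_on V (f i)) \<Longrightarrow> holo_on V (\<lambda>x. \<Sum>i\<in>I. f i x)"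
  by (induction I rule: infinite_finite_induct) (auto intro: holo_on_add)

lemma has_derivative_holomorphic_compose:
  assumes "(f has_derivative f') (at x)" "(h has_field_derivative h') (at (f x))"
  shows "((\<lambda>y. h (f y)) has_derivative (\<lambda>v. h' * f' v)) (at x)"
  using diff_chain_at[OF assms(1), of h "\<lambda>v. h' * v"] assms(2)
  by (simp add: has_field_derivative_def o_def)

lemma holo_on_compose:
  assumes "holo_on V f" "open T" "h holomorphic_on T" "f ` V \<subseteq> T"
  shows "holo_on V (\<lambda>x. h (f x))"
  unfolding holo_on_def
proof
  fix x assume x: "x \<in> V"
  then have "(h has_field_derivative deriv h (f x)) (at (f x))"
    using assms holomorphic_derivI by blast
  from has_derivative_holomorphic_compose[OF holo_onD(1)[OF assms(1) x] this]
  show "\<exists>f'. ((\<lambda>x. h (f x)) has_derivative f') (at x) \<and> (\<forall>c v. f' (c *s v) = c * f' v)"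
    using holo_onD(2)[OF assms(1) x] by (auto intro!: exI)
qed

lemma holo_on_inverse: "holo_on V f \<Longrightarrow> (\<And>x. x \<in> V \<Longrightarrow> f x \<noteq> 0) \<Longrightarrow> holo_on V (\<lambda>x. inverse (f x))"
  by (rule holo_on_compose[of V f "- {0}" inverse]) (auto intro!: holomorphic_intros)

lemma holo_on_cong: "open V \<Longrightarrow> (\<And>x. x \<in> V \<Longrightarrow> f x = g x) \<Longrightarrow> holo_on V f \<longleftrightarrow> holo_on V g"
  unfolding holo_on_def using has_derivative_cong_open[of V _ f g] by metis

lemma holo_on_local:
  assumes "\<And>x. x \<in> V \<Longrightarrow> \<exists>U. open U \<and> x \<in> U \<and> holo_on U f"
  shows "holo_on V f"
  using assms unfolding holo_on_def by meson

section \<open>Wirtinger derivatives\<close>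

lemma deriv10_eq: "(f has_derivative f') (at x) \<Longrightarrow> deriv10 u f x = (f' u - \<i> * f' (\<i> *s u)) / 2"
  unfolding deriv10_def by (simp add: frechet_eq)

lemma deriv01_eq: "(f has_derivative f') (at x) \<Longrightarrow> deriv01 u f x = (f' u + \<i> * f' (\<i> *s u)) / 2"
  unfolding deriv01_def by (simp add: frechet_eq)

lemma deriv_const [simp]: "deriv10 u (\<lambda>x. c) x = 0" "deriv01 u (\<lambda>x. c) x = 0"
  by (simp_all add: deriv10_def deriv01_def)

lemma deriv_cong_open:
  assumes "open V" "x \<in> V" "\<And>y. y \<in> V \<Longrightarrow> f y = g y"
  shows "deriv10 u f x = deriv10 u g x" "deriv01 u f x = deriv01 u g x"
  using frechet_cong_open[OF assms] by (simp_all add: deriv10_def deriv01_def)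

lemma deriv_add:
  assumes "f differentiable (at x)" "g differentiable (at x)"
  shows "deriv10 u (\<lambda>y. f y + g y) x = deriv10 u f x + deriv10 u g x"
    "deriv01 u (\<lambda>y. f y + g y) x = deriv01 u f x + deriv01 u g x"
  unfolding deriv10_eq[OF has_derivative_add[OF frechet_works[OF assms(1)] frechet_works[OF assms(2)]]]
    deriv01_eq[OF has_derivative_add[OF frechet_works[OF assms(1)] frechet_works[OF assms(2)]]]
  by (simp_all add: deriv10_def deriv01_def algebra_simps add_divide_distrib diff_divide_distrib)

lemma deriv_mult:
  assumes "f differentiable (at x)" "g differentiable (at x)"
  shows "deriv10 u (\<lambda>y. f y * g y) x = deriv10 u f x * g x + f x * deriv10 u g x"
    "deriv01 u (\<lambda>y. f y * g y) x = deriv01 u f x * g x + f x * deriv01 u g x"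
  unfolding deriv10_eq[OF has_derivative_mult[OF frechet_works[OF assms(1)] frechet_works[OF assms(2)]]]
    deriv01_eq[OF has_derivative_mult[OF frechet_works[OF assms(1)] frechet_works[OF assms(2)]]]
  by (simp_all add: deriv10_def deriv01_def algebra_simps add_divide_distrib diff_divide_distrib)

lemma deriv_uminus:
  assumes "f differentiable (at x)"
  shows "deriv10 u (\<lambda>y. - f y) x = - deriv10 u f x" "deriv01 u (\<lambda>y. - f y) x = - deriv01 u f x"
  using deriv_mult[of "\<lambda>_. -1", OF _ assms] by auto

lemma deriv_diff:
  assumes "f differentiable (at x)" "g differentiable (at x)"
  shows "deriv10 u (\<lambda>y. f y - g y) x = deriv10 u f x - deriv10 u g x"
    "deriv01 u (\<lambda>y. f y - g y) x = deriv01 u f x - deriv01 u g x"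
  using deriv_add[OF assms(1), of "\<lambda>y. - g y"] deriv_uminus[OF assms(2)] assms(2) by auto

lemma deriv_sum:
  assumes "\<And>i. i \<in> I \<Longrightarrow> f i differentiable (at x)"
  shows "deriv10 u (\<lambda>y. \<Sum>i\<in>I. f i y) x = (\<Sum>i\<in>I. deriv10 u (f i) x)"
    "deriv01 u (\<lambda>y. \<Sum>i\<in>I. f i y) x = (\<Sum>i\<in>I. deriv01 u (f i) x)"
  using assms by (induction I rule: infinite_finite_induct) (auto simp: deriv_add)

lemma deriv_holomorphic_compose:
  assumes "f differentiable (at x)" "(h has_field_derivative h') (at (f x))"
  shows "deriv10 u (\<lambda>y. h (f y)) x = h' * deriv10 u f x" "deriv01 u (\<lambda>y. h (f y)) x = h' * deriv01 u f x"
  unfolding deriv10_eq[OF has_derivative_holomorphic_compose[OF frechet_works[OF assms(1)] assms(2)]]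
    deriv01_eq[OF has_derivative_holomorphic_compose[OF frechet_works[OF assms(1)] assms(2)]]
  by (simp_all add: deriv10_def deriv01_def algebra_simps)

lemma deriv01_holo: "holo_on V f \<Longrightarrow> x \<in> V \<Longrightarrow> deriv01 u f x = 0"
  by (simp add: deriv01_def holo_onD(2) mult.assoc[symmetric])

lemma deriv10_holo: "holo_on V f \<Longrightarrow> x \<in> V \<Longrightarrow> deriv10 u f x = frechet_derivative f (at x) u"
  by (simp add: deriv10_def holo_onD(2) mult.assoc[symmetric])

lemma smooth_on_deriv:
  assumes "open V" "smooth_on V f"
  shows "smooth_on V (\<lambda>x. deriv10 u f x)" "smooth_on V (\<lambda>x. deriv01 u f x)"
  unfolding deriv10_def deriv01_def divide_inverse
  by (intro smooth_on_mult smooth_on_diff smooth_on_add smooth_on_const smooth_on_frechet assms)+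

section \<open>Derivatives of matrix-valued functions\<close>

definition mderiv10 :: "complex^'n::finite \<Rightarrow> (complex^'n \<Rightarrow> complex^'n^'n) \<Rightarrow> complex^'n \<Rightarrow> complex^'n^'n" where
  "mderiv10 u F x = (\<chi> a b. deriv10 u (\<lambda>y. F y $ a $ b) x)"

definition mderiv01 :: "complex^'n::finite \<Rightarrow> (complex^'n \<Rightarrow> complex^'n^'n) \<Rightarrow> complex^'n \<Rightarrow> complex^'n^'n" where
  "mderiv01 u F x = (\<chi> a b. deriv01 u (\<lambda>y. F y $ a $ b) x)"

lemma del_mult_vec:
  fixes F :: "complex^'n::finite \<Rightarrow> complex^'n^'n"
  assumes "\<And>a b. (\<lambda>y. F y $ a $ b) differentiable (at x)" "\<And>b. (\<lambda>y. s y $ b) differentiable (at x)"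
  shows "del X (\<lambda>y. F y *v s y) x = mderiv10 (X x) F x *v s x + F x *v del X s x"
    "delbar X (\<lambda>y. F y *v s y) x = mderiv01 (X x) F x *v s x + F x *v delbar X s x"
proof -
  have 1: "(\<lambda>y. (F y *v s y) $ c) = (\<lambda>y. \<Sum>b\<in>UNIV. F y $ c $ b * s y $ b)" for c
    by (simp add: matrix_vector_mult_def)
  show "del X (\<lambda>y. F y *v s y) x = mderiv10 (X x) F x *v s x + F x *v del X s x"
    unfolding del_def 1 using assms
    by (simp add: vec_eq_iff deriv_sum deriv_mult matrix_vector_mult_def mderiv10_def sum.distrib)
  show "delbar X (\<lambda>y. F y *v s y) x = mderiv01 (X x) F x *v s x + F x *v delbar X s x"
    unfolding delbar_def 1 using assms
    by (simp add: vec_eq_iff deriv_sum deriv_mult matrix_vector_mult_def mderiv01_def sum.distrib)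
qed

lemma mderiv01_holo:
  "(\<And>a b. holo_on V (\<lambda>y. F y $ a $ b)) \<Longrightarrow> x \<in> V \<Longrightarrow> mderiv01 u F x = 0"
  using deriv01_holo[of V _ x u] by (simp add: mderiv01_def vec_eq_iff)

lemma del_const [simp]: "del X (\<lambda>_. c) x = 0" "delbar X (\<lambda>_. c) x = 0"
  by (simp_all add: del_def delbar_def vec_eq_iff)

lemma del_cong_open:
  assumes "open V" "x \<in> V" "\<And>y. y \<in> V \<Longrightarrow> s y = t y"
  shows "del X s x = del X t x" "delbar X s x = delbar X t x"
  using deriv_cong_open[OF assms(1,2), of "\<lambda>y. s y $ c" "\<lambda>y. t y $ c" for c] assms(3)
  by (simp_all add: del_def delbar_def vec_eq_iff)

lemma smooth_on_component: "open V \<Longrightarrow> smooth_on V s \<Longrightarrow> smooth_on V (\<lambda>y. (s y :: complex^'n) $ b)"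
  by (simp add: smooth_on_vec)

lemma smooth_on_matrix_vector:
  fixes F :: "'a::euclidean_space \<Rightarrow> complex^'n^'m"
  assumes "open V" "smooth_on V F" "smooth_on V s"
  shows "smooth_on V (\<lambda>y. F y *v s y)"
proof -
  have "smooth_on V (\<lambda>y. F y $ a $ b)" for a b
    using assms(1,2) by (simp add: smooth_on_vec)
  moreover have "smooth_on V (\<lambda>y. s y $ b)" for b
    using assms(1,3) by (simp add: smooth_on_vec)
  ultimately show ?thesis
    using assms(1) by (subst smooth_on_vec) (auto simp: matrix_vector_mult_def intro!: smooth_on_sum smooth_on_mult)
qed

lemma smooth_on_matrix_mult:
  fixes F :: "'a::euclidean_space \<Rightarrow> complex^'n^'m" and G :: "'a \<Rightarrow> complex^'l^'n"
  assumes "open V" "smooth_on V F" "smooth_on V G"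
  shows "smooth_on V (\<lambda>y. F y ** G y)"
proof -
  have "smooth_on V (\<lambda>y. F y $ a $ b)" for a b
    using assms(1,2) by (simp add: smooth_on_vec)
  moreover have "smooth_on V (\<lambda>y. G y $ a $ b)" for a b
    using assms(1,3) by (simp add: smooth_on_vec)
  ultimately have "smooth_on V (\<lambda>y. (F y ** G y) $ a $ b)" for a b
    using assms(1) by (auto simp: matrix_matrix_mult_def intro!: smooth_on_sum smooth_on_mult)
  then show ?thesis using assms(1) by (simp add: smooth_on_vec)
qed

lemma smooth_on_matrix:
  fixes F :: "'a::euclidean_space \<Rightarrow> complex^'n^'m"
  assumes "open V" "\<And>a b. smooth_on V (\<lambda>y. F y $ a $ b)"
  shows "smooth_on V F"
  using assms by (simp add: smooth_on_vec)

lemma smooth_on_conj_vec: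
  assumes "open V" "smooth_on V s"
  shows "smooth_on V (\<lambda>y. conj_vec (s y))"
  using smooth_on_component[OF assms] assms(1)
  by (subst smooth_on_vec) (auto simp: conj_vec_def intro!: smooth_on_cnj)

lemma smooth_on_del:
  assumes "open V" "smooth_on V s"
  shows "smooth_on V (\<lambda>x. del (\<lambda>_. u) s x)" "smooth_on V (\<lambda>x. delbar (\<lambda>_. u) s x)"
  using smooth_on_component[OF assms] assms(1)
  by (auto simp: smooth_on_vec[OF assms(1)] del_def delbar_def intro!: smooth_on_deriv)

section \<open>Special functions\<close>

text \<open>The entire functions \<open>cosh (sqrt s)\<close> and \<open>sinh (sqrt s) / sqrt s\<close>.\<close>

definition ch_coeff :: "nat \<Rightarrow> complex" where "ch_coeff n = inverse (fact (2 * n))"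
definition sh_coeff :: "nat \<Rightarrow> complex" where "sh_coeff n = inverse (fact (2 * n + 1))"
definition ch :: "complex \<Rightarrow> complex" where "ch s = (\<Sum>n. ch_coeff n * s ^ n)"
definition sh :: "complex \<Rightarrow> complex" where "sh s = (\<Sum>n. sh_coeff n * s ^ n)"

lemma summable_ch_sh:
  "summable (\<lambda>n. ch_coeff n * s ^ n)" "summable (\<lambda>n. sh_coeff n * s ^ n)"
proof -
  have e: "summable (\<lambda>n. inverse (fact n) * norm s ^ n)"
    by (rule summable_exp)
  have le: "inverse (fact (2*n)::real) \<le> inverse (fact n)" "inverse (fact (2*n+1)::real) \<le> inverse (fact n)" for n
    by (intro le_imp_inverse_le fact_mono; simp)+
  show "summable (\<lambda>n. ch_coeff n * s ^ n)"
    by (rule summable_comparison_test'[OF e, of 0])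
       (auto simp: ch_coeff_def norm_mult norm_power norm_inverse intro!: mult_right_mono le)
  show "summable (\<lambda>n. sh_coeff n * s ^ n)"
    using le(2) by (intro summable_comparison_test'[OF e, of 0])
       (auto simp: sh_coeff_def norm_mult norm_power norm_inverse simp del: fact_Suc intro!: mult_right_mono)
qed

lemma diffs_ch_coeff: "diffs ch_coeff n = sh_coeff n / 2"
proof -
  have "2 * (of_nat (Suc n) * ch_coeff (Suc n)) = sh_coeff n"
  proof -
    have "(fact (2 * Suc n) :: complex) = 2 * of_nat (Suc n) * fact (2 * n + 1)"
      by (simp add: algebra_simps)
    moreover have "of_nat (Suc n) \<noteq> (0::complex)" by (simp only: of_nat_eq_0_iff)
    moreover have "2 * (N * inverse (2 * N * F)) = inverse F" if "N \<noteq> 0" for N F :: complex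
      using that by (simp add: field_simps)
    ultimately show ?thesis unfolding ch_coeff_def sh_coeff_def by metis
  qed
  then show ?thesis by (simp add: diffs_def field_simps)
qed

lemma DERIV_ch: "(ch has_field_derivative sh s / 2) (at s)"
proof -
  have "((\<lambda>s. \<Sum>n. ch_coeff n * s ^ n) has_field_derivative (\<Sum>n. diffs ch_coeff n * s ^ n)) (at s)"
    by (rule termdiffs_strong_converges_everywhere) (rule summable_ch_sh)
  moreover have "(\<Sum>n. diffs ch_coeff n * s ^ n) = sh s / 2"
    unfolding sh_def by (subst suminf_divide[OF summable_ch_sh(2), symmetric]) (simp add: diffs_ch_coeff)
  ultimately show ?thesis by (simp add: ch_def[abs_def])
qed

definition sh' :: "complex \<Rightarrow> complex" where "sh' s = (\<Sum>n. diffs sh_coeff n * s ^ n)"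

lemma DERIV_sh: "(sh has_field_derivative sh' s) (at s)"
  unfolding sh_def[abs_def] sh'_def
  by (rule termdiffs_strong_converges_everywhere) (rule summable_ch_sh)

text \<open>For \<open>s = \<sigma>\<^sup>2\<close> this is the fact that
  \<open>sinh \<sigma> = \<sigma> * sh (\<sigma>\<^sup>2)\<close> has derivative
  \<open>cosh \<sigma>\<close>. It serves to eliminate \<open>sh'\<close> from later
  formulas.\<close>

lemma sh'_eq: "sh s + 2 * s * sh' s = ch s"
proof -
  have sd: "(\<lambda>n. diffs sh_coeff n * s ^ n) sums sh' s"
    unfolding sh'_def using termdiff_converges_all[OF summable_ch_sh(2)] by (simp add: summable_sums)
  have "(\<lambda>n. s * (diffs sh_coeff n * s ^ n)) sums (s * sh' s)"
    by (rule sums_mult[OF sd])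
  then have "(\<lambda>n. of_nat (Suc n) * sh_coeff (Suc n) * s ^ Suc n) sums (s * sh' s)"
    by (simp add: diffs_def mult_ac)
  then have "(\<lambda>n. of_nat n * sh_coeff n * s ^ n) sums (s * sh' s)"
    by (subst (asm) sums_Suc_iff) simp
  then have "(\<lambda>n. sh_coeff n * s ^ n + 2 * (of_nat n * sh_coeff n * s ^ n)) sums (sh s + 2 * (s * sh' s))"
    unfolding sh_def by (intro sums_add sums_mult summable_sums summable_ch_sh)
  moreover have "sh_coeff n * s ^ n + 2 * (of_nat n * sh_coeff n * s ^ n) = ch_coeff n * s ^ n" for n
  proof -
    have "sh_coeff n * (1 + 2 * of_nat n) = ch_coeff n"
    proof -
      have "(fact (2 * n + 1) :: complex) = of_nat (2 * n + 1) * fact (2 * n)" by simp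
      moreover have "of_nat (2 * n + 1) \<noteq> (0::complex)" by (simp only: of_nat_eq_0_iff)
      moreover have "inverse (N * F) * N = inverse F" if "N \<noteq> 0" for N F :: complex
        using that by (simp add: field_simps)
      moreover have "1 + 2 * of_nat n = (of_nat (2 * n + 1) :: complex)" by simp
      ultimately show ?thesis unfolding ch_coeff_def sh_coeff_def by metis
    qed
    then show ?thesis by (metis (no_types, lifting) distrib_left mult.assoc mult.commute mult.right_neutral)
  qed
  ultimately show ?thesis unfolding ch_def by (simp add: sums_iff mult.assoc)
qed

lemma ch_sh_holomorphic: "ch holomorphic_on T" "sh holomorphic_on T"
  using DERIV_ch DERIV_sh by (auto simp: holomorphic_on_def field_differentiable_def intro:
      has_field_derivative_at_within)

lemma ch_sh_0 [simp]: "ch 0 = 1" "sh 0 = 1"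
  by (simp_all add: ch_def sh_def ch_coeff_def sh_coeff_def powser_zero)

lemma ch_sh_cnj: "cnj (ch s) = ch (cnj s)" "cnj (sh s) = sh (cnj s)"
proof -
  have "(\<lambda>n. cnj (ch_coeff n * s ^ n)) sums cnj (ch s)" "(\<lambda>n. cnj (sh_coeff n * s ^ n)) sums cnj (sh s)"
    unfolding sums_cnj ch_def sh_def by (intro summable_sums summable_ch_sh)+
  then show "cnj (ch s) = ch (cnj s)" "cnj (sh s) = sh (cnj s)"
    by (simp_all add: ch_def sh_def sums_iff ch_coeff_def sh_coeff_def)
qed

text \<open>This is \<open>cosh\<^sup>2 - sinh\<^sup>2 = 1\<close> without square roots: the left
  side has derivative zero by \<open>sh'_eq\<close>. It makes the closed form of the exponential
  invertible.\<close>

lemma ch_sh_norm: "ch s ^ 2 - s * sh s ^ 2 = 1"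
proof -
  have "((\<lambda>s. ch s ^ 2 - s * sh s ^ 2) has_field_derivative 0) (at x)" for x
  proof -
    have "((\<lambda>s. ch s ^ 2 - s * sh s ^ 2) has_field_derivative
      2 * ch x * (sh x / 2) - (sh x ^ 2 + x * (2 * sh x * sh' x))) (at x)"
      by (rule derivative_eq_intros DERIV_ch DERIV_sh | simp)+
    moreover have "2 * ch x * (sh x / 2) - (sh x ^ 2 + x * (2 * sh x * sh' x)) = 0"
      unfolding sh'_eq[of x, symmetric] by (simp add: field_simps power2_eq_square)
    ultimately show ?thesis by simp
  qed
  then have "ch s ^ 2 - s * sh s ^ 2 = ch 0 ^ 2 - 0 * sh 0 ^ 2"
    using has_field_derivative_zero_constant[of UNIV "\<lambda>s. ch s ^ 2 - s * sh s ^ 2"] by (metis UNIV_I convex_UNIV)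
  then show ?thesis by simp
qed

text \<open>Write \<open>K = k\<^sup>2\<close> and \<open>\<xi> = z\<^sup>2 / \<delta>\<close>. For
  \<open>R = a - (z / \<delta>) b W - \<xi> c V - (z / \<delta>) p W V\<close> with functions \<open>a, b, c, p\<close> of \<open>\<xi>\<close>, the equation
  \<open>z R' + [W, R] / z + R V = 0\<close> is the system of differential equations in \<open>rad_ode_a\<close>, \<open>rad_ode_b\<close>,
  \<open>rad_ode_c\<close>, \<open>rad_ode_p\<close>. Its power series solution with \<open>a(0) = 1\<close> is governed by
  \<open>rad_seq\<close>, which stops at \<open>k\<close>. For \<open>k = 0\<close> the series does not stop, but then \<open>V = 0\<close>, so the equations
  for \<open>c\<close> and \<open>p\<close> are not needed and \<open>R = 1\<close> is a solution.\<close>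

primrec rad_seq :: "nat \<Rightarrow> nat \<Rightarrow> complex" where
  "rad_seq k 0 = 1 / 2"
| "rad_seq k (Suc n) = (of_nat k ^ 2 - of_nat (Suc n) ^ 2) / (2 * of_nat (Suc n)) * rad_seq k n"

text \<open>The step to index \<open>k\<close> carries the factor
  \<open>k\<^sup>2 - k\<^sup>2\<close>, and every later entry is a multiple of this one.\<close>

lemma rad_seq_eq_0: "k > 0 \<Longrightarrow> n \<ge> k \<Longrightarrow> rad_seq k n = 0"
proof (induction n)
  case (Suc n)
  then show ?case by (cases "k = Suc n") auto
qed simp

text \<open>The odd and even entries of \<open>rad_seq\<close> are the coefficients of
  \<open>c\<close> and \<open>p\<close>; integrating \<open>rad_ode_a\<close> and
  \<open>rad_ode_b\<close> then yields those of \<open>a\<close> and \<open>b\<close>. The value 1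
  at \<open>j = 0\<close> is the integration constant.\<close>

definition rad_a :: "nat \<Rightarrow> complex poly" where
  "rad_a k = (if k = 0 then 1 else
     Abs_poly (\<lambda>j. if j = 0 then 1 else of_nat k ^ 2 * rad_seq k (2 * j - 1) / (2 * of_nat j)))"
definition rad_b :: "nat \<Rightarrow> complex poly" where
  "rad_b k = (if k = 0 then 0 else Abs_poly (\<lambda>j. - (of_nat k ^ 2 * rad_seq k (2 * j) / of_nat (2 * j + 1))))"
definition rad_c :: "nat \<Rightarrow> complex poly" where
  "rad_c k = (if k = 0 then 0 else Abs_poly (\<lambda>j. rad_seq k (2 * j + 1)))"
definition rad_p :: "nat \<Rightarrow> complex poly" where
  "rad_p k = (if k = 0 then 0 else Abs_poly (\<lambda>j. rad_seq k (2 * j)))"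

lemma coeff_rad:
  assumes "k > 0"
  shows "coeff (rad_a k) j = (if j = 0 then 1 else of_nat k ^ 2 * rad_seq k (2 * j - 1) / (2 * of_nat j))"
    "coeff (rad_b k) j = - (of_nat k ^ 2 * rad_seq k (2 * j) / of_nat (2 * j + 1))"
    "coeff (rad_c k) j = rad_seq k (2 * j + 1)"
    "coeff (rad_p k) j = rad_seq k (2 * j)"
proof -
  have *: "coeff (Abs_poly f) j = f j" if "\<And>n. n \<ge> k \<Longrightarrow> n > 0 \<Longrightarrow> f n = 0" for f :: "nat \<Rightarrow> complex"
    by (rule fun_cong[OF coeff_Abs_poly[of k f]]) (use that in auto)
  show "coeff (rad_a k) j = (if j = 0 then 1 else of_nat k ^ 2 * rad_seq k (2 * j - 1) / (2 * of_nat j))"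
    unfolding rad_a_def by (subst if_not_P, use assms in simp, subst *)
      (use assms in \<open>auto simp: rad_seq_eq_0 simp del: rad_seq.simps(2)\<close>)
  show "coeff (rad_b k) j = - (of_nat k ^ 2 * rad_seq k (2 * j) / of_nat (2 * j + 1))"
    unfolding rad_b_def by (subst if_not_P, use assms in simp, subst *)
      (use assms in \<open>auto simp: rad_seq_eq_0 simp del: rad_seq.simps(2)\<close>)
  show "coeff (rad_c k) j = rad_seq k (2 * j + 1)"
    unfolding rad_c_def by (subst if_not_P, use assms in simp, subst *)
      (use assms in \<open>auto simp: rad_seq_eq_0 simp del: rad_seq.simps(2)\<close>)
  show "coeff (rad_p k) j = rad_seq k (2 * j)"
    unfolding rad_p_def by (subst if_not_P, use assms in simp, subst *)
      (use assms in \<open>auto simp: rad_seq_eq_0 simp del: rad_seq.simps(2)\<close>)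
qed

lemma rad_ode_a: "smult 2 (pderiv (rad_a k)) = smult (of_nat k ^ 2) (rad_c k)"
proof (cases "k = 0")
  case False
  have nz: "(of_nat (Suc n) :: complex) \<noteq> 0" for n by (simp only: of_nat_eq_0_iff)
  show ?thesis using False nz
    by (intro poly_eqI) (simp add: coeff_pderiv coeff_rad del: rad_seq.simps(2) of_nat_Suc)
qed (simp add: rad_a_def rad_c_def)

lemma rad_ode_b: "rad_b k + smult 2 (pCons 0 (pderiv (rad_b k))) = - smult (of_nat k ^ 2) (rad_p k)"
proof (cases "k = 0")
  case False
  have nz: "(of_nat (2 * n + 1) :: complex) \<noteq> 0" for n by (simp only: of_nat_eq_0_iff)
  show ?thesis
  proof (rule poly_eqI)
    fix n
    have "coeff (rad_b k + smult 2 (pCons 0 (pderiv (rad_b k)))) n = of_nat (2 * n + 1) * coeff (rad_b k) n"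
      by (cases n) (simp_all add: coeff_pderiv algebra_simps)
    also have "\<dots> = coeff (- smult (of_nat k ^ 2) (rad_p k)) n"
      using False nz[of n] by (simp add: coeff_rad del: rad_seq.simps(2) of_nat_Suc of_nat_add)
    finally show "coeff (rad_b k + smult 2 (pCons 0 (pderiv (rad_b k)))) n =
        coeff (- smult (of_nat k ^ 2) (rad_p k)) n" .
  qed
qed (simp add: rad_b_def rad_p_def)

text \<open>In degree 0 this reads \<open>a(0) = 2 p(0)\<close>, whence the start value 1/2 of
  \<open>rad_seq\<close>; in degree \<open>j + 1\<close> it is the recursion from index
  \<open>2j + 1\<close> to \<open>2j + 2\<close>.\<close>

lemma rad_ode_c:
  assumes "k > 0"
  shows "smult 2 (pCons 0 (rad_c k + pCons 0 (pderiv (rad_c k)))) = rad_a k - smult 2 (rad_p k)"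
proof (rule poly_eqI)
  fix n
  show "coeff (smult 2 (pCons 0 (rad_c k + pCons 0 (pderiv (rad_c k))))) n = coeff (rad_a k - smult 2 (rad_p k)) n"
  proof (cases n)
    case 0
    then show ?thesis using assms by (simp add: coeff_rad)
  next
    case (Suc j)
    let ?r = "rad_seq k (2 * j + 1)"
    let ?N = "of_nat (Suc j) :: complex"
    have nz: "?N \<noteq> 0" by (simp only: of_nat_eq_0_iff)
    have "coeff (rad_c k + pCons 0 (pderiv (rad_c k))) j = ?N * coeff (rad_c k) j"
      by (cases j) (simp_all add: coeff_pderiv algebra_simps)
    then have l: "coeff (smult 2 (pCons 0 (rad_c k + pCons 0 (pderiv (rad_c k))))) n = 2 * (?N * ?r)"
      using Suc assms by (simp add: coeff_rad del: rad_seq.simps(2) of_nat_Suc)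
    have "rad_seq k (2 * Suc j) = (of_nat k ^ 2 - (2 * ?N) ^ 2) / (2 * (2 * ?N)) * ?r"
      by (simp add: algebra_simps)
    then have "coeff (rad_a k - smult 2 (rad_p k)) n =
        of_nat k ^ 2 * ?r / (2 * ?N) - 2 * ((of_nat k ^ 2 - (2 * ?N) ^ 2) / (2 * (2 * ?N)) * ?r)"
      using Suc assms by (simp add: coeff_rad del: rad_seq.simps(2) of_nat_Suc)
    also have "\<dots> = 2 * (?N * ?r)"
      using nz by (simp add: field_simps power2_eq_square del: rad_seq.simps(2) of_nat_Suc)
    finally show ?thesis using l by simp
  qed
qed

text \<open>In degree \<open>n\<close> this is the recursion of \<open>rad_seq\<close> from index
  \<open>2n\<close> to \<open>2n + 1\<close>.\<close>

lemma rad_ode_p: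
  assumes "k > 0"
  shows "rad_p k + smult 2 (pCons 0 (pderiv (rad_p k))) + rad_b k + smult 2 (rad_c k) = 0"
proof (rule poly_eqI)
  fix n
  let ?r = "rad_seq k (2 * n)"
  let ?N = "of_nat (2 * n + 1) :: complex"
  have nz: "?N \<noteq> 0" by (simp only: of_nat_eq_0_iff)
  have "coeff (rad_p k + smult 2 (pCons 0 (pderiv (rad_p k)))) n = ?N * coeff (rad_p k) n"
    by (cases n) (simp_all add: coeff_pderiv algebra_simps)
  moreover have "rad_seq k (2 * n + 1) = (of_nat k ^ 2 - ?N ^ 2) / (2 * ?N) * ?r"
    by (simp add: algebra_simps)
  ultimately have "coeff (rad_p k + smult 2 (pCons 0 (pderiv (rad_p k))) + rad_b k + smult 2 (rad_c k)) n
     = ?N * ?r - of_nat k ^ 2 * ?r / ?N + 2 * ((of_nat k ^ 2 - ?N ^ 2) / (2 * ?N) * ?r)"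
    using assms by (simp add: coeff_rad del: rad_seq.simps(2) of_nat_Suc of_nat_add)
  also have "\<dots> = 0"
    using nz by (simp add: field_simps power2_eq_square del: rad_seq.simps(2) of_nat_Suc of_nat_add)
  finally show "coeff (rad_p k + smult 2 (pCons 0 (pderiv (rad_p k))) + rad_b k + smult 2 (rad_c k)) n = coeff 0 n"
    by simp
qed

text \<open>The left side is the determinant of \<open>R\<close>, written as the norm of the
  quaternion with units \<open>W\<close>, \<open>V\<close>, \<open>W V\<close>. It is constant in
  the manner of Liouville's formula, \<open>V\<close> being traceless, and equals 1 at the
  origin.\<close>

lemma rad_norm:
  "poly (rad_a k) s ^ 2 - s * poly (rad_b k) s ^ 2 - of_nat k ^ 2 * s ^ 2 * poly (rad_c k) s ^ 2
     + of_nat k ^ 2 * s * poly (rad_p k) s ^ 2 = 1"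
proof (cases "k = 0")
  case False
  define N where "N s = poly (rad_a k) s ^ 2 - s * poly (rad_b k) s ^ 2 - of_nat k ^ 2 * s ^ 2 * poly (rad_c k) s ^ 2
     + of_nat k ^ 2 * s * poly (rad_p k) s ^ 2" for s
  have "(N has_field_derivative 0) (at x)" for x
  proof -
    let ?K = "(of_nat k :: complex) ^ 2"
    let ?a = "poly (rad_a k) x" and ?b = "poly (rad_b k) x" and ?c = "poly (rad_c k) x" and ?p = "poly (rad_p k) x"
    let ?a' = "poly (pderiv (rad_a k)) x" and ?b' = "poly (pderiv (rad_b k)) x"
      and ?c' = "poly (pderiv (rad_c k)) x" and ?p' = "poly (pderiv (rad_p k)) x"
    have 1: "2 * ?a' = ?K * ?c" using arg_cong[OF rad_ode_a[of k], of "\<lambda>q. poly q x"] by simp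
    have 2: "?b + 2 * (x * ?b') = - (?K * ?p)" using arg_cong[OF rad_ode_b[of k],
        of "\<lambda>q. poly q x"] by (simp add: algebra_simps)
    have 3: "2 * (x * (?c + x * ?c')) = ?a - 2 * ?p" using arg_cong[OF rad_ode_c[of k],
        of "\<lambda>q. poly q x"] False by (simp add: algebra_simps)
    have 4: "?p + 2 * (x * ?p') + ?b + 2 * ?c = 0" using arg_cong[OF rad_ode_p[of k],
        of "\<lambda>q. poly q x"] False by (simp add: algebra_simps)
    have "(N has_field_derivative (2 * ?a * ?a' - (?b ^ 2 + x * (2 * ?b * ?b'))
        - ?K * (2 * x * ?c ^ 2 + x ^ 2 * (2 * ?c * ?c')) + ?K * (?p ^ 2 + x * (2 * ?p * ?p')))) (at x)"
      unfolding N_def[abs_def]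
      by (auto intro!: derivative_eq_intros poly_DERIV simp: algebra_simps)
    moreover have "2 * ?a * ?a' - (?b ^ 2 + x * (2 * ?b * ?b'))
        - ?K * (2 * x * ?c ^ 2 + x ^ 2 * (2 * ?c * ?c')) + ?K * (?p ^ 2 + x * (2 * ?p * ?p')) = 0"
      using 1 2 3 4 by algebra
    ultimately show ?thesis by simp
  qed
  then have "N s = N 0"
    using has_field_derivative_zero_constant[of UNIV N] by (metis UNIV_I convex_UNIV)
  moreover have "N 0 = 1"
    using False by (simp add: N_def poly_0_coeff_0 coeff_rad)
  ultimately show ?thesis by (simp add: N_def)
qed (simp add: rad_a_def rad_b_def rad_c_def rad_p_def)

section \<open>Two-by-two matrices\<close>

definition msc :: "complex \<Rightarrow> complex^'n^'m \<Rightarrow> complex^'n^'m" where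
  "msc c A = (\<chi> i j. c * A $ i $ j)"

lemma msc_nth [simp]: "msc c A $ i $ j = c * A $ i $ j"
  by (simp add: msc_def)

lemma msc_mult_vec [simp]: "msc c A *v v = c *s (A *v v)"
  by (simp add: vec_eq_iff matrix_vector_mult_def sum_distrib_left mult.assoc)

lemma matrix_vec_smult: "(A::complex^'n^'m) *v (c *s v) = c *s (A *v v)"
  by (simp add: vec_eq_iff matrix_vector_mult_def sum_distrib_left mult_ac)

lemma trace_2: "trace (A::complex^2^2) = A$1$1 + A$2$2"
  by (simp add: trace_def sum_2)

lemmas expand_2 = vec_eq_iff forall_2 matrix_vector_mult_def sum_2

lemma matrix_eq_2: "(A::complex^2^2) = B \<longleftrightarrow> A$1$1 = B$1$1 \<and> A$1$2 = B$1$2 \<and> A$2$1 = B$2$1 \<and> A$2$2 = B$2$2"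
  by (simp add: vec_eq_iff forall_2)

text \<open>Polarisation of the Cayley-Hamilton theorem, which says that the square of a traceless 2
  by 2 matrix is a scalar.\<close>

lemma traceless_anticommutator:
  fixes A B :: "complex^2^2"
  assumes "trace A = 0" "trace B = 0"
  shows "A *v (B *v v) + B *v (A *v v) = trace (A ** B) *s v"
proof -
  have "A$2$2 = - A$1$1" "B$2$2 = - B$1$1"
    using assms by (auto simp: trace_2 add_eq_0_iff)
  then show ?thesis
    by (simp add: expand_2 trace_2 matrix_matrix_mult_def algebra_simps)
qed

lemma traceless_square:
  fixes A :: "complex^2^2"
  assumes "trace A = 0"
  shows "A *v (A *v v) = (trace (A ** A) / 2) *s v"
  using traceless_anticommutator[OF assms assms, of v]
  by (simp add: vec_eq_iff field_simps)

text \<open>For commuting matrices the anticommutator is \<open>2 A W\<close>, hence a scalar;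
  multiplying by \<open>W\<close> once more and dividing by \<open>2 \<delta>\<close> isolates
  \<open>A\<close>.\<close>

lemma traceless_commutant:
  fixes A W :: "complex^2^2"
  assumes "trace A = 0" "trace W = 0" "\<And>v. A *v (W *v v) = W *v (A *v v)"
    and "\<And>v. W *v (W *v v) = \<delta> *s v" "\<delta> \<noteq> 0"
  shows "A *v v = (trace (A ** W) / (2 * \<delta>)) *s (W *v v)"
proof -
  have "A *v (W *v (W *v v)) + W *v (A *v (W *v v)) = trace (A ** W) *s (W *v v)"
    by (rule traceless_anticommutator[OF assms(1,2)])
  then have "2 * \<delta> * (A *v v) $ i = trace (A ** W) * (W *v v) $ i" for i
    by (simp add: assms(3)[symmetric] assms(4) matrix_vec_smult vec_eq_iff mult.assoc)
  then show ?thesis using assms(5) by (simp add: vec_eq_iff field_simps)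
qed

section \<open>Skew operators for a quadratic form in the plane\<close>

definition bil :: "complex^'n^'n \<Rightarrow> complex^'n \<Rightarrow> complex^'n \<Rightarrow> complex" where
  "bil G u v = (\<Sum>a\<in>UNIV. \<Sum>b\<in>UNIV. G $ a $ b * u $ a * v $ b)"

text \<open>Skewness of \<open>N\<close> means that \<open>G ** N\<close> is an antisymmetric
  matrix, which in size two has one free entry. The locale is applied to \<open>V\<close>, to its
  covariant derivative, to a difference of connections, and to a difference of \<open>V\<close>
  between charts.\<close>

locale skew2 =
  fixes G N :: "complex^2^2"
  assumes sym: "transpose G = G" and inv: "invertible G"
    and skew: "\<And>u v. bil G (N *v u) v = - bil G u (N *v v)"
begin

lemma sym12: "G$2$1 = G$1$2"
  using arg_cong[OF sym, of "\<lambda>A. A$1$2"] by (simp add: transpose_def)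

lemma detG: "G$1$1 * G$2$2 - G$1$2 * G$1$2 \<noteq> 0"
  using inv invertible_det_nz[of G] sym12 by (simp add: det_2)

text \<open>The entry in row 1 and column 2 of the antisymmetric matrix
  \<open>G ** N\<close>.\<close>

definition s where "s = G$1$1 * N$1$2 + G$1$2 * N$2$2"

lemma skew_components:
  "G$1$1 * N$1$1 + G$1$2 * N$2$1 = 0"
  "G$1$2 * N$1$2 + G$2$2 * N$2$2 = 0"
  "G$1$2 * N$1$1 + G$2$2 * N$2$1 = - s"
proof -
  have "2 * (G$1$1 * N$1$1 + G$1$2 * N$2$1) = 0"
    using skew[of "axis 1 1" "axis 1 1"] sym12 by (simp add: bil_def matrix_vector_mult_def sum_2 axis_def
        algebra_simps)
  then show "G$1$1 * N$1$1 + G$1$2 * N$2$1 = 0" by (simp only: mult_eq_0_iff) simp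
  have "2 * (G$1$2 * N$1$2 + G$2$2 * N$2$2) = 0"
    using skew[of "axis 2 1" "axis 2 1"] sym12 by (simp add: bil_def matrix_vector_mult_def sum_2 axis_def
        algebra_simps)
  then show "G$1$2 * N$1$2 + G$2$2 * N$2$2 = 0" by (simp only: mult_eq_0_iff) simp
  show "G$1$2 * N$1$1 + G$2$2 * N$2$1 = - s"
    using skew[of "axis 1 1" "axis 2 1"] sym12 by (simp add: bil_def matrix_vector_mult_def sum_2 axis_def
        s_def algebra_simps)
qed

text \<open>Cramer's rule recovers \<open>N\<close> from \<open>G ** N\<close>; the determinant
  stays on the left so that the identities remain polynomial.\<close>

lemma explicit:
  "(G$1$1 * G$2$2 - G$1$2 * G$1$2) * N$1$1 = s * G$1$2"
  "(G$1$1 * G$2$2 - G$1$2 * G$1$2) * N$1$2 = s * G$2$2"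
  "(G$1$1 * G$2$2 - G$1$2 * G$1$2) * N$2$1 = - s * G$1$1"
  "(G$1$1 * G$2$2 - G$1$2 * G$1$2) * N$2$2 = - s * G$1$2"
  using skew_components s_def by algebra+

lemma trace_zero: "trace N = 0"
proof -
  have "(G$1$1 * G$2$2 - G$1$2 * G$1$2) * (N$1$1 + N$2$2) = 0"
    using explicit by algebra
  then show ?thesis using detG by (simp add: trace_2)
qed

text \<open>Passing to \<open>G\<close>-adjoints turns \<open>N ** W\<close> into
  \<open>- W ** N\<close>, which has the opposite trace. With
  \<open>traceless_anticommutator\<close>, skew operators therefore anticommute with traceless
  self-adjoint ones.\<close>

lemma trace_selfadjoint:
  assumes "\<And>u v. bil G (W *v u) v = bil G u (W *v v)"
  shows "trace (N ** W) = 0"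
proof -
  have w: "G$1$1 * W$1$2 + G$1$2 * W$2$2 = G$1$2 * W$1$1 + G$2$2 * W$2$1"
    using assms[of "axis 1 1" "axis 2 1"] sym12 by (simp add: bil_def matrix_vector_mult_def sum_2 axis_def
        algebra_simps)
  have "(G$1$1 * G$2$2 - G$1$2 * G$1$2) * (N$1$1 * W$1$1 + N$1$2 * W$2$1 + (N$2$1 * W$1$2 + N$2$2 * W$2$2)) = 0"
    using explicit w by algebra
  then show ?thesis using detG by (simp add: trace_2 matrix_matrix_mult_def sum_2)
qed

text \<open>An eigenvector determines \<open>s\<close> as a quotient whose denominator is a
  component of \<open>G *v e\<close>; \<open>Vm_holo\<close> reads holomorphy off from this, and
  \<open>G_e_nonzero\<close> supplies a nonzero denominator.\<close>

lemma eigen: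
  assumes "N *v e = l *s e"
  shows "s * (G$1$2 * e$1 + G$2$2 * e$2) = (G$1$1 * G$2$2 - G$1$2 * G$1$2) * l * e$1"
    "s * (G$1$1 * e$1 + G$1$2 * e$2) = - ((G$1$1 * G$2$2 - G$1$2 * G$1$2) * l * e$2)"
proof -
  have 1: "N$1$1 * e$1 + N$1$2 * e$2 = l * e$1" "N$2$1 * e$1 + N$2$2 * e$2 = l * e$2"
    using assms by (simp_all add: expand_2)
  show "s * (G$1$2 * e$1 + G$2$2 * e$2) = (G$1$1 * G$2$2 - G$1$2 * G$1$2) * l * e$1"
    "s * (G$1$1 * e$1 + G$1$2 * e$2) = - ((G$1$1 * G$2$2 - G$1$2 * G$1$2) * l * e$2)"
    using 1 explicit by algebra+
qed

lemma G_e_nonzero: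
  fixes e :: "complex^2"
  assumes "e \<noteq> 0"
  shows "G$1$2 * e$1 + G$2$2 * e$2 \<noteq> 0 \<or> G$1$1 * e$1 + G$1$2 * e$2 \<noteq> 0"
proof (rule ccontr)
  assume "\<not> ?thesis"
  then have "(G$1$1 * G$2$2 - G$1$2 * G$1$2) * e$1 = 0" "(G$1$1 * G$2$2 - G$1$2 * G$1$2) * e$2 = 0"
    by algebra+
  then show False using detG assms by (simp add: vec_eq_iff forall_2)
qed

text \<open>A nonzero multiple of the standard antisymmetric matrix is invertible, so a skew
  operator with a kernel is zero. This is the uniqueness principle used for
  \<open>V\<close>.\<close>

lemma zero:
  assumes "N *v e = 0" "e \<noteq> 0"
  shows "N = 0"
proof -
  have "s = 0" using eigen[of e 0] assms G_e_nonzero[OF assms(2)] by auto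
  then show ?thesis using explicit detG by (simp add: matrix_eq_2)
qed

end

lemma adjoint_wrt_eq:
  assumes "\<And>u v. b (f u) v = b u (h v)" "\<And>w w'. (\<And>u. b u w = b u w') \<Longrightarrow> w = w'"
  shows "adjoint_wrt b f = h"
  unfolding adjoint_wrt_def
proof (rule the_equality)
  show "\<forall>u v. b (f u) v = b u (h v)" using assms(1) by blast
  fix f' assume "\<forall>u v. b (f u) v = b u (f' v)"
  then show "f' = h" using assms by (metis ext)
qed

section \<open>Semi-simple Tate charts\<close>

definition cmat :: "complex^'n::finite^'n^'n \<Rightarrow> complex^'n \<Rightarrow> complex^'n^'n" where
  "cmat T u = (\<chi> c b. \<Sum>a\<in>UNIV. T $ c $ a $ b * u $ a)"

lemma contract_cmat: "contract T u v = cmat T u *v v"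
proof -
  have "(\<Sum>a\<in>UNIV. \<Sum>b\<in>UNIV. T $ c $ a $ b * u $ a * v $ b) =
      (\<Sum>b\<in>UNIV. (\<Sum>a\<in>UNIV. T $ c $ a $ b * u $ a) * v $ b)" for c
    by (subst sum.swap) (simp add: sum_distrib_right)
  then show ?thesis by (simp add: contract_def cmat_def matrix_vector_mult_def)
qed

lemma cmat_add: "cmat T (u + v) = cmat T u + cmat T v"
  by (simp add: cmat_def vec_eq_iff distrib_left sum.distrib)

lemma cmat_smult: "cmat T (c *s u) = msc c (cmat T u)"
  by (simp add: cmat_def vec_eq_iff sum_distrib_left mult_ac)

lemma trace_msc: "trace (msc c A) = c * trace A"
  by (simp add: trace_def sum_distrib_left)

lemma trace_mat_1_2: "trace (mat 1 :: complex^2^2) = 2"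
  by (simp add: trace_2 mat_def)

lemma bil_diff: "bil G (u - v) w = bil G u w - bil G v w" "bil G w (u - v) = bil G w u - bil G w v"
  by (simp_all add: bil_def algebra_simps sum_subtractf)

lemma bil_add: "bil G (u + v) w = bil G u w + bil G v w" "bil G w (u + v) = bil G w u + bil G w v"
  by (simp_all add: bil_def algebra_simps sum.distrib)

lemma bil_smult: "bil G (c *s u) w = c * bil G u w" "bil G w (c *s u) = c * bil G w u"
  by (simp_all add: bil_def sum_distrib_left mult_ac)

lemma bil_uminus: "bil G (- u) w = - bil G u w" "bil G w (- u) = - bil G w u"
  by (simp_all add: bil_def sum_negf)

lemma bil_nondeg:
  fixes G :: "complex^'n::finite^'n"
  assumes "invertible G" "\<And>u. bil G u w = bil G u w'"
  shows "w = w'"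
proof -
  have "bil G (axis a 1) w = (G *v w) $ a" for a w
    by (simp add: bil_def matrix_vector_mult_def axis_def if_distrib[of "\<lambda>x. x * _"] if_distrib[of "\<lambda>x. _ * x"]
        sum.delta cong: if_cong) (subst sum.swap, simp add: sum.delta)
  then have "G *v w = G *v w'" using assms(2) by (metis vec_eq_iff)
  then show ?thesis using assms(1)
    by (metis invertible_def matrix_vector_mul_assoc matrix_vector_mul_lid)
qed

lemma pairing_bil: "pairing S x u v = bil (metric S x) u v"
  by (simp add: pairing_def bil_def)

lemma mult_cmat: "mult S x u v = cmat (structure_constants S x) u *v v"
  by (simp add: mult_def contract_cmat)

lemma covd_cmat: "covd \<Gamma> X Y x = del (\<lambda>_. X x) Y x + cmat (\<Gamma> x) (X x) *v Y x"
  by (simp add: covd_def contract_cmat del_def)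

lemma holo_fieldsD: "X \<in> holo_fields V \<Longrightarrow> holo_on V (\<lambda>x. X x $ c)"
  by (simp add: holo_fields_def)

lemma const_fields [simp]: "(\<lambda>_. u) \<in> holo_fields V" "(\<lambda>_. u) \<in> smooth_fields V"
  by (simp_all add: holo_fields_def smooth_fields_def)

lemma holo_fields_matrix_vector:
  assumes "\<And>a b. holo_on V (\<lambda>x. F x $ a $ b)" "X \<in> holo_fields V"
  shows "(\<lambda>x. F x *v X x) \<in> holo_fields V"
  using assms by (auto simp: holo_fields_def matrix_vector_mult_def intro!: holo_on_sum holo_on_mult)

lemma holo_on_differentiable: "holo_on V f \<Longrightarrow> x \<in> V \<Longrightarrow> f differentiable (at x)"
  using holo_onD(1) by (blast intro: differentiableI)

lemma deriv10_linear_holo: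
  assumes "holo_on V f" "x \<in> V"
  shows "deriv10 (u + v) f x = deriv10 u f x + deriv10 v f x" "deriv10 (c *s u) f x = c * deriv10 u f x"
  using assms by (simp_all add: deriv10_holo holo_onD(2)
      linear_add[OF linear_frechet_derivative[OF holo_on_differentiable]])

definition Mmat :: "('n::finite, 'z) frobenius_chart_scheme \<Rightarrow> complex^'n \<Rightarrow> complex^'n \<Rightarrow> complex^'n^'n" where
  "Mmat S x u = cmat (structure_constants S x) u"

definition Umat :: "('n::finite, 'z) frobenius_chart_scheme \<Rightarrow> complex^'n \<Rightarrow> complex^'n^'n" where
  "Umat S x = Mmat S x (euler S x)"

definition half_tr :: "(2, 'z) frobenius_chart_scheme \<Rightarrow> complex^2 \<Rightarrow> complex" where
  "half_tr S x = trace (Umat S x) / 2"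

definition Wmat :: "(2, 'z) frobenius_chart_scheme \<Rightarrow> complex^2 \<Rightarrow> complex^2^2" where
  "Wmat S x = Umat S x - msc (half_tr S x) (mat 1)"

definition disc :: "(2, 'z) frobenius_chart_scheme \<Rightarrow> complex^2 \<Rightarrow> complex" where
  "disc S x = trace (Wmat S x ** Wmat S x) / 2"

text \<open>\<open>V_op\<close> involves derivatives of the Euler field and is known to be linear
  only at points where that field is holomorphic; \<open>matrix\<close> gives a total definition,
  and \<open>V_op_Vm\<close> links the two inside the domain.\<close>

definition Vmat :: "('n::finite, 'z) frobenius_chart_scheme \<Rightarrow> complex \<Rightarrow> complex^'n \<Rightarrow> complex^'n^'n" where
  "Vmat S d x = matrix (V_op S d x)"

lemma U_op_Umat: "U_op S x v = Umat S x *v v"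
  by (simp add: U_op_def Umat_def Mmat_def mult_cmat)

lemma Umat_Wmat: "Umat S x *v v = half_tr S x *s v + Wmat S x *v v"
  by (simp add: Wmat_def matrix_vector_mult_diff_rdistrib)

lemma trace_Wmat: "trace (Wmat S x) = 0"
  by (simp add: Wmat_def trace_sub trace_msc trace_mat_1_2 half_tr_def)

lemma Wmat_square: "Wmat S x *v (Wmat S x *v v) = disc S x *s v"
  unfolding disc_def by (rule traceless_square[OF trace_Wmat])

locale tate_chart =
  fixes \<Omega> :: "(complex^2) set" and d :: complex and S :: "2 cdv_chart"
  assumes op: "open \<Omega>" and cdv: "cdv_on \<Omega> d S"
    and semi: "\<And>x. x \<in> \<Omega> \<Longrightarrow> card {l. \<exists>v. v \<noteq> 0 \<and> U_op S x v = l *s v} = 2"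
    and tate: "\<And>Y x. smooth_on \<Omega> Y \<Longrightarrow> x \<in> \<Omega> \<Longrightarrow> Q_op S d Y x = 0"
begin

abbreviation "g x \<equiv> bil (metric S x)"
abbreviation "e \<equiv> unit_field S"
abbreviation "E \<equiv> euler S"
abbreviation "Mm \<equiv> Mmat S"
abbreviation "Um \<equiv> Umat S"
abbreviation "Wm \<equiv> Wmat S"
abbreviation "Vm \<equiv> Vmat S d"
abbreviation "\<delta> \<equiv> disc S"
abbreviation "Gm x u \<equiv> cmat (christoffel S x) u"
abbreviation "Hm x u \<equiv> cmat (chern S x) u"

lemma frob: "frobenius_on \<Omega> d S"
  using cdv by (simp add: cdv_on_def)

lemma flat: "flat_metric_on \<Omega> S"
  using frob by (simp add: frobenius_on_def)

lemma metric_holo: "holo_on \<Omega> (\<lambda>x. metric S x $ a $ b)"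
  using flat by (simp add: flat_metric_on_def)

lemma metric_sym: "x \<in> \<Omega> \<Longrightarrow> transpose (metric S x) = metric S x"
  and metric_inv: "x \<in> \<Omega> \<Longrightarrow> invertible (metric S x)"
  using flat by (simp_all add: flat_metric_on_def)

lemma torsion_free:
  "X \<in> holo_fields \<Omega> \<Longrightarrow> Y \<in> holo_fields \<Omega> \<Longrightarrow> x \<in> \<Omega> \<Longrightarrow> lie X Y x = nabla S X Y x - nabla S Y X x"
  using flat by (simp add: flat_metric_on_def)

lemma metric_compat:
  "X \<in> holo_fields \<Omega> \<Longrightarrow> Y \<in> holo_fields \<Omega> \<Longrightarrow> Z \<in> holo_fields \<Omega> \<Longrightarrow> x \<in> \<Omega> \<Longrightarrow>
   deriv10 (X x) (\<lambda>y. g y (Y y) (Z y)) x = g x (nabla S X Y x) (Z x) + g x (Y x) (nabla S X Z x)"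
  using flat unfolding flat_metric_on_def pairing_bil by blast

lemma structure_holo: "holo_on \<Omega> (\<lambda>x. structure_constants S x $ c $ a $ b)"
  using frob by (simp add: frobenius_on_def)

lemma e_holo: "e \<in> holo_fields \<Omega>" and E_holo: "E \<in> holo_fields \<Omega>"
  using frob by (simp_all add: frobenius_on_def)

lemma product:
  assumes "x \<in> \<Omega>"
  shows "mult S x u v = mult S x v u"
    "mult S x (mult S x u v) w = mult S x u (mult S x v w)"
    "mult S x (e x) u = u"
    "g x (mult S x u v) w = g x u (mult S x v w)"
  using frob assms unfolding frobenius_on_def pairing_bil by blast+

lemma nabla_e: "X \<in> holo_fields \<Omega> \<Longrightarrow> x \<in> \<Omega> \<Longrightarrow> nabla S X e x = 0"
  using frob by (simp add: frobenius_on_def)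

lemma nabla_mult_sym:
  "X \<in> holo_fields \<Omega> \<Longrightarrow> Y \<in> holo_fields \<Omega> \<Longrightarrow> Z \<in> holo_fields \<Omega> \<Longrightarrow> x \<in> \<Omega> \<Longrightarrow>
   nabla_mult S X Y Z x = nabla_mult S Y X Z x"
  using frob unfolding frobenius_on_def by blast

lemma lie_mult:
  "X \<in> holo_fields \<Omega> \<Longrightarrow> Y \<in> holo_fields \<Omega> \<Longrightarrow> x \<in> \<Omega> \<Longrightarrow>
   lie E (multf S X Y) x - multf S (lie E X) Y x - multf S X (lie E Y) x = multf S X Y x"
  using frob unfolding frobenius_on_def by blast

lemma lie_metric:
  "X \<in> holo_fields \<Omega> \<Longrightarrow> Y \<in> holo_fields \<Omega> \<Longrightarrow> x \<in> \<Omega> \<Longrightarrow>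
   deriv10 (E x) (\<lambda>y. g y (X y) (Y y)) x - g x (lie E X x) (Y x) - g x (X x) (lie E Y x) = (2 - d) * g x (X x) (Y x)"
  using frob unfolding frobenius_on_def pairing_bil by blast

lemma Mm_mult: "mult S x u v = Mm x u *v v"
  by (simp add: Mmat_def mult_cmat)

lemma Mm_holo: "holo_on \<Omega> (\<lambda>x. Mm x u $ a $ b)"
  by (auto simp: Mmat_def cmat_def intro!: holo_on_sum holo_on_mult structure_holo)

lemma Um_holo: "holo_on \<Omega> (\<lambda>x. Um x $ a $ b)"
  by (auto simp: Umat_def Mmat_def cmat_def intro!: holo_on_sum holo_on_mult structure_holo holo_fieldsD[OF E_holo])

lemma half_tr_holo: "holo_on \<Omega> (half_tr S)"
  unfolding half_tr_def[abs_def] trace_2 divide_inverse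
  by (intro holo_on_mult holo_on_add Um_holo holo_on_const)

lemma Wm_holo: "holo_on \<Omega> (\<lambda>x. Wm x $ a $ b)"
  unfolding Wmat_def by (simp, intro holo_on_diff holo_on_mult Um_holo half_tr_holo holo_on_const)

lemma disc_holo: "holo_on \<Omega> \<delta>"
  unfolding disc_def[abs_def] trace_2 divide_inverse matrix_matrix_mult_def sum_2 vec_lambda_beta
  by (intro holo_on_mult holo_on_add Wm_holo holo_on_const)

lemma nabla_cmat: "nabla S X Y x = del (\<lambda>_. X x) Y x + Gm x (X x) *v Y x"
  by (simp add: nabla_def covd_cmat)

lemma nabla_const: "nabla S X (\<lambda>_. v) x = Gm x (X x) *v v"
  by (simp add: nabla_cmat)

lemma nabla_euler_nabla: "nabla S X E x = nabla_euler S x (X x)"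
  by (simp add: nabla_euler_def nabla_cmat)

lemma V_op_linear: "x \<in> \<Omega> \<Longrightarrow> Vector_Spaces.linear (*s) (*s) (V_op S d x)"
proof (unfold_locales)
  fix u v assume x: "x \<in> \<Omega>"
  show "V_op S d x (u + v) = V_op S d x u + V_op S d x v"
    by (simp add: V_op_def nabla_euler_def nabla_cmat del_def vec_eq_iff
        deriv10_linear_holo(1)[OF holo_fieldsD[OF E_holo] x] cmat_add matrix_vector_mult_add_rdistrib algebra_simps)
  fix c
  show "V_op S d x (c *s u) = c *s V_op S d x u"
    by (simp add: V_op_def nabla_euler_def nabla_cmat del_def vec_eq_iff
        deriv10_linear_holo(2)[OF holo_fieldsD[OF E_holo] x] cmat_smult algebra_simps)
qed

lemma V_op_Vm: "x \<in> \<Omega> \<Longrightarrow> V_op S d x v = Vm x *v v"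
  unfolding Vmat_def by (rule matrix_works[OF V_op_linear, symmetric])

lemma nabla_euler_Vm: "x \<in> \<Omega> \<Longrightarrow> nabla_euler S x v = Vm x *v v + ((2 - d) / 2) *s v"
  using V_op_Vm[of x v] by (simp add: V_op_def algebra_simps)

text \<open>Since the connection is metric and torsion free, \<open>L_E(g) = (2 - d) g\<close> says
  that the symmetric part of the endomorphism \<open>nabla_euler\<close> is
  \<open>(2 - d) / 2\<close>. Subtracting this scalar leaves the skew part.\<close>

lemma V_skew:
  assumes "x \<in> \<Omega>"
  shows "g x (Vm x *v u) v = - g x u (Vm x *v v)"
proof -
  let ?u = "\<lambda>_::complex^2. u" and ?v = "\<lambda>_::complex^2. v"
  have "deriv10 (E x) (\<lambda>y. g y u v) x = g x (nabla S E ?u x) v + g x u (nabla S E ?v x)"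
    using metric_compat[of E ?u ?v x] E_holo assms by simp
  moreover have "lie E ?u x = nabla S E ?u x - nabla_euler S x u" "lie E ?v x = nabla S E ?v x - nabla_euler S x v"
    using torsion_free[of E ?u x] torsion_free[of E ?v x] E_holo assms by (simp_all add: nabla_euler_nabla)
  moreover have "deriv10 (E x) (\<lambda>y. g y u v) x - g x (lie E ?u x) v - g x u (lie E ?v x) = (2 - d) * g x u v"
    using lie_metric[of ?u ?v x] assms by simp
  ultimately have "g x (nabla_euler S x u) v + g x u (nabla_euler S x v) = (2 - d) * g x u v"
    by (simp add: bil_diff)
  moreover define c where "c = (2 - d) / 2"
  ultimately have "g x (Vm x *v u) v + c * g x u v + (g x u (Vm x *v v) + c * g x u v) = 2 * c * g x u v"
    by (simp add: nabla_euler_Vm[OF assms] bil_add bil_smult)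
  then show ?thesis by algebra
qed

lemma V_skew2: "x \<in> \<Omega> \<Longrightarrow> skew2 (metric S x) (Vm x)"
  by unfold_locales (simp_all add: metric_sym metric_inv V_skew)

lemma e_nonzero: "x \<in> \<Omega> \<Longrightarrow> e x \<noteq> 0"
proof
  assume "x \<in> \<Omega>" "e x = 0"
  then have "mult S x 0 u = u" for u using product(3)[of x u] by simp
  then have "u = 0" for u :: "complex^2" by (metis \<open>x \<in> \<Omega>\<close> product(1) mult_cmat matrix_vector_mult_0_right)
  then show False by (metis one_neq_zero zero_index one_index)
qed

text \<open>Applying the Lie derivative along \<open>E\<close> to \<open>e \<circ> e = e\<close>
  gives \<open>L_E e = - e\<close>. As \<open>e\<close> is parallel and there is no torsion, the
  derivative of \<open>E\<close> along \<open>e\<close> is \<open>e\<close> itself.\<close>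

lemma V_e:
  assumes "x \<in> \<Omega>"
  shows "Vm x *v e x = (d / 2) *s e x"
proof -
  have "del E (multf S e e) x = del E e x"
    by (rule del_cong_open(1)[OF op assms]) (simp add: multf_def product(3))
  moreover have "del (multf S e e) E x = del e E x"
    by (simp add: del_def multf_def product(3)[OF assms])
  ultimately have "lie E (multf S e e) x = lie E e x"
    by (simp add: lie_def)
  moreover have "multf S (lie E e) e x = lie E e x" "multf S e (lie E e) x = lie E e x" "multf S e e x = e x"
    using product(3)[OF assms] product(1)[OF assms, of "lie E e x" "e x"] by (simp_all add: multf_def)
  ultimately have "- lie E e x = e x"
    using lie_mult[OF e_holo e_holo assms] by simp
  moreover have "lie E e x = - nabla_euler S x (e x)"
    using torsion_free[OF E_holo e_holo assms] nabla_e[OF E_holo assms] by (simp add: nabla_euler_nabla)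
  ultimately have "Vm x *v e x + ((2 - d) / 2) *s e x = e x"
    by (simp add: nabla_euler_Vm[OF assms] add.commute)
  then show ?thesis by (simp add: vec_eq_iff field_simps)
qed

lemma trace_V: "x \<in> \<Omega> \<Longrightarrow> trace (Vm x) = 0"
  by (rule skew2.trace_zero[OF V_skew2])

text \<open>The square of a traceless matrix is a scalar, and the scalar can be read off on the
  eigenvector \<open>e\<close>.\<close>

lemma V_square:
  assumes "x \<in> \<Omega>"
  shows "Vm x *v (Vm x *v v) = (d\<^sup>2 / 4) *s v"
proof -
  have sq: "Vm x *v (Vm x *v v) = (trace (Vm x ** Vm x) / 2) *s v" for v
    by (rule traceless_square[OF trace_V[OF assms]])
  have "(trace (Vm x ** Vm x) / 2) *s e x = (d\<^sup>2 / 4) *s e x"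
    unfolding sq[symmetric] by (simp add: V_e[OF assms] matrix_vec_smult power2_eq_square)
  then have "trace (Vm x ** Vm x) / 2 = d\<^sup>2 / 4"
    using e_nonzero[OF assms] by (metis vec.scale_cancel_right)
  then show ?thesis using sq by simp
qed

lemma W_selfadjoint:
  assumes "x \<in> \<Omega>"
  shows "g x (Wm x *v u) v = g x u (Wm x *v v)"
proof -
  have "g x (mult S x (E x) u) v = g x u (mult S x (E x) v)"
    using product(1,4)[OF assms] by metis
  then have "g x (Um x *v u) v = g x u (Um x *v v)"
    by (simp add: Mm_mult Umat_def)
  then show ?thesis by (simp add: Umat_Wmat bil_add bil_smult)
qed

lemma V_W_anticommute:
  assumes "x \<in> \<Omega>"
  shows "Vm x *v (Wm x *v v) = - (Wm x *v (Vm x *v v))"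
  using traceless_anticommutator[OF trace_V[OF assms] trace_Wmat[of S x], where v = v]
    skew2.trace_selfadjoint[OF V_skew2[OF assms] W_selfadjoint[OF assms]]
  by (simp add: add_eq_0_iff2)

text \<open>If \<open>\<delta> x\<close> were zero, \<open>W\<close> would be nilpotent and
  \<open>half_tr\<close> would be the sole eigenvalue of \<open>U\<close>.\<close>

lemma disc_nonzero:
  assumes "x \<in> \<Omega>"
  shows "\<delta> x \<noteq> 0"
proof
  assume 0: "\<delta> x = 0"
  have "{l. \<exists>v. v \<noteq> 0 \<and> U_op S x v = l *s v} \<subseteq> {half_tr S x}"
  proof clarsimp
    fix l v assume v: "v \<noteq> 0" "U_op S x v = l *s v"
    then have 1: "Wm x *v v = (l - half_tr S x) *s v"
      by (simp add: U_op_Umat Umat_Wmat vec_eq_iff algebra_simps)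
    have "Wm x *v (Wm x *v v) = (l - half_tr S x) *s ((l - half_tr S x) *s v)"
      by (simp only: 1 matrix_vec_smult)
    then have "(l - half_tr S x) *s ((l - half_tr S x) *s v) = 0"
      by (simp only: Wmat_square 0 vec.scale_zero_left)
    then show "l = half_tr S x" using v by (simp only: vec.scale_eq_0_iff) auto
  qed
  then have "card {l. \<exists>v. v \<noteq> 0 \<and> U_op S x v = l *s v} \<le> 1"
    using card_mono[of "{half_tr S x}"] by force
  then show False using semi[OF assms] by simp
qed

text \<open>\<open>aM\<close> and \<open>cM\<close> are the two 1-forms in the expansion of a
  multiplication operator in \<open>1\<close> and \<open>W\<close>; the formula for
  \<open>cM\<close> is the coefficient that \<open>traceless_commutant\<close> gives for the
  traceless part.\<close>

definition aM where "aM x u = trace (Mm x u) / 2"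
definition cM where "cM x u = trace ((Mm x u - msc (aM x u) (mat 1)) ** Wm x) / (2 * \<delta> x)"

lemma M_U_commute: "x \<in> \<Omega> \<Longrightarrow> Mm x u *v (Um x *v v) = Um x *v (Mm x u *v v)"
  using product(1,2)[of x] unfolding Umat_def Mm_mult[symmetric] by metis

lemma M_W_commute: "x \<in> \<Omega> \<Longrightarrow> Mm x u *v (Wm x *v v) = Wm x *v (Mm x u *v v)"
  using M_U_commute[of x u v] by (simp add: Umat_Wmat matrix_vector_right_distrib matrix_vec_smult)

lemma M_decomp:
  assumes "x \<in> \<Omega>"
  shows "Mm x u *v v = aM x u *s v + cM x u *s (Wm x *v v)"
proof -
  have "(Mm x u - msc (aM x u) (mat 1)) *v v = cM x u *s (Wm x *v v)"
    unfolding cM_def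
    by (rule traceless_commutant[OF _ trace_Wmat _ Wmat_square disc_nonzero[OF assms]])
       (simp_all add: trace_sub trace_msc trace_mat_1_2 aM_def matrix_vector_mult_diff_rdistrib
          matrix_vector_mult_diff_distrib M_W_commute[OF assms] matrix_vec_smult)
  then show ?thesis by (simp add: matrix_vector_mult_diff_rdistrib algebra_simps)
qed

end

section \<open>Covariant derivatives\<close>

lemma holo_on_quotient_local:
  assumes "open V" "holo_on V f" "holo_on V n" "\<And>x. x \<in> V \<Longrightarrow> s x * f x = n x" "x \<in> V" "f x \<noteq> 0"
  shows "\<exists>U. open U \<and> x \<in> U \<and> holo_on U s"
proof (intro exI conjI)
  let ?U = "V \<inter> f -` (- {0})"
  show "open ?U"
    by (rule continuous_open_preimage[OF holo_on_continuous[OF assms(2)] assms(1)]) auto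
  then show "holo_on ?U s"
  proof (subst holo_on_cong)
    show "s y = n y * inverse (f y)" if "y \<in> ?U" for y
      using assms(4)[of y] that by (auto simp: field_simps)
    have sub: "holo_on ?U h" if "holo_on V h" for h
      using that unfolding holo_on_def by blast
    show "holo_on ?U (\<lambda>y. n y * inverse (f y))"
      by (intro holo_on_mult holo_on_inverse sub assms) auto
  qed
  show "x \<in> ?U" using assms by auto
qed

lemma trace_mderiv10:
  assumes "\<And>a b. (\<lambda>y. F y $ a $ b) differentiable (at x)"
  shows "trace (mderiv10 u F x) = deriv10 u (\<lambda>y. trace (F y)) x"
  using assms by (simp add: trace_def mderiv10_def deriv_sum)

lemma trace_commutator: "trace (A ** B - B ** A) = (0::complex)"
  using trace_mul_sym[of A B] by (simp add: trace_sub)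

lemma conj_vec_conj_vec [simp]: "conj_vec (conj_vec v) = v"
  by (simp add: conj_vec_def)

lemma kappa_simps:
  "kappa S x (u + v) = kappa S x u + kappa S x v"
  "kappa S x (u - v) = kappa S x u - kappa S x v"
  "kappa S x (- u) = - kappa S x u"
  "kappa S x 0 = 0"
  "kappa S x (c *s u) = cnj c *s kappa S x u"
  by (simp_all add: kappa_def conj_vec_def vec_eq_iff matrix_vector_mult_def algebra_simps sum.distrib
      sum_subtractf sum_negf sum_distrib_left)

context tate_chart
begin

lemma chart_differentiable:
  assumes "x \<in> \<Omega>"
  shows "(\<lambda>y. Wm y $ a $ b) differentiable (at x)" "(\<lambda>y. Um y $ a $ b) differentiable (at x)"
    "half_tr S differentiable (at x)" "\<delta> differentiable (at x)" "(\<lambda>y. Mm y u $ a $ b) differentiable (at x)"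
  by (rule holo_on_differentiable[OF _ assms], rule Wm_holo Um_holo half_tr_holo disc_holo Mm_holo)+

lemma nabla_matrix:
  assumes "\<And>a b. holo_on \<Omega> (\<lambda>y. F y $ a $ b)" "Y \<in> holo_fields \<Omega>" "x \<in> \<Omega>"
  shows "nabla S (\<lambda>_. u) (\<lambda>y. F y *v Y y) x =
    mderiv10 u F x *v Y x + F x *v del (\<lambda>_. u) Y x + Gm x u *v (F x *v Y x)"
  unfolding nabla_cmat
  by (subst del_mult_vec(1)) (simp_all add: holo_on_differentiable[OF _ assms(3)] assms(1) holo_fieldsD[OF assms(2)])

text \<open>Symmetry of \<open>\<nabla>(\<circ>)\<close> exchanges the directions \<open>u\<close>
  and \<open>E\<close>, and \<open>L_E(\<circ>) = \<circ>\<close> evaluates the derivative of the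
  product along \<open>E\<close>. The result is the analogue for \<open>\<nabla>\<close> and
  \<open>V\<close> of the equation for \<open>D'(U)\<close> with \<open>Q\<close>.\<close>

lemma nabla_U:
  assumes x: "x \<in> \<Omega>"
  shows "mderiv10 u Um x *v v + Gm x u *v (Um x *v v) - Um x *v (Gm x u *v v) =
    Mm x u *v v + Vm x *v (Mm x u *v v) - Mm x u *v (Vm x *v v)"
proof -
  let ?u = "\<lambda>_::complex^2. u" and ?v = "\<lambda>_::complex^2. v"
  define N where "N = nabla S E (multf S ?u ?v) x"
  define nu where "nu = nabla S E ?u x"
  define nv where "nv = nabla S E ?v x"
  let ?ne = "nabla_euler S x"
  have EU: "multf S E ?v = (\<lambda>y. Um y *v v)"
    by (simp add: multf_def Mm_mult Umat_def)
  have uv: "multf S ?u ?v = (\<lambda>y. Mm y u *v v)"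
    by (simp add: multf_def Mm_mult)
  have uv_holo: "multf S ?u ?v \<in> holo_fields \<Omega>"
    unfolding uv by (rule holo_fields_matrix_vector) (simp_all add: Mm_holo)
  have comm: "mult S x w v = Mm x v *v w" for w
    using product(1)[OF x] by (simp add: Mm_mult)
  have uvc: "Mm x v *v u = Mm x u *v v"
    using comm[of u] by (simp add: Mm_mult)
  have "nabla S ?u (multf S E ?v) x = mderiv10 u Um x *v v + Gm x u *v (Um x *v v)"
    unfolding EU using nabla_matrix[of Um ?v x u] Um_holo x by simp
  then have "(mderiv10 u Um x *v v + Gm x u *v (Um x *v v)) - Mm x v *v ?ne u - Um x *v (Gm x u *v v) =
      N - Mm x v *v nu - Mm x u *v nv"
    using nabla_mult_sym[of ?u E ?v x] E_holo x
    by (simp add: nabla_mult_def N_def multf_def comm nabla_euler_nabla nu_def nv_def nabla_const Umat_def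
        uvc) (simp add: Mm_mult)
  moreover have "N - ?ne (Mm x u *v v) - Mm x v *v (nu - ?ne u) - Mm x u *v (nv - ?ne v) = Mm x u *v v"
    using lie_mult[of ?u ?v x] torsion_free[OF E_holo uv_holo x] torsion_free[of E ?u x] torsion_free[of E
        ?v x] E_holo x
    by (simp add: N_def nu_def nv_def nabla_euler_nabla multf_def comm uvc) (simp add: Mm_mult)?
  \<comment> \<open>Here \<open>N\<close>, \<open>r\<close> and \<open>s\<close> stand for the terms
    with a derivative along \<open>E\<close>; they cancel between the two identities.\<close>
  moreover have "A - q = m + k - t" if "A - p - q = N - r - s" "N - k - (r - p) - (s - t) = m"
    for A p q N r s k t m :: "complex^2"
  proof -
    have "A = N - r - s + p + q" unfolding that(1)[symmetric] by simp
    moreover have "N = m + k + (r - p) + (s - t)" unfolding that(2)[symmetric] by simp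
    ultimately show ?thesis by simp
  qed
  ultimately have "mderiv10 u Um x *v v + Gm x u *v (Um x *v v) - Um x *v (Gm x u *v v) =
      Mm x u *v v + ?ne (Mm x u *v v) - Mm x u *v (?ne v)"
    unfolding matrix_vector_mult_diff_distrib by blast
  then show ?thesis
    by (simp add: nabla_euler_Vm[OF x] matrix_vector_right_distrib matrix_vec_smult)
qed

lemma mderiv_U:
  assumes x: "x \<in> \<Omega>"
  shows "mderiv10 u Um x = mderiv10 u Wm x + msc (deriv10 u (half_tr S) x) (mat 1)"
proof -
  have "deriv10 u (\<lambda>y. Wm y $ a $ b) x =
      deriv10 u (\<lambda>y. Um y $ a $ b) x - deriv10 u (half_tr S) x * mat 1 $ a $ b" for a b
    using chart_differentiable[OF x] by (simp add: Wmat_def deriv_diff deriv_mult)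
  then show ?thesis by (simp add: vec_eq_iff mderiv10_def)
qed

text \<open>The traceless terms of \<open>nabla_U\<close> are collected in \<open>N\<close>, and the
  equation says that \<open>N\<close> is the scalar \<open>aM\<close> minus the derivative of
  \<open>half_tr\<close>. Taking the trace makes both sides zero, which gives the two claims
  together.\<close>

lemma deriv_half_tr_and_W:
  assumes x: "x \<in> \<Omega>"
  shows "deriv10 u (half_tr S) x = aM x u"
    and "mderiv10 u Wm x *v v = Wm x *v (Gm x u *v v) - Gm x u *v (Wm x *v v) + cM x u *s (Wm x *v v)
      - (2 * cM x u) *s (Wm x *v (Vm x *v v))"
proof -
  let ?c = "cM x u" and ?t = "deriv10 u (half_tr S) x"
  define N where "N = mderiv10 u Wm x + (Gm x u ** Wm x - Wm x ** Gm x u) - msc ?c (Wm x) + msc (2 * ?c) (Wm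
      x ** Vm x)"
  have N: "N *v v = (aM x u - ?t) *s v" for v
    using nabla_U[OF x, of u v]
    unfolding mderiv_U[OF x] M_decomp[OF x] Umat_Wmat N_def
    by (simp add: matrix_vector_mult_add_rdistrib matrix_vector_mult_diff_rdistrib matrix_vector_right_distrib
      matrix_vec_smult V_W_anticommute[OF x] matrix_vector_mul_assoc[symmetric] vec_eq_iff algebra_simps)
  have "trace N = 0"
    using skew2.trace_selfadjoint[OF V_skew2[OF x] W_selfadjoint[OF x]] chart_differentiable(1)[OF x]
    by (simp add: N_def trace_add trace_sub[of _ "msc ?c (Wm x)"] trace_commutator trace_msc trace_Wmat trace_mderiv10
        trace_mul_sym[of "Wm x" "Vm x"])
  moreover have "N = msc (aM x u - ?t) (mat 1)"
    using N by (simp add: matrix_eq)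
  ultimately show 1: "?t = aM x u"
    by (simp add: trace_msc trace_mat_1_2)
  show "mderiv10 u Wm x *v v = Wm x *v (Gm x u *v v) - Gm x u *v (Wm x *v v) + ?c *s (Wm x *v v)
      - (2 * ?c) *s (Wm x *v (Vm x *v v))"
    using N[of v] unfolding 1 N_def
    by (simp add: matrix_vector_mult_add_rdistrib matrix_vector_mult_diff_rdistrib
      matrix_vector_mul_assoc[symmetric] vec_eq_iff algebra_simps)
qed

text \<open>Obtained by differentiating \<open>W\<^sup>2 = \<delta>\<close>: the terms with
  \<open>V\<close> cancel because \<open>V\<close> and \<open>W\<close> anticommute, and the
  commutators with the connection matrix cancel as well.\<close>

lemma deriv_disc:
  assumes x: "x \<in> \<Omega>"
  shows "deriv10 u \<delta> x = 2 * cM x u * \<delta> x"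
proof -
  let ?c = "cM x u"
  have "deriv10 u \<delta> x *s v = (2 * ?c * \<delta> x) *s v" for v :: "complex^2"
  proof -
    let ?v = "\<lambda>_::complex^2. v"
    have "del (\<lambda>_. u) (\<lambda>y. Wm y *v (Wm y *v v)) x = mderiv10 u Wm x *v (Wm x *v v) + Wm x *v (mderiv10 u Wm x *v v)"
    proof -
      have "(\<lambda>y. (Wm y *v v) $ b) differentiable (at x)" for b
        using chart_differentiable(1)[OF x] by (simp add: matrix_vector_mult_def)
      then show ?thesis
        using chart_differentiable(1)[OF x] by (simp add: del_mult_vec(1)[where X = "\<lambda>_. u"])
    qed
    also have "\<dots> = (2 * ?c * \<delta> x) *s v"
      unfolding deriv_half_tr_and_W(2)[OF x]
      by (simp add: matrix_vector_right_distrib matrix_vector_mult_diff_distrib matrix_vec_smult Wmat_square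
        V_W_anticommute[OF x] linear_neg[OF matrix_vector_mul_linear] vec_eq_iff algebra_simps)
    finally have "del (\<lambda>_. u) (\<lambda>y. Wm y *v (Wm y *v v)) x = (2 * ?c * \<delta> x) *s v" .
    moreover have "del (\<lambda>_. u) (\<lambda>y. Wm y *v (Wm y *v v)) x = deriv10 u \<delta> x *s v"
      using chart_differentiable(4)[OF x] by (simp add: Wmat_square del_def vec_eq_iff deriv_mult)
    ultimately show ?thesis by simp
  qed
  from this[of 1] show ?thesis by (simp add: vec_eq_iff)
qed

text \<open>The Christoffel coefficients carry no regularity assumption of their own, so holomorphy
  is not read off from the definition of \<open>V\<close>. Instead \<open>V\<close> is an algebraic
  function of \<open>g\<close> and \<open>e\<close>, being skew with eigenvector
  \<open>e\<close>.\<close>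

lemma Vm_holo: "holo_on \<Omega> (\<lambda>x. Vm x $ a $ b)"
proof -
  define D where "D x = metric S x$1$1 * metric S x$2$2 - metric S x$1$2 * metric S x$1$2" for x
  define s where "s x = skew2.s (metric S x) (Vm x)" for x
  define f1 where "f1 x = metric S x$1$2 * e x$1 + metric S x$2$2 * e x$2" for x
  define f2 where "f2 x = metric S x$1$1 * e x$1 + metric S x$1$2 * e x$2" for x
  have h: "holo_on \<Omega> D" "holo_on \<Omega> f1" "holo_on \<Omega> f2"
    unfolding D_def[abs_def] f1_def[abs_def] f2_def[abs_def]
    by (intro holo_on_diff holo_on_add holo_on_mult metric_holo holo_fieldsD[OF e_holo])+
  have n: "holo_on \<Omega> (\<lambda>x. D x * (d / 2) * e x$1)" "holo_on \<Omega> (\<lambda>x. - (D x * (d / 2) * e x$2))"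
    by (intro holo_on_uminus holo_on_mult h holo_on_const holo_fieldsD[OF e_holo])+
  have s1: "s x * f1 x = D x * (d / 2) * e x$1" "s x * f2 x = - (D x * (d / 2) * e x$2)" if "x \<in> \<Omega>" for x
    using skew2.eigen[OF V_skew2[OF that] V_e[OF that]] by (simp_all add: s_def f1_def f2_def D_def)
  have s: "holo_on \<Omega> s"
  proof (rule holo_on_local)
    fix x assume x: "x \<in> \<Omega>"
    have "f1 x \<noteq> 0 \<or> f2 x \<noteq> 0"
      using skew2.G_e_nonzero[OF V_skew2[OF x] e_nonzero[OF x]] by (simp add: f1_def f2_def)
    then show "\<exists>U. open U \<and> x \<in> U \<and> holo_on U s"
      using holo_on_quotient_local[OF op h(2) n(1) s1(1) x] holo_on_quotient_local[OF op h(3) n(2) s1(2) x] by blast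
  qed
  have D0: "D x \<noteq> 0" if "x \<in> \<Omega>" for x
    using skew2.detG[OF V_skew2[OF that]] by (simp add: D_def)
  define F :: "complex^2 \<Rightarrow> complex^2^2" where "F x = vector [vector [metric S x$1$2, metric S x$2$2],
      vector [- metric S x$1$1, - metric S x$1$2]]" for x
  have Fh: "holo_on \<Omega> (\<lambda>x. F x $ a $ b)" for a b
    using exhaust_2[of a] exhaust_2[of b] by (auto simp: F_def vector_2 intro!: metric_holo holo_on_uminus)
  have "D x * Vm x $ a $ b = s x * F x $ a $ b" if "x \<in> \<Omega>" for x
    using skew2.explicit[OF V_skew2[OF that]] exhaust_2[of a] exhaust_2[of b]
    by (auto simp: D_def s_def F_def vector_2)
  then have "Vm x $ a $ b = inverse (D x) * (s x * F x $ a $ b)" if "x \<in> \<Omega>" for x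
    using D0[OF that] that by (simp add: field_simps)
  then show ?thesis
    by (subst holo_on_cong[OF op], assumption) (intro holo_on_mult holo_on_inverse h D0 s Fh)
qed

text \<open>\<open>\<nabla>V\<close> is \<open>g\<close>-skew and kills \<open>e\<close>; in dimension two this forces \<open>\<nabla>V = 0\<close>.\<close>

lemma deriv_V:
  assumes x: "x \<in> \<Omega>"
  shows "mderiv10 u Vm x *v v = Vm x *v (Gm x u *v v) - Gm x u *v (Vm x *v v)"
proof -
  define T where "T = mderiv10 u Vm x + Gm x u ** Vm x - Vm x ** Gm x u"
  have T: "T *v v = mderiv10 u Vm x *v v + Gm x u *v (Vm x *v v) - Vm x *v (Gm x u *v v)" for v
    by (simp add: T_def matrix_vector_mult_add_rdistrib matrix_vector_mult_diff_rdistrib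
        matrix_vector_mul_assoc[symmetric])
  have Vf: "(\<lambda>y. Vm y *v Y y) \<in> holo_fields \<Omega>" if "Y \<in> holo_fields \<Omega>" for Y
    using holo_fields_matrix_vector[OF Vm_holo that] .
  have nV: "nabla S (\<lambda>_. u) (\<lambda>y. Vm y *v Y y) x = T *v Y x + Vm x *v nabla S (\<lambda>_. u) Y x" if "Y \<in> holo_fields \<Omega>" for Y
    using nabla_matrix[OF Vm_holo that x, of u] by (simp add: T nabla_cmat matrix_vector_right_distrib)
  have "bil (metric S x) (T *v v) w = - bil (metric S x) v (T *v w)" for v w
  proof -
    let ?v = "\<lambda>_::complex^2. v" and ?w = "\<lambda>_::complex^2. w"
    have "deriv10 u (\<lambda>y. g y (Vm y *v v) w) x = deriv10 u (\<lambda>y. - g y v (Vm y *v w)) x"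
      by (rule deriv_cong_open(1)[OF op x]) (simp add: V_skew)
    also have "\<dots> = - deriv10 u (\<lambda>y. g y v (Vm y *v w)) x"
    proof (rule deriv_uminus)
      have "holo_on \<Omega> (\<lambda>y. g y v (Vm y *v w))"
        unfolding bil_def matrix_vector_mult_def vec_lambda_beta
        by (intro holo_on_sum holo_on_mult metric_holo Vm_holo holo_on_const)
      then show "(\<lambda>y. g y v (Vm y *v w)) differentiable (at x)"
        using holo_on_differentiable x by blast
    qed
    finally show ?thesis
      using metric_compat[of "\<lambda>_. u" "\<lambda>y. Vm y *v v" ?w x] metric_compat[of "\<lambda>_. u" ?v "\<lambda>y. Vm y *v w" x]
        nV[of ?v] nV[of ?w] Vf[of ?v] Vf[of ?w] x V_skew[OF x]
      by (simp add: bil_add)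
  qed
  then have sk: "skew2 (metric S x) T"
    by unfold_locales (simp_all add: metric_sym metric_inv x)
  have "T *v e x = 0"
  proof -
    have "T *v e x = nabla S (\<lambda>_. u) (\<lambda>y. Vm y *v e y) x"
      using nV[OF e_holo] nabla_e x by simp
    also have "\<dots> = nabla S (\<lambda>_. u) (\<lambda>y. msc (d / 2) (mat 1) *v e y) x"
      by (simp add: nabla_cmat V_e[OF x] del_cong_open(1)[OF op x, of "\<lambda>y. Vm y *v e y" "\<lambda>y. (d / 2) *s e y"] V_e)
    also have "\<dots> = msc (d / 2) (mat 1) *v nabla S (\<lambda>_. u) e x"
      using nabla_matrix[of "\<lambda>_. msc (d / 2) (mat 1)" e x u] e_holo x
      by (simp add: nabla_cmat mderiv10_def zero_vec_def[symmetric] matrix_vec_smult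
          matrix_vector_right_distrib vec_eq_iff algebra_simps)
    also have "\<dots> = 0" using nabla_e x by simp
    finally show ?thesis .
  qed
  then have "T = 0" using skew2.zero[OF sk] e_nonzero[OF x] by blast
  then show ?thesis using T[of v] by (simp add: algebra_simps)
qed

end

section \<open>The Chern connection and the real structure\<close>

context tate_chart
begin

abbreviation "\<kappa> \<equiv> kappa S"

lemma kappa_kappa: "x \<in> \<Omega> \<Longrightarrow> \<kappa> x (\<kappa> x u) = u"
  using cdv by (simp add: cdv_on_def real_structure_on_def)

lemma kappa_smooth: "smooth_on \<Omega> Y \<Longrightarrow> smooth_on \<Omega> (\<lambda>y. \<kappa> y (Y y))"
  using cdv op unfolding kappa_def
  by (intro smooth_on_matrix_vector smooth_on_conj_vec) (simp_all add: cdv_on_def real_structure_on_def)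

lemma herm_eq: "herm S x u v = g x u (\<kappa> x v)"
  by (simp add: herm_def pairing_bil)

lemma D_kappa:
  assumes "smooth_on \<Omega> Y" "x \<in> \<Omega>"
  shows "D' S (\<lambda>_. u) (\<lambda>y. \<kappa> y (Y y)) x = \<kappa> x (delbar (\<lambda>_. u) Y x)"
    "delbar (\<lambda>_. u) (\<lambda>y. \<kappa> y (Y y)) x = \<kappa> x (D' S (\<lambda>_. u) Y x)"
proof -
  have "\<forall>X\<in>smooth_fields \<Omega>. \<forall>Y\<in>smooth_fields \<Omega>. \<forall>x\<in>\<Omega>.
        D' S X (\<lambda>y. kappa S y (Y y)) x = kappa S x (delbar X Y x) \<and>
        delbar X (\<lambda>y. kappa S y (Y y)) x = kappa S x (D' S X Y x)"
    using cdv by (simp add: cdv_on_def)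
  then show "D' S (\<lambda>_. u) (\<lambda>y. \<kappa> y (Y y)) x = \<kappa> x (delbar (\<lambda>_. u) Y x)"
    "delbar (\<lambda>_. u) (\<lambda>y. \<kappa> y (Y y)) x = \<kappa> x (D' S (\<lambda>_. u) Y x)"
    using assms const_fields(2)[of u \<Omega>] by (auto simp: smooth_fields_def)
qed

lemma D'_cmat: "D' S X Y x = del (\<lambda>_. X x) Y x + Hm x (X x) *v Y x"
  by (simp add: D'_def covd_cmat)

lemma smooth_component_differentiable: "smooth_on \<Omega> Y \<Longrightarrow> x \<in> \<Omega> \<Longrightarrow> (\<lambda>y. (Y y :: complex^2) $ b) differentiable (at x)"
  using smooth_on_component[OF op] smooth_on_differentiable by blast

text \<open>Write \<open>g(v, w)\<close> as \<open>h(v, \<kappa> w)\<close>. Compatibility with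
  \<open>h\<close> brings in \<open>delbar\<close> of \<open>\<kappa> w\<close>, which
  \<open>D(\<kappa>) = 0\<close> converts back into \<open>D'\<close>; so \<open>D'\<close>
  preserves \<open>g\<close> too.\<close>

lemma D'_metric:
  assumes x: "x \<in> \<Omega>"
  shows "deriv10 u (\<lambda>y. g y v w) x = g x (Hm x u *v v) w + g x v (Hm x u *v w)"
proof -
  let ?v = "\<lambda>_::complex^2. v" and ?w = "\<lambda>_::complex^2. w" and ?u = "\<lambda>_::complex^2. u"
  have "chern_on \<Omega> S" using cdv by (simp add: cdv_on_def)
  moreover have "(\<lambda>y. \<kappa> y w) \<in> smooth_fields \<Omega>"
    using kappa_smooth[of ?w] by (simp add: smooth_fields_def)
  ultimately have "deriv10 u (\<lambda>y. herm S y v (\<kappa> y w)) x =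
      herm S x (D' S ?u ?v x) (\<kappa> x w) + herm S x v (delbar ?u (\<lambda>y. \<kappa> y w) x)"
    using x const_fields(2)[of u \<Omega>] const_fields(2)[of v \<Omega>] unfolding chern_on_def by fast
  moreover have "deriv10 u (\<lambda>y. herm S y v (\<kappa> y w)) x = deriv10 u (\<lambda>y. g y v w) x"
    by (rule deriv_cong_open(1)[OF op x]) (simp add: herm_eq kappa_kappa)
  ultimately show ?thesis
    using D_kappa(2)[of ?w x u] x by (simp add: herm_eq kappa_kappa D'_cmat)
qed

lemma D'_Um_const:
  assumes x: "x \<in> \<Omega>"
  shows "mderiv10 u Um x *v v + Hm x u *v (Um x *v v) - Um x *v (Hm x u *v v) = Mm x u *v v"
proof -
  have "\<forall>X\<in>smooth_fields \<Omega>. \<forall>Z\<in>smooth_fields \<Omega>. \<forall>x\<in>\<Omega>.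
        (D' S X (\<lambda>y. U_op S y (Z y)) x - U_op S x (D' S X Z x))
        - (Phi S x (X x) (Q_op S d Z x) - Q_op S d (\<lambda>y. Phi S y (X y) (Z y)) x)
        + Phi S x (X x) (Z x) = 0"
    using cdv by (simp add: cdv_on_def)
  from this[rule_format, OF const_fields(2)[of u] const_fields(2)[of v] x]
  have "(D' S (\<lambda>_. u) (\<lambda>y. U_op S y v) x - U_op S x (D' S (\<lambda>_. u) (\<lambda>_. v) x))
        - (Phi S x u (Q_op S d (\<lambda>_. v) x) - Q_op S d (\<lambda>y. Phi S y u v) x) + Phi S x u v = 0" .
  moreover have "Q_op S d (\<lambda>_. v) x = 0" by (rule tate[OF _ x]) simp
  moreover have "smooth_on \<Omega> (\<lambda>y. Mm y u *v v)"
    by (intro smooth_on_matrix_vector smooth_on_matrix holo_on_smooth Mm_holo op smooth_on_const)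
  then have "Q_op S d (\<lambda>y. Phi S y u v) x = 0"
    using op by (intro tate[OF _ x]) (auto simp: Phi_def Mm_mult intro: smooth_on_uminus)
  moreover have "D' S (\<lambda>_. u) (\<lambda>y. U_op S y v) x = mderiv10 u Um x *v v + Hm x u *v (Um x *v v)"
    using chart_differentiable(2)[OF x] by (simp add: D'_cmat U_op_Umat del_mult_vec(1)[where s = "\<lambda>_. v"])
  ultimately show ?thesis by (simp add: Phi_def Mm_mult D'_cmat U_op_Umat)
qed

text \<open>The difference \<open>D' - \<nabla> + c V\<close> is \<open>g\<close>-skew and commutes with \<open>W\<close>, hence vanishes.\<close>

lemma Hm_eq:
  assumes x: "x \<in> \<Omega>"
  shows "Hm x u *v v = Gm x u *v v - cM x u *s (Vm x *v v)"
proof -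
  let ?c = "cM x u"
  define N where "N = Hm x u - Gm x u + msc ?c (Vm x)"
  have N: "N *v v = Hm x u *v v - Gm x u *v v + ?c *s (Vm x *v v)" for v
    by (simp add: N_def matrix_vector_mult_add_rdistrib matrix_vector_mult_diff_rdistrib)
  have "bil (metric S x) (N *v v) w = - bil (metric S x) v (N *v w)" for v w
  proof -
    have "g x (Gm x u *v v) w + g x v (Gm x u *v w) = g x (Hm x u *v v) w + g x v (Hm x u *v w)"
      using D'_metric[OF x, of u v w] metric_compat[of "\<lambda>_. u" "\<lambda>_. v" "\<lambda>_. w" x] x
      by (simp add: nabla_cmat)
    then show ?thesis
      unfolding N bil_add bil_diff bil_smult V_skew[OF x, of v w] by algebra
  qed
  then have sk: "skew2 (metric S x) N"
    by unfold_locales (simp_all add: metric_sym metric_inv x)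
  \<comment> \<open>Subtracting \<open>nabla_U\<close> from \<open>D'_Um_const\<close> leaves
    \<open>[H - G, U] = [M, V] = c [W, V]\<close>, and the summand \<open>c V\<close> of
    \<open>N\<close> contributes the opposite.\<close>
  have comm: "N *v (Wm x *v v) = Wm x *v (N *v v)" for v
  proof -
    have "Hm x u *v (Um x *v v) - Um x *v (Hm x u *v v) - (Gm x u *v (Um x *v v) - Um x *v (Gm x u *v v))
        = Mm x u *v (Vm x *v v) - Vm x *v (Mm x u *v v)"
    proof -
      have "h - h' - (q - q') = n - m" if "p + h - h' = k" "p + q - q' = k + m - n"
          for p h h' q q' k m n :: "complex^2"
      proof -
        have "h = k - p + h'" unfolding that(1)[symmetric] by simp
        moreover have "q = k + m - n - p + q'" unfolding that(2)[symmetric] by simp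
        ultimately show ?thesis by simp
      qed
      from this[OF D'_Um_const[OF x] nabla_U[OF x]] show ?thesis .
    qed
    then show ?thesis
      unfolding N M_decomp[OF x] Umat_Wmat
      by (simp add: matrix_vector_right_distrib matrix_vector_mult_diff_distrib matrix_vec_smult V_W_anticommute[OF x]
         vec_eq_iff algebra_simps)
  qed
  have "N *v v = (trace (N ** Wm x) / (2 * \<delta> x)) *s (Wm x *v v)"
    by (rule traceless_commutant[OF skew2.trace_zero[OF sk] trace_Wmat comm Wmat_square disc_nonzero[OF x]])
  then have "N *v v = 0"
    using skew2.trace_selfadjoint[OF sk W_selfadjoint[OF x]] by simp
  then show ?thesis by (simp add: N algebra_simps)
qed

lemma D'_nabla:
  assumes "x \<in> \<Omega>"
  shows "D' S (\<lambda>_. u) Y x = nabla S (\<lambda>_. u) Y x - cM x u *s (Vm x *v Y x)"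
  by (simp add: D'_cmat nabla_cmat Hm_eq[OF assms])

lemma U_dag_eq:
  assumes "x \<in> \<Omega>"
  shows "U_dag S x = (\<lambda>v. \<kappa> x (Um x *v \<kappa> x v))"
  unfolding U_dag_def
proof (rule adjoint_wrt_eq)
  show "herm S x (U_op S x u) v = herm S x u (\<kappa> x (Um x *v \<kappa> x v))" for u v
    using W_selfadjoint[OF assms]
    by (simp add: herm_eq kappa_kappa assms U_op_Umat Umat_Wmat bil_add bil_smult)
  show "w = w'" if "\<And>u. herm S x u w = herm S x u w'" for w w'
    using bil_nondeg[OF metric_inv[OF assms], of "\<kappa> x w" "\<kappa> x w'"] that kappa_kappa[OF assms]
    by (metis herm_eq)
qed

lemma Phi_dag_eq:
  assumes "x \<in> \<Omega>"
  shows "Phi_dag S x u = (\<lambda>v. - \<kappa> x (Mm x u *v \<kappa> x v))"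
  unfolding Phi_dag_def
proof (rule adjoint_wrt_eq)
  show "herm S x (Phi S x u a) v = herm S x a (- \<kappa> x (Mm x u *v \<kappa> x v))" for a v
    using W_selfadjoint[OF assms]
    by (simp add: herm_eq kappa_kappa assms Phi_def Mm_mult M_decomp kappa_simps(3) bil_uminus bil_add
        bil_diff bil_smult)
  show "w = w'" if "\<And>u. herm S x u w = herm S x u w'" for w w'
    using bil_nondeg[OF metric_inv[OF assms], of "\<kappa> x w" "\<kappa> x w'"] that kappa_kappa[OF assms]
    by (metis herm_eq)
qed

text \<open>The coefficients \<open>chern\<close> are not given as smooth, but
  \<open>D(\<kappa>) = 0\<close> expresses them through \<open>\<kappa>\<close> and
  \<open>delbar\<close>. The Tate condition, stated for smooth sections, thereby applies to
  derivatives.\<close>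

lemma D'_const_smooth: "smooth_on \<Omega> (D' S (\<lambda>_. u) (\<lambda>_. v))"
proof -
  have "D' S (\<lambda>_. u) (\<lambda>_. v) x = \<kappa> x (delbar (\<lambda>_. u) (\<lambda>y. \<kappa> y v) x)" if "x \<in> \<Omega>" for x
    using D_kappa(2)[of "\<lambda>_. v" x u] kappa_kappa that by simp
  moreover have "smooth_on \<Omega> (\<lambda>x. \<kappa> x (delbar (\<lambda>_. u) (\<lambda>y. \<kappa> y v) x))"
    by (intro kappa_smooth smooth_on_del(2) op) simp
  ultimately show ?thesis
    using smooth_on_cong[OF op, of "D' S (\<lambda>_. u) (\<lambda>_. v)" "\<lambda>x. \<kappa> x (delbar (\<lambda>_. u) (\<lambda>y. \<kappa> y v) x)"]
    by simp
qed

lemma M_Udag_commute: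
  assumes x: "x \<in> \<Omega>"
  shows "Mm x u *v (U_dag S x v) = U_dag S x (Mm x u *v v)"
proof -
  have "\<forall>X\<in>smooth_fields \<Omega>. \<forall>Z\<in>smooth_fields \<Omega>. \<forall>x\<in>\<Omega>.
        (D' S X (Q_op S d Z) x - Q_op S d (D' S X Z) x)
        + (Phi S x (X x) (U_dag S x (Z x)) - U_dag S x (Phi S x (X x) (Z x))) = 0"
    using cdv by (simp add: cdv_on_def)
  from this[rule_format, OF const_fields(2)[of u] const_fields(2)[of v] x]
  have "(D' S (\<lambda>_. u) (Q_op S d (\<lambda>_. v)) x - Q_op S d (D' S (\<lambda>_. u) (\<lambda>_. v)) x)
        + (Phi S x u (U_dag S x v) - U_dag S x (Phi S x u v)) = 0" .
  moreover have "Q_op S d (D' S (\<lambda>_. u) (\<lambda>_. v)) x = 0"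
    by (rule tate[OF D'_const_smooth x])
  moreover have "Q_op S d (\<lambda>_. v) y = 0" if "y \<in> \<Omega>" for y
    by (rule tate[OF _ that]) simp
  then have "D' S (\<lambda>_. u) (Q_op S d (\<lambda>_. v)) x = 0"
    using del_cong_open(1)[OF op x, of "Q_op S d (\<lambda>_. v)" "\<lambda>_. 0"] x by (simp add: D'_cmat)
  ultimately show ?thesis
    by (simp add: Phi_def Mm_mult U_dag_eq[OF x] kappa_simps linear_neg[OF matrix_vector_mul_linear])
qed

lemma del_smult:
  assumes "f differentiable (at x)" "\<And>b. (\<lambda>y. (Y y :: complex^2) $ b) differentiable (at x)"
  shows "del (\<lambda>_. u) (\<lambda>y. f y *s Y y) x = deriv10 u f x *s Y x + f x *s del (\<lambda>_. u) Y x"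
  using assms by (simp add: del_def vec_eq_iff deriv_mult)

lemma del_add:
  assumes "\<And>b. (\<lambda>y. (X y :: complex^2) $ b) differentiable (at x)"
      "\<And>b. (\<lambda>y. (Y y :: complex^2) $ b) differentiable (at x)"
  shows "del (\<lambda>_. u) (\<lambda>y. X y + Y y) x = del (\<lambda>_. u) X x + del (\<lambda>_. u) Y x"
    "del (\<lambda>_. u) (\<lambda>y. X y - Y y) x = del (\<lambda>_. u) X x - del (\<lambda>_. u) Y x"
  using assms by (simp_all add: del_def vec_eq_iff deriv_add deriv_diff)

lemma smooth_smult:
  assumes "smooth_on \<Omega> f" "smooth_on \<Omega> Y"
  shows "smooth_on \<Omega> (\<lambda>y. f y *s (Y y :: complex^2))"
  using assms op smooth_on_component[OF op assms(2)] by (subst smooth_on_vec) (auto intro!: smooth_on_mult)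

lemma Wm_smooth: "smooth_on \<Omega> Y \<Longrightarrow> smooth_on \<Omega> (\<lambda>y. Wm y *v Y y)"
  by (intro smooth_on_matrix_vector op smooth_on_matrix holo_on_smooth Wm_holo)

lemma Vm_smooth: "smooth_on \<Omega> Y \<Longrightarrow> smooth_on \<Omega> (\<lambda>y. Vm y *v Y y)"
  by (intro smooth_on_matrix_vector op smooth_on_matrix holo_on_smooth Vm_holo)

lemma nabla_smult:
  assumes "smooth_on \<Omega> f" "smooth_on \<Omega> Y" "x \<in> \<Omega>"
  shows "nabla S (\<lambda>_. u) (\<lambda>y. f y *s Y y) x = deriv10 u f x *s Y x + f x *s nabla S (\<lambda>_. u) Y x"
  using smooth_component_differentiable[OF assms(2,3)] smooth_on_differentiable[OF assms(1,3)]
  by (simp add: nabla_cmat del_smult matrix_vec_smult)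

lemma nabla_add:
  assumes "smooth_on \<Omega> X" "smooth_on \<Omega> Y" "x \<in> \<Omega>"
  shows "nabla S (\<lambda>_. u) (\<lambda>y. X y + Y y) x = nabla S (\<lambda>_. u) X x + nabla S (\<lambda>_. u) Y x"
    "nabla S (\<lambda>_. u) (\<lambda>y. X y - Y y) x = nabla S (\<lambda>_. u) X x - nabla S (\<lambda>_. u) Y x"
  using smooth_component_differentiable[OF assms(1,3)] smooth_component_differentiable[OF assms(2,3)]
  by (simp_all add: nabla_cmat del_add matrix_vector_right_distrib matrix_vector_mult_diff_distrib)

lemma nabla_W:
  assumes "smooth_on \<Omega> Y" "x \<in> \<Omega>"
  shows "nabla S (\<lambda>_. u) (\<lambda>y. Wm y *v Y y) x = Wm x *v nabla S (\<lambda>_. u) Y x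
    + cM x u *s (Wm x *v Y x) - (2 * cM x u) *s (Wm x *v (Vm x *v Y x))"
  using smooth_component_differentiable[OF assms] chart_differentiable(1)[OF assms(2)]
  by (simp add: nabla_cmat del_mult_vec(1)[where X =
      "\<lambda>_. u"] deriv_half_tr_and_W(2)[OF assms(2)] matrix_vector_right_distrib)

lemma nabla_V:
  assumes "smooth_on \<Omega> Y" "x \<in> \<Omega>"
  shows "nabla S (\<lambda>_. u) (\<lambda>y. Vm y *v Y y) x = Vm x *v nabla S (\<lambda>_. u) Y x"
  using smooth_component_differentiable[OF assms] holo_on_differentiable[OF Vm_holo assms(2)]
  by (simp add: nabla_cmat del_mult_vec(1)[where X = "\<lambda>_. u"] deriv_V[OF assms(2)] matrix_vector_right_distrib)

lemma D'_smult:
  assumes "smooth_on \<Omega> f" "smooth_on \<Omega> Y" "x \<in> \<Omega>"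
  shows "D' S (\<lambda>_. u) (\<lambda>y. f y *s Y y) x = deriv10 u f x *s Y x + f x *s D' S (\<lambda>_. u) Y x"
  using smooth_component_differentiable[OF assms(2,3)] smooth_on_differentiable[OF assms(1,3)]
  by (simp add: D'_cmat del_smult matrix_vec_smult)

lemma D'_add:
  assumes "smooth_on \<Omega> X" "smooth_on \<Omega> Y" "x \<in> \<Omega>"
  shows "D' S (\<lambda>_. u) (\<lambda>y. X y + Y y) x = D' S (\<lambda>_. u) X x + D' S (\<lambda>_. u) Y x"
  using smooth_component_differentiable[OF assms(1,3)] smooth_component_differentiable[OF assms(2,3)]
  by (simp add: D'_cmat del_add matrix_vector_right_distrib)

text \<open>Passing from \<open>\<nabla>\<close> to \<open>D' = \<nabla> - c V\<close> subtracts
  \<open>c [V, W] = - 2 c W V\<close>, exactly the term with \<open>V\<close> in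
  \<open>nabla_W\<close>.\<close>

lemma D'_W:
  assumes "smooth_on \<Omega> Y" "x \<in> \<Omega>"
  shows "D' S (\<lambda>_. u) (\<lambda>y. Wm y *v Y y) x = Wm x *v D' S (\<lambda>_. u) Y x + cM x u *s (Wm x *v Y x)"
  unfolding D'_nabla[OF assms(2)] nabla_W[OF assms]
  by (simp add: matrix_vector_mult_diff_distrib matrix_vec_smult V_W_anticommute[OF assms(2)] vec_eq_iff
      algebra_simps)

end

section \<open>The gauge transformation\<close>

text \<open>The coefficients of \<open>R\<close> on \<open>1\<close>, \<open>- W\<close>,
  \<open>- V\<close>, \<open>- W V\<close> as functions of \<open>z\<close> and of
  \<open>s = \<delta>\<close>; the primed versions below are their derivatives in
  \<open>z\<close>.\<close>

definition fA :: "nat \<Rightarrow> complex \<Rightarrow> complex \<Rightarrow> complex" where "fA k z s = poly (rad_a k) (z\<^sup>2 / s)"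
definition fB :: "nat \<Rightarrow> complex \<Rightarrow> complex \<Rightarrow> complex" where "fB k z s = z / s * poly (rad_b k) (z\<^sup>2 / s)"
definition fC :: "nat \<Rightarrow> complex \<Rightarrow> complex \<Rightarrow> complex" where "fC k z s = z\<^sup>2 / s * poly (rad_c k) (z\<^sup>2 / s)"
definition fD :: "nat \<Rightarrow> complex \<Rightarrow> complex \<Rightarrow> complex" where "fD k z s = z / s * poly (rad_p k) (z\<^sup>2 / s)"

definition fA' :: "nat \<Rightarrow> complex \<Rightarrow> complex \<Rightarrow> complex" where
  "fA' k z s = 2 * z / s * poly (pderiv (rad_a k)) (z\<^sup>2 / s)"
definition fB' :: "nat \<Rightarrow> complex \<Rightarrow> complex \<Rightarrow> complex" where
  "fB' k z s = (poly (rad_b k) (z\<^sup>2 / s) + 2 * (z\<^sup>2 / s) * poly (pderiv (rad_b k)) (z\<^sup>2 / s)) / s"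
definition fC' :: "nat \<Rightarrow> complex \<Rightarrow> complex \<Rightarrow> complex" where
  "fC' k z s = 2 * z / s * (poly (rad_c k) (z\<^sup>2 / s) + z\<^sup>2 / s * poly (pderiv (rad_c k)) (z\<^sup>2 / s))"
definition fD' :: "nat \<Rightarrow> complex \<Rightarrow> complex \<Rightarrow> complex" where
  "fD' k z s = (poly (rad_p k) (z\<^sup>2 / s) + 2 * (z\<^sup>2 / s) * poly (pderiv (rad_p k)) (z\<^sup>2 / s)) / s"

lemmas rad_fun_defs = fA_def fB_def fC_def fD_def fA'_def fB'_def fC'_def fD'_def

lemma DERIV_rad_z:
  assumes "s \<noteq> 0"
  shows "((\<lambda>z. fA k z s) has_field_derivative fA' k z s) (at z)"
    "((\<lambda>z. fB k z s) has_field_derivative fB' k z s) (at z)"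
    "((\<lambda>z. fC k z s) has_field_derivative fC' k z s) (at z)"
    "((\<lambda>z. fD k z s) has_field_derivative fD' k z s) (at z)"
proof -
  have p: "((\<lambda>z. poly q (z\<^sup>2 / s)) has_field_derivative poly (pderiv q) (z\<^sup>2 / s) * (2 * z / s)) (at z)"
      for q :: "complex poly"
    using assms by (intro DERIV_chain2[OF poly_DERIV]) (auto intro!: derivative_eq_intros)
  show "((\<lambda>z. fA k z s) has_field_derivative fA' k z s) (at z)"
    unfolding fA_def fA'_def using p[of "rad_a k"] by (simp add: mult_ac)
  show "((\<lambda>z. fB k z s) has_field_derivative fB' k z s) (at z)"
    "((\<lambda>z. fC k z s) has_field_derivative fC' k z s) (at z)"
    "((\<lambda>z. fD k z s) has_field_derivative fD' k z s) (at z)"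
    unfolding fB_def fB'_def fC_def fC'_def fD_def fD'_def using assms
    by (auto intro!: derivative_eq_intros p simp: field_simps power2_eq_square)
qed

text \<open>\<open>fA\<close> and \<open>fC\<close> depend on \<open>z\<^sup>2 / s\<close> alone,
  while \<open>fB\<close> and \<open>fD\<close> carry an extra weight \<open>- 1/2\<close> in
  \<open>s\<close>. Euler's relation for homogeneous functions thus expresses derivatives in
  \<open>s\<close> by derivatives in \<open>z\<close>.\<close>

lemma DERIV_rad_s:
  assumes "s \<noteq> 0"
  shows "(fA k z has_field_derivative - (z * fA' k z s) / (2 * s)) (at s)"
    "(fB k z has_field_derivative - (z * fB' k z s + fB k z s) / (2 * s)) (at s)"
    "(fC k z has_field_derivative - (z * fC' k z s) / (2 * s)) (at s)"
    "(fD k z has_field_derivative - (z * fD' k z s + fD k z s) / (2 * s)) (at s)"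
proof -
  have p: "((\<lambda>s. poly q (z\<^sup>2 / s)) has_field_derivative poly (pderiv q) (z\<^sup>2 / s) * (- (z\<^sup>2 / s\<^sup>2))) (at s)"
      for q :: "complex poly"
    using assms by (intro DERIV_chain2[OF poly_DERIV]) (auto intro!: derivative_eq_intros simp: power2_eq_square)
  show "(fA k z has_field_derivative - (z * fA' k z s) / (2 * s)) (at s)"
    unfolding fA_def[abs_def] fA'_def using assms
    by (auto intro!: derivative_eq_intros p simp: field_simps power2_eq_square)
  show "(fB k z has_field_derivative - (z * fB' k z s + fB k z s) / (2 * s)) (at s)"
    unfolding fB_def[abs_def] fB'_def using assms
    by (auto intro!: derivative_eq_intros p simp: field_simps power2_eq_square)
  show "(fC k z has_field_derivative - (z * fC' k z s) / (2 * s)) (at s)"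
    unfolding fC_def[abs_def] fC'_def using assms
    by (auto intro!: derivative_eq_intros p simp: field_simps power2_eq_square)
  show "(fD k z has_field_derivative - (z * fD' k z s + fD k z s) / (2 * s)) (at s)"
    unfolding fD_def[abs_def] fD'_def using assms
    by (auto intro!: derivative_eq_intros p simp: field_simps power2_eq_square)
qed

lemma rad_fun_ode:
  assumes "s \<noteq> 0"
  shows "z * fA' k z s = of_nat k ^ 2 * fC k z s"
    "z * fB' k z s = - (of_nat k ^ 2 * fD k z s)"
    "k > 0 \<Longrightarrow> z * (z * fC' k z s - fA k z s) + 2 * s * fD k z s = 0"
    "k > 0 \<Longrightarrow> z * (z * fD' k z s + fB k z s) + 2 * fC k z s = 0"
proof -
  let ?x = "z\<^sup>2 / s"
  have 1: "2 * poly (pderiv (rad_a k)) ?x = of_nat k ^ 2 * poly (rad_c k) ?x"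
    using arg_cong[OF rad_ode_a[of k], of "\<lambda>q. poly q ?x"] by simp
  have 2: "poly (rad_b k) ?x + 2 * ?x * poly (pderiv (rad_b k)) ?x = - (of_nat k ^ 2 * poly (rad_p k) ?x)"
    using arg_cong[OF rad_ode_b[of k], of "\<lambda>q. poly q ?x"] by (simp add: mult_ac)
  have 3: "2 * (?x * (poly (rad_c k) ?x + ?x * poly (pderiv (rad_c k)) ?x)) =
      poly (rad_a k) ?x - 2 * poly (rad_p k) ?x" if "k > 0"
    using arg_cong[OF rad_ode_c[OF that], of "\<lambda>q. poly q ?x"] by (simp add: algebra_simps add_divide_distrib)
  have 4: "poly (rad_p k) ?x + 2 * ?x * poly (pderiv (rad_p k)) ?x + poly (rad_b k) ?x + 2 * poly (rad_c k)
      ?x = 0" if "k > 0"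
    using arg_cong[OF rad_ode_p[OF that], of "\<lambda>q. poly q ?x"] by (simp add: mult_ac)
  have "z * fA' k z s = ?x * (2 * poly (pderiv (rad_a k)) ?x)"
    by (simp add: rad_fun_defs power2_eq_square)
  then show "z * fA' k z s = of_nat k ^ 2 * fC k z s"
    unfolding 1 by (simp add: rad_fun_defs mult_ac)
  show "z * fB' k z s = - (of_nat k ^ 2 * fD k z s)"
    unfolding fB'_def 2 by (simp add: rad_fun_defs)
  show "z * (z * fC' k z s - fA k z s) + 2 * s * fD k z s = 0" if "k > 0"
  proof -
    have "z * fC' k z s = 2 * (?x * (poly (rad_c k) ?x + ?x * poly (pderiv (rad_c k)) ?x))"
      by (simp add: fC'_def power2_eq_square)
    then have "z * fC' k z s = poly (rad_a k) ?x - 2 * poly (rad_p k) ?x"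
      unfolding 3[OF that] .
    then have "z * (z * fC' k z s - fA k z s) = - (2 * (z * poly (rad_p k) ?x))"
      by (simp add: fA_def)
    then show ?thesis using assms by (simp add: fD_def)
  qed
  show "z * (z * fD' k z s + fB k z s) + 2 * fC k z s = 0" if "k > 0"
  proof -
    have "z * (z * fD' k z s + fB k z s) + 2 * fC k z s =
        ?x * (poly (rad_p k) ?x + 2 * ?x * poly (pderiv (rad_p k)) ?x + poly (rad_b k) ?x + 2 * poly (rad_c k) ?x)"
      using assms by (simp add: fB_def fC_def fD'_def field_simps power2_eq_square)
    then show ?thesis unfolding 4[OF that] by simp
  qed
qed

lemma rad_fun_norm:
  assumes "s \<noteq> 0"
  shows "fA k z s ^ 2 - s * fB k z s ^ 2 - of_nat k ^ 2 * fC k z s ^ 2 + of_nat k ^ 2 * s * fD k z s ^ 2 = 1"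
proof -
  have "s * fB k z s ^ 2 = z\<^sup>2 / s * poly (rad_b k) (z\<^sup>2 / s) ^ 2" "s * fD k z s ^ 2 =
      z\<^sup>2 / s * poly (rad_p k) (z\<^sup>2 / s) ^ 2"
    "fC k z s ^ 2 = (z\<^sup>2 / s)\<^sup>2 * poly (rad_c k) (z\<^sup>2 / s) ^ 2"
    using assms by (simp_all add: fB_def fC_def fD_def field_simps power2_eq_square)
  then show ?thesis using rad_norm[of k "z\<^sup>2 / s"]
    by (simp add: fA_def mult.assoc)
qed

section \<open>The exponentials of \<open>U\<close> and of its adjoint\<close>

definition cnjm :: "complex^'n^'m \<Rightarrow> complex^'n^'m" where
  "cnjm A = (\<chi> i j. cnj (A $ i $ j))"

lemma conj_vec_matrix: "conj_vec (A *v v) = cnjm A *v conj_vec v"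
  by (simp add: conj_vec_def cnjm_def matrix_vector_mult_def vec_eq_iff)

definition Wdag :: "(2, 'z) cdv_chart_scheme \<Rightarrow> complex^2 \<Rightarrow> complex^2^2" where
  "Wdag S x = real_structure S x ** cnjm (Wmat S x) ** cnjm (real_structure S x)"

lemma Wdag_kappa: "Wdag S x *v v = kappa S x (Wmat S x *v kappa S x v)"
  by (simp add: Wdag_def kappa_def conj_vec_matrix matrix_vector_mul_assoc[symmetric])

text \<open>If \<open>W\<^sup>2 = s\<close> then
  \<open>exp (w (t + W)) = al w t s + be w t s * W\<close>. Since \<open>ch\<close> and
  \<open>sh\<close> are entire, no square root of \<open>s\<close> has to be chosen.\<close>

definition al :: "complex \<Rightarrow> complex \<Rightarrow> complex \<Rightarrow> complex" where
  "al w t s = exp (w * t) * ch (w\<^sup>2 * s)"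
definition be :: "complex \<Rightarrow> complex \<Rightarrow> complex \<Rightarrow> complex" where
  "be w t s = exp (w * t) * (w * sh (w\<^sup>2 * s))"

lemma DERIV_al_be_w:
  "((\<lambda>w. al w t s) has_field_derivative t * al w t s + s * be w t s) (at w)"
  "((\<lambda>w. be w t s) has_field_derivative t * be w t s + al w t s) (at w)"
proof -
  show "((\<lambda>w. al w t s) has_field_derivative t * al w t s + s * be w t s) (at w)"
    unfolding al_def be_def
    by (auto intro!: derivative_eq_intros DERIV_chain2[OF DERIV_ch] simp: algebra_simps)
  have "((\<lambda>w. be w t s) has_field_derivative t * be w t s + exp (w * t) * (sh (w\<^sup>2 * s) + 2 * (w\<^sup>2 * s) *
      sh' (w\<^sup>2 * s))) (at w)"
    unfolding be_def
    by (auto intro!: derivative_eq_intros DERIV_chain2[OF DERIV_sh] simp: algebra_simps power2_eq_square)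
  then show "((\<lambda>w. be w t s) has_field_derivative t * be w t s + al w t s) (at w)"
    unfolding sh'_eq by (simp add: al_def)
qed

lemma al_be_norm: "al w t s * al (-w) t s + s * (be w t s * be (-w) t s) = 1"
    "al w t s * be (-w) t s + be w t s * al (-w) t s = 0"
proof -
  have e: "exp (w * t) * exp (- (w * t)) = 1" by (simp add: exp_minus_inverse)
  have "al w t s * al (-w) t s + s * (be w t s * be (-w) t s) =
      (exp (w * t) * exp (- (w * t))) * (ch (w\<^sup>2 * s) ^ 2 - (w\<^sup>2 * s) * sh (w\<^sup>2 * s) ^ 2)"
    by (simp add: al_def be_def algebra_simps power2_eq_square)
  then show "al w t s * al (-w) t s + s * (be w t s * be (-w) t s) = 1"
    unfolding e ch_sh_norm by simp
  show "al w t s * be (-w) t s + be w t s * al (-w) t s = 0"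
    by (simp add: al_def be_def)
qed

lemma cnj_al_be: "cnj (al w t s) = al (cnj w) (cnj t) (cnj s)" "cnj (be w t s) = be (cnj w) (cnj t) (cnj s)"
  by (simp_all add: al_def be_def ch_sh_cnj exp_cnj)

text \<open>\<open>Emat\<close> and \<open>Edag\<close> are \<open>exp (w U)\<close> and \<open>exp (z U\<^sup>\<dagger>)\<close> in closed form: \<open>U\<close> differs by the scalar
  \<open>t = half_tr\<close> from \<open>W\<close>, whose square is the scalar \<open>\<delta> = disc\<close>, and \<open>U\<^sup>\<dagger> = \<kappa> U \<kappa>\<close>.\<close>

definition Emat :: "(2, 'z) frobenius_chart_scheme \<Rightarrow> complex \<Rightarrow> complex^2 \<Rightarrow> complex^2^2" where
  "Emat S w x = msc (al w (half_tr S x) (disc S x)) (mat 1) + msc (be w (half_tr S x) (disc S x)) (Wmat S x)"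

definition Edag :: "(2, 'z) cdv_chart_scheme \<Rightarrow> complex \<Rightarrow> complex^2 \<Rightarrow> complex^2^2" where
  "Edag S z x = msc (al z (cnj (half_tr S x)) (cnj (disc S x))) (mat 1)
     + msc (be z (cnj (half_tr S x)) (cnj (disc S x))) (Wdag S x)"

definition Edag' :: "(2, 'z) cdv_chart_scheme \<Rightarrow> complex \<Rightarrow> complex^2 \<Rightarrow> complex^2^2" where
  "Edag' S z x = (let t = cnj (half_tr S x); s = cnj (disc S x) in
     msc (t * al z t s + s * be z t s) (mat 1) + msc (t * be z t s + al z t s) (Wdag S x))"

definition Rmat :: "(2, 'z) frobenius_chart_scheme \<Rightarrow> complex \<Rightarrow> nat \<Rightarrow> complex \<Rightarrow> complex^2 \<Rightarrow> complex^2^2" where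
  "Rmat S d k z x = msc (fA k z (disc S x)) (mat 1) - msc (fB k z (disc S x)) (Wmat S x)
     - msc (fC k z (disc S x)) (Vmat S d x) - msc (fD k z (disc S x)) (Wmat S x ** Vmat S d x)"

definition Rmat' :: "(2, 'z) frobenius_chart_scheme \<Rightarrow> complex \<Rightarrow> nat \<Rightarrow> complex \<Rightarrow> complex^2 \<Rightarrow> complex^2^2" where
  "Rmat' S d k z x = msc (fA' k z (disc S x)) (mat 1) - msc (fB' k z (disc S x)) (Wmat S x)
     - msc (fC' k z (disc S x)) (Vmat S d x) - msc (fD' k z (disc S x)) (Wmat S x ** Vmat S d x)"

definition phi :: "(2, 'z) cdv_chart_scheme \<Rightarrow> complex \<Rightarrow> nat \<Rightarrow> complex \<Rightarrow> complex^2 \<Rightarrow> complex^2^2" where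
  "phi S d k z x = Edag S z x ** Rmat S d k z x"

lemma Emat_vec: "Emat S w x *v v =
    al w (half_tr S x) (disc S x) *s v + be w (half_tr S x) (disc S x) *s (Wmat S x *v v)"
  by (simp add: Emat_def matrix_vector_mult_add_rdistrib)

lemma Rmat_vec: "Rmat S d k z x *v v = fA k z (disc S x) *s v - fB k z (disc S x) *s (Wmat S x *v v)
     - fC k z (disc S x) *s (Vmat S d x *v v) - fD k z (disc S x) *s (Wmat S x *v (Vmat S d x *v v))"
  by (simp add: Rmat_def matrix_vector_mult_diff_rdistrib matrix_vector_mul_assoc[symmetric])

lemma Rmat'_vec: "Rmat' S d k z x *v v = fA' k z (disc S x) *s v - fB' k z (disc S x) *s (Wmat S x *v v)
     - fC' k z (disc S x) *s (Vmat S d x *v v) - fD' k z (disc S x) *s (Wmat S x *v (Vmat S d x *v v))"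
  by (simp add: Rmat'_def matrix_vector_mult_diff_rdistrib matrix_vector_mul_assoc[symmetric])

lemma DERIV_Edag: "((\<lambda>z. Edag S z x $ a $ b) has_field_derivative Edag' S z x $ a $ b) (at z)"
  by (simp add: Edag_def Edag'_def Let_def)
     (intro DERIV_add DERIV_cmult_right DERIV_al_be_w)

lemma DERIV_matrix_mult:
  assumes "\<And>a b. ((\<lambda>z. F z $ a $ b) has_field_derivative F' $ a $ b) (at z)"
    "\<And>a b. ((\<lambda>z. G z $ a $ b) has_field_derivative G' $ a $ b) (at z)"
  shows "((\<lambda>z. (F z ** G z) $ a $ b) has_field_derivative (F' ** G z + F z ** G') $ a $ b) (at (z::complex))"
  unfolding matrix_matrix_mult_def
  by (auto intro!: derivative_eq_intros assms simp: sum.distrib algebra_simps)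

lemma DERIV_Rmat:
  assumes "disc S x \<noteq> 0"
  shows "((\<lambda>z. Rmat S d k z x $ a $ b) has_field_derivative Rmat' S d k z x $ a $ b) (at z)"
  unfolding Rmat_def Rmat'_def
  by (simp, intro DERIV_diff DERIV_cmult_right DERIV_rad_z[OF assms])

context tate_chart
begin

text \<open>Conjugation by the antilinear \<open>\<kappa>\<close> conjugates the parameter
  \<open>z\<close>. As \<open>D(\<kappa>) = 0\<close> exchanges \<open>D'\<close> and
  \<open>delbar\<close>, properties of the holomorphic matrix \<open>Emat\<close> carry over to
  \<open>Edag\<close> with these operators interchanged.\<close>

lemma Edag_eq_kappa_Emat:
  assumes "x \<in> \<Omega>"
  shows "Edag S z x *v v = \<kappa> x (Emat S (cnj z) x *v \<kappa> x v)"
  using kappa_kappa[OF assms]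
  by (simp add: Edag_def Emat_vec matrix_vector_mult_add_rdistrib kappa_simps cnj_al_be Wdag_kappa)

lemma U_dag_Wdag:
  assumes "x \<in> \<Omega>"
  shows "U_dag S x v = cnj (half_tr S x) *s v + Wdag S x *v v"
  using kappa_kappa[OF assms] by (simp add: U_dag_eq[OF assms] Umat_Wmat kappa_simps Wdag_kappa)

lemma Wdag_square:
  assumes "x \<in> \<Omega>"
  shows "Wdag S x *v (Wdag S x *v v) = cnj (\<delta> x) *s v"
  using kappa_kappa[OF assms] by (simp add: Wdag_kappa Wmat_square kappa_simps)

lemma Edag'_vec:
  assumes "x \<in> \<Omega>"
  shows "Edag' S z x *v v = U_dag S x (Edag S z x *v v)"
  unfolding U_dag_Wdag[OF assms]
  by (simp add: Edag'_def Edag_def Let_def matrix_vector_mult_add_rdistrib matrix_vector_right_distrib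
      matrix_vec_smult
      Wdag_square[OF assms] vec_eq_iff algebra_simps)

lemma M_Edag_commute:
  assumes "x \<in> \<Omega>"
  shows "Mm x u *v (Edag S z x *v v) = Edag S z x *v (Mm x u *v v)"
proof -
  have "Mm x u *v (Wdag S x *v v) = Wdag S x *v (Mm x u *v v)" for v
    using M_Udag_commute[OF assms, of u v] unfolding U_dag_Wdag[OF assms]
    by (simp add: matrix_vector_right_distrib matrix_vec_smult)
  then show ?thesis
    by (simp add: Edag_def matrix_vector_mult_add_rdistrib matrix_vector_right_distrib matrix_vec_smult)
qed

lemma Emat_inverse: "Emat S w x *v (Emat S (-w) x *v v) = v"
proof -
  let ?t = "half_tr S x" and ?s = "\<delta> x"
  have "Emat S w x *v (Emat S (-w) x *v v) =
    (al w ?t ?s * al (-w) ?t ?s + ?s * (be w ?t ?s * be (-w) ?t ?s)) *s v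
      + (al w ?t ?s * be (-w) ?t ?s + be w ?t ?s * al (-w) ?t ?s) *s (Wm x *v v)"
    by (simp add: Emat_vec matrix_vector_right_distrib matrix_vec_smult Wmat_square vec_eq_iff algebra_simps)
  then show ?thesis unfolding al_be_norm by simp
qed

lemma Edag_injective:
  assumes "x \<in> \<Omega>" "Edag S z x *v v = Edag S z x *v v'"
  shows "v = v'"
proof -
  have "\<kappa> x (\<kappa> x (Emat S (cnj z) x *v \<kappa> x v)) = \<kappa> x (\<kappa> x (Emat S (cnj z) x *v \<kappa> x v'))"
    using assms(2) unfolding Edag_eq_kappa_Emat[OF assms(1)] by simp
  then have "Emat S (- cnj z) x *v (Emat S (- (- cnj z)) x *v \<kappa> x v) =
      Emat S (- cnj z) x *v (Emat S (- (- cnj z)) x *v \<kappa> x v')"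
    by (simp add: kappa_kappa[OF assms(1)])
  then show ?thesis unfolding Emat_inverse using kappa_kappa[OF assms(1)] by metis
qed

lemma exp_smooth: "smooth_on \<Omega> (\<lambda>y. al w (half_tr S y) (\<delta> y))" "smooth_on \<Omega> (\<lambda>y. be w (half_tr S y) (\<delta> y))"
proof -
  have *: "smooth_on \<Omega> (\<lambda>y. h (w\<^sup>2 * \<delta> y))" if "h holomorphic_on UNIV" for h
    by (rule smooth_on_holomorphic_compose[OF op open_UNIV that]) (simp,
        rule smooth_on_mult[OF op smooth_on_const holo_on_smooth[OF op disc_holo]])
  have e: "smooth_on \<Omega> (\<lambda>y. exp (w * half_tr S y))"
    by (rule smooth_on_holomorphic_compose[OF op open_UNIV, where h = exp])
      (auto intro!: smooth_on_mult[OF op smooth_on_const holo_on_smooth[OF op half_tr_holo]] holomorphic_intros)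
  show "smooth_on \<Omega> (\<lambda>y. al w (half_tr S y) (\<delta> y))" "smooth_on \<Omega> (\<lambda>y. be w (half_tr S y) (\<delta> y))"
    unfolding al_def be_def by (intro smooth_on_mult op e * ch_sh_holomorphic smooth_on_const)+
qed

text \<open>The two inputs are the derivatives \<open>aM\<close> of \<open>half_tr\<close> and
  \<open>2 cM \<delta>\<close> of \<open>\<delta>\<close>. The last term for \<open>be\<close> comes
  from eliminating \<open>sh'\<close>; it is what compensates \<open>D'(W) = cM W\<close> in
  \<open>D'_Emat\<close>.\<close>

lemma deriv_exp:
  assumes x: "x \<in> \<Omega>"
  shows "deriv10 u (\<lambda>y. al w (half_tr S y) (\<delta> y)) x =
      w * aM x u * al w (half_tr S x) (\<delta> x) + w * cM x u * \<delta> x * be w (half_tr S x) (\<delta> x)"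
    "deriv10 u (\<lambda>y. be w (half_tr S y) (\<delta> y)) x =
        w * aM x u * be w (half_tr S x) (\<delta> x) + w * cM x u * al w (half_tr S x) (\<delta> x) - cM x u * be w
            (half_tr S x) (\<delta> x)"
proof -
  let ?t = "half_tr S x" and ?s = "\<delta> x"
  have dt: "(\<lambda>y. w * half_tr S y) differentiable (at x)" and ds: "(\<lambda>y. w\<^sup>2 * \<delta> y) differentiable (at x)"
    using chart_differentiable(3,4)[OF x] by simp_all
  have t': "deriv10 u (\<lambda>y. w * half_tr S y) x = w * aM x u"
    using chart_differentiable(3)[OF x] by (simp add: deriv_mult deriv_half_tr_and_W(1)[OF x])
  have s': "deriv10 u (\<lambda>y. w\<^sup>2 * \<delta> y) x = w\<^sup>2 * (2 * cM x u * ?s)"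
    using chart_differentiable(4)[OF x] by (simp add: deriv_mult deriv_disc[OF x])
  have E: "deriv10 u (\<lambda>y. exp (w * half_tr S y)) x = exp (w * ?t) * (w * aM x u)"
    using deriv_holomorphic_compose(1)[OF dt DERIV_exp, of u] unfolding t' .
  have C: "deriv10 u (\<lambda>y. ch (w\<^sup>2 * \<delta> y)) x = sh (w\<^sup>2 * ?s) / 2 * (w\<^sup>2 * (2 * cM x u * ?s))"
    using deriv_holomorphic_compose(1)[OF ds DERIV_ch, of u] unfolding s' .
  have H: "deriv10 u (\<lambda>y. sh (w\<^sup>2 * \<delta> y)) x = sh' (w\<^sup>2 * ?s) * (w\<^sup>2 * (2 * cM x u * ?s))"
    using deriv_holomorphic_compose(1)[OF ds DERIV_sh, of u] unfolding s' .
  have d: "(\<lambda>y. exp (w * half_tr S y)) differentiable (at x)" "(\<lambda>y. ch (w\<^sup>2 * \<delta> y)) differentiable (at x)"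
    "(\<lambda>y. sh (w\<^sup>2 * \<delta> y)) differentiable (at x)"
    using has_derivative_holomorphic_compose[OF frechet_works[OF dt] DERIV_exp]
      has_derivative_holomorphic_compose[OF frechet_works[OF ds] DERIV_ch]
      has_derivative_holomorphic_compose[OF frechet_works[OF ds] DERIV_sh]
    by (auto intro: differentiableI)
  show "deriv10 u (\<lambda>y. al w (half_tr S y) (\<delta> y)) x = w * aM x u * al w ?t ?s + w * cM x u * ?s * be w ?t ?s"
    unfolding al_def deriv_mult(1)[OF d(1,2)] E C by (simp add: be_def algebra_simps power2_eq_square)
  have "deriv10 u (\<lambda>y. be w (half_tr S y) (\<delta> y)) x =
      w * aM x u * be w ?t ?s + exp (w * ?t) * (w * cM x u * (2 * (w\<^sup>2 * ?s) * sh' (w\<^sup>2 * ?s)))"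
    unfolding be_def using d by (simp add: deriv_mult E H) (simp add: algebra_simps power2_eq_square)?
  moreover have "2 * (w\<^sup>2 * ?s) * sh' (w\<^sup>2 * ?s) = ch (w\<^sup>2 * ?s) - sh (w\<^sup>2 * ?s)"
    using sh'_eq[of "w\<^sup>2 * ?s"] by (simp add: algebra_simps)
  ultimately have "deriv10 u (\<lambda>y. be w (half_tr S y) (\<delta> y)) x =
      w * aM x u * be w ?t ?s + exp (w * ?t) * (w * cM x u * (ch (w\<^sup>2 * ?s) - sh (w\<^sup>2 * ?s)))"
    by (simp only:)
  then show "deriv10 u (\<lambda>y. be w (half_tr S y) (\<delta> y)) x =
      w * aM x u * be w ?t ?s + w * cM x u * al w ?t ?s - cM x u * be w ?t ?s"
    by (simp add: al_def be_def algebra_simps)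
qed

text \<open>\<open>D'(U)\<close> is the multiplication operator \<open>Mm x u\<close>, which
  commutes with \<open>U\<close>; the exponential is therefore differentiated as in the scalar
  case.\<close>

lemma D'_Emat:
  assumes "smooth_on \<Omega> Y" "x \<in> \<Omega>"
  shows "D' S (\<lambda>_. u) (\<lambda>y. Emat S w y *v Y y) x =
      Emat S w x *v D' S (\<lambda>_. u) Y x + w *s (Mm x u *v (Emat S w x *v Y x))"
proof -
  note sm = assms(1) Wm_smooth exp_smooth smooth_smult
  have "D' S (\<lambda>_. u) (\<lambda>y. Emat S w y *v Y y) x =
     deriv10 u (\<lambda>y. al w (half_tr S y) (\<delta> y)) x *s Y x + al w (half_tr S x) (\<delta> x) *s D' S (\<lambda>_. u) Y x
     + (deriv10 u (\<lambda>y. be w (half_tr S y) (\<delta> y)) x *s (Wm x *v Y x) + be w (half_tr S x) (\<delta> x) *s (Wm x *v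
         D' S (\<lambda>_. u) Y x + cM x u *s (Wm x *v Y x)))"
    unfolding Emat_vec using assms(2) by (simp add: D'_add D'_smult D'_W sm)
  then show ?thesis
    unfolding deriv_exp[OF assms(2)] M_decomp[OF assms(2)]
    by (simp add: Emat_vec matrix_vector_right_distrib matrix_vec_smult Wmat_square vec_eq_iff algebra_simps)
qed

lemma Emat_smooth: "smooth_on \<Omega> Y \<Longrightarrow> smooth_on \<Omega> (\<lambda>y. Emat S w y *v Y y)"
  unfolding Emat_vec using op by (intro smooth_on_add smooth_smult exp_smooth Wm_smooth)

lemma delbar_holo_matrix:
  assumes "\<And>a b. holo_on \<Omega> (\<lambda>y. F y $ a $ b)" "smooth_on \<Omega> Y" "x \<in> \<Omega>"
  shows "delbar (\<lambda>_. u) (\<lambda>y. F y *v Y y) x = F x *v delbar (\<lambda>_. u) Y x"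
  using smooth_component_differentiable[OF assms(2,3)] holo_on_differentiable[OF assms(1,3)]
  by (simp add: del_mult_vec(2)[where X = "\<lambda>_. u"] mderiv01_holo[OF assms(1,3)])

lemma Emat_holo: "holo_on \<Omega> (\<lambda>y. Emat S w y $ a $ b)"
proof -
  have *: "holo_on \<Omega> (\<lambda>y. h (w\<^sup>2 * \<delta> y))" if "h holomorphic_on UNIV" for h
    by (rule holo_on_compose[OF _ open_UNIV that]) (intro holo_on_mult holo_on_const disc_holo, simp)
  have e: "holo_on \<Omega> (\<lambda>y. exp (w * half_tr S y))"
    by (rule holo_on_compose[OF _ open_UNIV, where h = exp])
      (intro holo_on_mult holo_on_const half_tr_holo, auto intro!: holomorphic_intros)
  show ?thesis
    unfolding Emat_def al_def be_def
    by (simp, intro holo_on_add holo_on_mult e * ch_sh_holomorphic holo_on_const Wm_holo)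
qed

text \<open>The image under \<open>\<kappa>\<close> of the holomorphy of
  \<open>Emat\<close>.\<close>

lemma D'_Edag:
  assumes "smooth_on \<Omega> Y" "x \<in> \<Omega>"
  shows "D' S (\<lambda>_. u) (\<lambda>y. Edag S z y *v Y y) x = Edag S z x *v D' S (\<lambda>_. u) Y x"
proof -
  have "D' S (\<lambda>_. u) (\<lambda>y. Edag S z y *v Y y) x = D' S (\<lambda>_. u) (\<lambda>y. \<kappa> y (Emat S (cnj z) y *v \<kappa> y (Y y))) x"
    using del_cong_open(1)[OF op assms(2), of "\<lambda>y. Edag S z y *v Y y"
        "\<lambda>y. \<kappa> y (Emat S (cnj z) y *v \<kappa> y (Y y))"] assms(2)
    by (simp add: D'_cmat Edag_eq_kappa_Emat)
  also have "\<dots> = Edag S z x *v D' S (\<lambda>_. u) Y x"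
    using assms by (simp add: D_kappa Emat_smooth kappa_smooth delbar_holo_matrix[OF Emat_holo] Edag_eq_kappa_Emat)
  finally show ?thesis .
qed

text \<open>The image under \<open>\<kappa>\<close> of \<open>D'_Emat\<close>. The extra term turns
  the holomorphic structure with \<open>z \<Phi>\<^sup>\<dagger>\<close> into the standard one, so
  that a holomorphic \<open>R\<close> remains as second factor.\<close>

lemma delbar_Edag:
  assumes "smooth_on \<Omega> Y" "x \<in> \<Omega>"
  shows "delbar (\<lambda>_. u) (\<lambda>y. Edag S z y *v Y y) x =
      Edag S z x *v delbar (\<lambda>_. u) Y x - z *s Phi_dag S x u (Edag S z x *v Y x)"
proof -
  have "delbar (\<lambda>_. u) (\<lambda>y. Edag S z y *v Y y) x = delbar (\<lambda>_. u) (\<lambda>y. \<kappa> y (Emat S (cnj z) y *v \<kappa> y (Y y))) x"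
    by (rule del_cong_open(2)[OF op assms(2)]) (simp add: Edag_eq_kappa_Emat)
  also have "\<dots> = Edag S z x *v delbar (\<lambda>_. u) Y x - z *s Phi_dag S x u (Edag S z x *v Y x)"
    using assms
    by (simp add: D_kappa Emat_smooth kappa_smooth D'_Emat Edag_eq_kappa_Emat kappa_simps Phi_dag_eq
        kappa_kappa vec_eq_iff)
  finally show ?thesis .
qed

end

section \<open>Sections over the product with the \<open>z\<close>-line\<close>

lemma smooth_on_snd:
  fixes f :: "'b::euclidean_space \<Rightarrow> 'c::real_normed_vector"
  assumes "open V" "smooth_on V f"
  shows "smooth_on ((UNIV :: 'a::euclidean_space set) \<times> V) (\<lambda>p. f (snd p))"
  using smooth_on_compose_affine[OF bounded_linear_snd open_Times[OF open_UNIV assms(1)] assms(1) _ assms(2), of 0]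
  by auto

lemma smooth_on_slice_snd:
  fixes s :: "'a::euclidean_space \<Rightarrow> 'b::euclidean_space \<Rightarrow> 'c::real_normed_vector"
  assumes "open V" "smooth_on (UNIV \<times> V) (\<lambda>(z, x). s z x)"
  shows "smooth_on V (s z)"
proof -
  have "bounded_linear (\<lambda>x::'b. (0::'a, x))"
    by (intro bounded_linear_Pair bounded_linear_zero bounded_linear_ident)
  from smooth_on_compose_affine[OF this assms(1) open_Times[OF open_UNIV assms(1)] _ assms(2), of "(z, 0)"]
  show ?thesis by simp
qed

lemma smooth_on_slice_fst:
  fixes s :: "'a::euclidean_space \<Rightarrow> 'b::euclidean_space \<Rightarrow> 'c::real_normed_vector"
  assumes "open V" "smooth_on (UNIV \<times> V) (\<lambda>(z, x). s z x)" "x \<in> V"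
  shows "smooth_on UNIV (\<lambda>z. s z x)"
proof -
  have "bounded_linear (\<lambda>z::'a. (z, 0::'b))"
    by (intro bounded_linear_Pair bounded_linear_zero bounded_linear_ident)
  from smooth_on_compose_affine[OF this open_UNIV open_Times[OF open_UNIV assms(1)] _ assms(2), of "(0, x)"]
  show ?thesis using assms(3) by simp
qed

lemma has_derivative_holo_mult:
  fixes f h :: "complex \<Rightarrow> complex"
  assumes "(f has_field_derivative f') (at z)" "h differentiable (at z)"
  shows "((\<lambda>w. f w * h w) has_derivative (\<lambda>v. f z * frechet_derivative h (at z) v + f' * v * h z)) (at z)"
  using assms(1) unfolding has_field_derivative_def
  by (intro has_derivative_mult frechet_works assms(2))

lemma del_z_matrix:
  fixes F :: "complex \<Rightarrow> complex^'n::finite \<Rightarrow> complex^'n^'n"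
  assumes "\<And>a b. ((\<lambda>w. F w x $ a $ b) has_field_derivative F' $ a $ b) (at z)"
    and "\<And>b. (\<lambda>w. s w x $ b) differentiable (at z)"
  shows "del_z (\<lambda>w y. F w y *v s w y) z x = F' *v s z x + F z x *v del_z s z x"
    "delbar_z (\<lambda>w y. F w y *v s w y) z x = F z x *v delbar_z s z x"
proof -
  let ?D = "\<lambda>b. frechet_derivative (\<lambda>w. s w x $ b) (at z)"
  have "((\<lambda>w. (F w x *v s w x) $ c) has_derivative
     (\<lambda>v. \<Sum>b\<in>UNIV. F z x $ c $ b * ?D b v + F' $ c $ b * v * s z x $ b)) (at z)" for c
    unfolding matrix_vector_mult_def vec_lambda_beta
    by (intro has_derivative_sum has_derivative_holo_mult assms)
  then have 1: "frechet_derivative (\<lambda>w. (F w x *v s w x) $ c) (at z) =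
     (\<lambda>v. \<Sum>b\<in>UNIV. F z x $ c $ b * ?D b v + F' $ c $ b * v * s z x $ b)" for c
    by (rule frechet_eq)
  show "del_z (\<lambda>w y. F w y *v s w y) z x = F' *v s z x + F z x *v del_z s z x"
    unfolding del_z_def 1
    by (simp add: vec_eq_iff matrix_vector_mult_def sum.distrib[symmetric] sum_divide_distrib
        sum_distrib_left sum_subtractf[symmetric])
       (intro allI sum.cong, auto simp: field_simps)
  show "delbar_z (\<lambda>w y. F w y *v s w y) z x = F z x *v delbar_z s z x"
    unfolding delbar_z_def 1
    by (simp add: vec_eq_iff matrix_vector_mult_def sum.distrib[symmetric] sum_divide_distrib sum_distrib_left)
       (intro allI sum.cong, auto simp: field_simps)
qed

lemma poly_holomorphic: "poly q holomorphic_on (T :: complex set)"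
  unfolding holomorphic_on_def field_differentiable_def
  using has_field_derivative_at_within[OF poly_DERIV] by blast

section \<open>Sufficiency: the gauge transformation for \<open>d = 2k\<close> or
  \<open>d = - 2k\<close>\<close>

locale tate_even = tate_chart +
  fixes k :: nat
  assumes d_even: "d\<^sup>2 / 4 = of_nat k ^ 2"
begin

abbreviation "R z x \<equiv> Rmat S d k z x"
abbreviation "R' z x \<equiv> Rmat' S d k z x"

lemma V_eq_0:
  assumes "x \<in> \<Omega>" "k = 0"
  shows "Vm x = 0"
proof -
  have "d = 0" using d_even assms(2) by simp
  then show ?thesis
    using skew2.zero[OF V_skew2[OF assms(1)] _ e_nonzero[OF assms(1)]] V_e[OF assms(1)] by simp
qed

lemma V_sq: "x \<in> \<Omega> \<Longrightarrow> Vm x *v (Vm x *v v) = (of_nat k ^ 2) *s v"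
  using V_square d_even by simp

text \<open>Since \<open>[W, V] = 2 W V\<close> and \<open>[W, W V] = 2 \<delta> V\<close>,
  comparing coefficients of \<open>1\<close>, \<open>W\<close>, \<open>V\<close>, \<open>W V\<close>
  reduces the equation to the four in \<open>rad_fun_ode\<close>.\<close>

lemma R_ode:
  assumes x: "x \<in> \<Omega>" and z: "z \<noteq> 0"
  shows "z *s (R' z x *v v) + (1 / z) *s (Wm x *v (R z x *v v) - R z x *v (Wm x *v v)) + R z x *v (Vm x *v v) = 0"
proof -
  note ode = rad_fun_ode[OF disc_nonzero[OF x], where z = z and k = k]
  let ?A = "fA k z (\<delta> x)" and ?B = "fB k z (\<delta> x)" and ?C = "fC k z (\<delta> x)" and ?D = "fD k z (\<delta> x)"
  let ?A' = "fA' k z (\<delta> x)" and ?B' = "fB' k z (\<delta> x)" and ?C' = "fC' k z (\<delta> x)" and ?D' = "fD' k z (\<delta> x)"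
  \<comment> \<open>Naming \<open>1 / z\<close> keeps the simplifier from clearing denominators
    while coefficients are collected.\<close>
  define i where "i = 1 / z"
  have "z *s (R' z x *v v) + i *s (Wm x *v (R z x *v v) - R z x *v (Wm x *v v)) + R z x *v (Vm x *v v)
    = (z * ?A' - of_nat k ^ 2 * ?C) *s v - (z * ?B' + of_nat k ^ 2 * ?D) *s (Wm x *v v)
     - (z * ?C' + 2 * i * \<delta> x * ?D - ?A) *s (Vm x *v v) - (z * ?D' + 2 * i * ?C + ?B) *s (Wm x *v (Vm x *v v))"
    by (simp add: Rmat_vec Rmat'_vec matrix_vector_right_distrib matrix_vector_mult_diff_distrib matrix_vec_smult
       Wmat_square V_sq[OF x] V_W_anticommute[OF x] linear_neg[OF matrix_vector_mul_linear] vec_eq_iff algebra_simps)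
  also have "\<dots> = 0"
  proof (cases "k = 0")
    case True
    then show ?thesis using ode(1,2) V_eq_0[OF x] z by simp
  next
    case False
    have "z * (z * ?C' + 2 * i * \<delta> x * ?D - ?A) = 0" "z * (z * ?D' + 2 * i * ?C + ?B) = 0"
      using ode(3,4) False z by (simp_all add: i_def algebra_simps)
    then show ?thesis using ode(1,2) z by simp
  qed
  finally show ?thesis by (simp add: i_def)
qed

lemma rad_holo:
  "fA k z holomorphic_on - {0}" "fB k z holomorphic_on - {0}" "fC k z holomorphic_on - {0}"
      "fD k z holomorphic_on - {0}"
proof -
  have *: "f holomorphic_on - {0}" if "\<And>s. s \<noteq> 0 \<Longrightarrow> (f has_field_derivative f' s) (at s)"
      for f f' :: "complex \<Rightarrow> complex"
    unfolding holomorphic_on_def field_differentiable_def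
  proof
    fix s :: complex assume "s \<in> - {0}"
    then show "\<exists>f'. (f has_field_derivative f') (at s within - {0})"
      using has_field_derivative_at_within[OF that[of s]] by auto
  qed
  show "fA k z holomorphic_on - {0}" "fB k z holomorphic_on - {0}" "fC k z holomorphic_on - {0}"
      "fD k z holomorphic_on - {0}"
    by (rule *, rule DERIV_rad_s, assumption)+
qed

lemma rad_disc_holo:
  "holo_on \<Omega> (\<lambda>y. fA k z (\<delta> y))" "holo_on \<Omega> (\<lambda>y. fB k z (\<delta> y))" "holo_on \<Omega> (\<lambda>y. fC k z (\<delta> y))"
      "holo_on \<Omega> (\<lambda>y. fD k z (\<delta> y))"
  using disc_nonzero by (auto intro!: holo_on_compose[OF disc_holo _ rad_holo(1)] holo_on_compose[OF
      disc_holo _ rad_holo(2)]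
     holo_on_compose[OF disc_holo _ rad_holo(3)] holo_on_compose[OF disc_holo _ rad_holo(4)])

lemma R_holo: "holo_on \<Omega> (\<lambda>y. R z y $ a $ b)"
  unfolding Rmat_def matrix_matrix_mult_def
  by (simp, intro holo_on_diff holo_on_mult holo_on_sum holo_on_const rad_disc_holo Wm_holo Vm_holo)

lemma R_smooth: "smooth_on \<Omega> Y \<Longrightarrow> smooth_on \<Omega> (\<lambda>y. R z y *v Y y)"
  by (intro smooth_on_matrix_vector op smooth_on_matrix holo_on_smooth R_holo)

lemma deriv_rad:
  assumes x: "x \<in> \<Omega>"
  shows "deriv10 u (\<lambda>y. fA k z (\<delta> y)) x = - cM x u * (z * fA' k z (\<delta> x))"
    "deriv10 u (\<lambda>y. fB k z (\<delta> y)) x = - cM x u * (z * fB' k z (\<delta> x) + fB k z (\<delta> x))"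
    "deriv10 u (\<lambda>y. fC k z (\<delta> y)) x = - cM x u * (z * fC' k z (\<delta> x))"
    "deriv10 u (\<lambda>y. fD k z (\<delta> y)) x = - cM x u * (z * fD' k z (\<delta> x) + fD k z (\<delta> x))"
  using disc_nonzero[OF x] by (simp_all add: deriv_holomorphic_compose(1)[OF chart_differentiable(4)[OF x]
      DERIV_rad_s(1)[OF disc_nonzero[OF x]]]
    deriv_holomorphic_compose(1)[OF chart_differentiable(4)[OF x] DERIV_rad_s(2)[OF disc_nonzero[OF x]]]
    deriv_holomorphic_compose(1)[OF chart_differentiable(4)[OF x] DERIV_rad_s(3)[OF disc_nonzero[OF x]]]
    deriv_holomorphic_compose(1)[OF chart_differentiable(4)[OF x] DERIV_rad_s(4)[OF disc_nonzero[OF x]]]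
        deriv_disc[OF x])
    (simp_all add: algebra_simps)

text \<open>One has \<open>\<nabla>W = c W + c [V, W]\<close>, \<open>\<nabla>V = 0\<close>, and
  \<open>2 c \<delta>\<close> as derivative of \<open>\<delta>\<close>. The commutator part yields
  \<open>c [V, R]\<close>; the rest scales \<open>W\<close> and \<open>\<delta>\<close>, which by
  homogeneity of \<open>R\<close> amounts to \<open>- c z\<close> times the derivative in
  \<open>z\<close>.\<close>

lemma nabla_R:
  assumes "smooth_on \<Omega> Y" "x \<in> \<Omega>"
  shows "nabla S (\<lambda>_. u) (\<lambda>y. R z y *v Y y) x = R z x *v nabla S (\<lambda>_. u) Y x
    + cM x u *s (Vm x *v (R z x *v Y x)) - cM x u *s (R z x *v (Vm x *v Y x)) - (cM x u * z) *s (R' z x *v Y x)"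
proof -
  note sm = rad_disc_holo[THEN holo_on_smooth[OF op]] assms(1) Wm_smooth Vm_smooth smooth_smult smooth_on_diff[OF op]
  have "nabla S (\<lambda>_. u) (\<lambda>y. R z y *v Y y) x =
    (deriv10 u (\<lambda>y. fA k z (\<delta> y)) x *s Y x + fA k z (\<delta> x) *s nabla S (\<lambda>_. u) Y x)
    - (deriv10 u (\<lambda>y. fB k z (\<delta> y)) x *s (Wm x *v Y x) + fB k z (\<delta> x) *s nabla S (\<lambda>_. u) (\<lambda>y. Wm y *v Y y) x)
    - (deriv10 u (\<lambda>y. fC k z (\<delta> y)) x *s (Vm x *v Y x) + fC k z (\<delta> x) *s nabla S (\<lambda>_. u) (\<lambda>y. Vm y *v Y y) x)
    - (deriv10 u (\<lambda>y. fD k z (\<delta> y)) x *s (Wm x *v (Vm x *v Y x)) + fD k z (\<delta> x) *s nabla S (\<lambda>_. u) (\<lambda>y. Wm y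
        *v (Vm y *v Y y)) x)"
    unfolding Rmat_vec using assms(2) by (simp add: nabla_add(2) nabla_smult sm)
  then show ?thesis
    unfolding deriv_rad[OF assms(2)] nabla_W[OF assms] nabla_V[OF assms] nabla_W[OF Vm_smooth[OF assms(1)] assms(2)]
    by (simp add: Rmat_vec Rmat'_vec matrix_vector_right_distrib matrix_vector_mult_diff_distrib matrix_vec_smult
       Wmat_square V_sq[OF assms(2)] V_W_anticommute[OF assms(2)] linear_neg[OF matrix_vector_mul_linear]
           vec_eq_iff algebra_simps)
qed

text \<open>The defect of this equation is \<open>- c\<close> times the left side of
  \<open>R_ode\<close>: the scalar \<open>a\<close> in \<open>M = a + c W\<close> commutes with
  \<open>R\<close>, and \<open>D' = \<nabla> - c V\<close> absorbs the term
  \<open>c V R\<close>.\<close>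

lemma D'_R:
  assumes "smooth_on \<Omega> Y" "x \<in> \<Omega>" "z \<noteq> 0"
  shows "D' S (\<lambda>_. u) (\<lambda>y. R z y *v Y y) x - (1 / z) *s (Mm x u *v (R z x *v Y x))
    = R z x *v (nabla S (\<lambda>_. u) Y x - (1 / z) *s (Mm x u *v Y x))"
proof -
  let ?c = "cM x u"
  have "?c *s (z *s (R' z x *v Y x) + (1 / z) *s (Wm x *v (R z x *v Y x) - R z x *v (Wm x *v Y x)) + R z x
      *v (Vm x *v Y x)) = 0"
    using R_ode[OF assms(2,3), of "Y x"] by simp
  then show ?thesis
    unfolding D'_nabla[OF assms(2)] nabla_R[OF assms(1,2)] M_decomp[OF assms(2)]
    by (simp add: matrix_vector_right_distrib matrix_vector_mult_diff_distrib matrix_vec_smult vec_eq_iff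
        algebra_simps)
qed

lemma R_injective:
  assumes x: "x \<in> \<Omega>" "R z x *v v = R z x *v v'"
  shows "v = v'"
proof -
  let ?A = "fA k z (\<delta> x)" and ?B = "fB k z (\<delta> x)" and ?C = "fC k z (\<delta> x)" and ?D = "fD k z (\<delta> x)"
  \<comment> \<open>The quaternion conjugate of \<open>R\<close>, with the signs of
    \<open>W\<close>, \<open>V\<close>, \<open>W V\<close> reversed; its product with
    \<open>R\<close> is the norm, equal to 1.\<close>
  define P where "P v = ?A *s v + ?B *s (Wm x *v v) + ?C *s (Vm x *v v) + ?D *s (Wm x *v (Vm x *v v))" for v
  have "P (R z x *v v) = (?A ^ 2 - \<delta> x * ?B ^ 2 - of_nat k ^ 2 * ?C ^ 2 + of_nat k ^ 2 * \<delta> x * ?D ^ 2) *s v" for v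
    by (simp add: P_def Rmat_vec matrix_vector_right_distrib matrix_vector_mult_diff_distrib matrix_vec_smult
       Wmat_square V_sq[OF x(1)] V_W_anticommute[OF x(1)] linear_neg[OF matrix_vector_mul_linear] vec_eq_iff
           algebra_simps power2_eq_square)
  then have "P (R z x *v v) = v" for v
    unfolding rad_fun_norm[OF disc_nonzero[OF x(1)]] by simp
  then show ?thesis using x(2) by metis
qed

lemma phi_vec: "phi S d k z x *v v = Edag S z x *v (R z x *v v)"
  by (simp add: phi_def matrix_vector_mul_assoc)

lemma phi_invertible:
  assumes "x \<in> \<Omega>"
  shows "invertible (phi S d k z x)"
proof -
  have "inj ((*v) (phi S d k z x))"
    unfolding inj_def phi_vec using Edag_injective R_injective assms by blast
  then show ?thesis
    by (simp add: invertible_left_inverse matrix_left_invertible_injective)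
qed

lemma phi_DERIV:
  assumes "x \<in> \<Omega>"
  shows "((\<lambda>z. phi S d k z x $ a $ b) has_field_derivative (Edag' S z x ** R z x + Edag S z x ** R' z x) $ a
      $ b) (at z)"
  unfolding phi_def
  by (rule DERIV_matrix_mult) (simp_all add: DERIV_Edag DERIV_Rmat disc_nonzero assms)

lemma phi_smooth: "smooth_on (UNIV \<times> \<Omega>) (\<lambda>(z, x). phi S d k z x)"
proof -
  let ?P = "(UNIV :: complex set) \<times> \<Omega>"
  have opP: "open ?P" by (intro open_Times open_UNIV op)
  have fst: "smooth_on ?P fst" by (rule smooth_on_bounded_linear[OF bounded_linear_fst])
  have holo: "smooth_on ?P (\<lambda>p. f (snd p))" if "holo_on \<Omega> f" for f
    by (rule smooth_on_snd[OF op holo_on_smooth[OF op that]])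
  have t: "smooth_on ?P (\<lambda>p. cnj (half_tr S (snd p)))" and s: "smooth_on ?P (\<lambda>p. cnj (\<delta> (snd p)))"
    by (intro smooth_on_cnj opP holo half_tr_holo disc_holo)+
  have ent: "smooth_on ?P (\<lambda>p. h (f p))" if "h holomorphic_on UNIV" "smooth_on ?P f" for f h
    by (rule smooth_on_holomorphic_compose[OF opP open_UNIV that(1) _ that(2)]) simp
  have W: "smooth_on ?P (\<lambda>p. Wm (snd p) $ a $ b)" and V: "smooth_on ?P (\<lambda>p. Vm (snd p) $ a $ b)" for a b
    using holo[OF Wm_holo, of a b] holo[OF Vm_holo, of a b] by simp_all
  have "smooth_on \<Omega> (real_structure S)"
    using cdv by (simp add: cdv_on_def real_structure_on_def)
  then have K: "smooth_on ?P (\<lambda>p. real_structure S (snd p))"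
    by (rule smooth_on_snd[OF op])
  have Kc: "smooth_on ?P (\<lambda>p. real_structure S (snd p) $ a $ b)" for a b
    using K by (simp add: smooth_on_vec[OF opP])
  have cK: "smooth_on ?P (\<lambda>p. cnjm (real_structure S (snd p)))" and cW: "smooth_on ?P (\<lambda>p. cnjm (Wm (snd p)))"
    by (rule smooth_on_matrix[OF opP], simp add: cnjm_def, intro smooth_on_cnj opP Kc W)+
  have Wd: "smooth_on ?P (\<lambda>p. Wdag S (snd p))"
    unfolding Wdag_def by (intro smooth_on_matrix_mult opP K cW cK)
  have Wdc: "smooth_on ?P (\<lambda>p. Wdag S (snd p) $ a $ b)" for a b
    using Wd by (simp add: smooth_on_vec[OF opP])
  have al: "smooth_on ?P (\<lambda>p. al (fst p) (cnj (half_tr S (snd p))) (cnj (\<delta> (snd p))))"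
    and be: "smooth_on ?P (\<lambda>p. be (fst p) (cnj (half_tr S (snd p))) (cnj (\<delta> (snd p))))"
    unfolding al_def be_def
    by (intro smooth_on_mult opP ent[where h = exp] ent[where h = ch] ent[where h = sh] smooth_on_power fst t s
        ch_sh_holomorphic holomorphic_on_exp)+
  have E: "smooth_on ?P (\<lambda>p. Edag S (fst p) (snd p))"
    by (rule smooth_on_matrix[OF opP], simp add: Edag_def,
        intro smooth_on_add smooth_on_mult opP al be smooth_on_const Wdc)
  have inv: "smooth_on ?P (\<lambda>p. inverse (\<delta> (snd p)))"
    by (rule smooth_on_inverse[OF opP holo[OF disc_holo]]) (auto simp: disc_nonzero)
  have pol: "smooth_on ?P (\<lambda>p. poly q ((fst p)\<^sup>2 * inverse (\<delta> (snd p))))" for q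
    by (intro ent[where h = "poly q"] poly_holomorphic smooth_on_mult smooth_on_power opP fst inv)
  have f: "smooth_on ?P (\<lambda>p. fA k (fst p) (\<delta> (snd p)))" "smooth_on ?P (\<lambda>p. fB k (fst p) (\<delta> (snd p)))"
    "smooth_on ?P (\<lambda>p. fC k (fst p) (\<delta> (snd p)))" "smooth_on ?P (\<lambda>p. fD k (fst p) (\<delta> (snd p)))"
    unfolding fA_def fB_def fC_def fD_def divide_inverse
    by (intro smooth_on_mult smooth_on_power opP fst inv pol)+
  have R: "smooth_on ?P (\<lambda>p. R (fst p) (snd p))"
    by (rule smooth_on_matrix[OF opP], simp add: Rmat_def matrix_matrix_mult_def,
        intro smooth_on_diff smooth_on_mult smooth_on_sum opP f smooth_on_const W V)
  show ?thesis
    unfolding case_prod_beta phi_def by (intro smooth_on_matrix_mult opP E R)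
qed

lemma section_smooth:
  assumes "s \<in> smooth_sections \<Omega>"
  shows "smooth_on \<Omega> (s z)" "x \<in> \<Omega> \<Longrightarrow> (\<lambda>w. s w x $ b) differentiable (at z)"
proof -
  have s: "smooth_on (UNIV \<times> \<Omega>) (\<lambda>(z, x). s z x)"
    using assms by (simp add: smooth_sections_def)
  show "smooth_on \<Omega> (s z)" by (rule smooth_on_slice_snd[OF op s])
  assume "x \<in> \<Omega>"
  from smooth_on_component[OF open_UNIV smooth_on_slice_fst[OF op s this], of b]
  show "(\<lambda>w. s w x $ b) differentiable (at z)" using smooth_on_differentiable by blast
qed

lemma phi_holo_iso: "holo_iso_on \<Omega> S (phi S d k)"
  unfolding holo_iso_on_def
proof (intro conjI allI ballI)
  fix s z x u assume s: "s \<in> smooth_sections \<Omega>" and x: "x \<in> \<Omega>"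
  show "phi S d k z x *v delbar (\<lambda>_. u) (s z) x =
      delbar (\<lambda>_. u) (\<lambda>y. phi S d k z y *v s z y) x + z *s Phi_dag S x u (phi S d k z x *v s z x)"
    unfolding phi_vec delbar_Edag[OF R_smooth[OF section_smooth(1)[OF s]] x]
    by (simp add: delbar_holo_matrix[OF R_holo section_smooth(1)[OF s] x])
next
  fix s z x assume "s \<in> smooth_sections \<Omega>" "x \<in> \<Omega>"
  then show "phi S d k z x *v delbar_z s z x = delbar_z (\<lambda>w y. phi S d k w y *v s w y) z x"
    by (intro del_z_matrix(2)[where F = "phi S d k" and F' = "Edag' S z x ** R z x + Edag S z x ** R' z x",
        symmetric] phi_DERIV section_smooth(2))
qed (auto simp: phi_smooth phi_invertible)

lemma phi_intertwines: "intertwines_on \<Omega> d S (phi S d k)"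
  unfolding intertwines_on_def
proof (intro conjI allI ballI impI)
  fix s z x u assume s: "s \<in> smooth_sections \<Omega>" and x: "x \<in> \<Omega>" and z: "z \<noteq> (0::complex)"
  note sm = section_smooth(1)[OF s, of z]
  show "phi S d k z x *v nabla_tilde_M S u s z x = D_tilde_M S u (\<lambda>w y. phi S d k w y *v s w y) z x"
  proof -
    have "phi S d k z x *v nabla_tilde_M S u s z x =
        Edag S z x *v (R z x *v (nabla S (\<lambda>_. u) (s z) x - (1 / z) *s (Mm x u *v s z x)))"
      by (simp add: nabla_tilde_M_def phi_vec Phi_def Mm_mult)
    also have "\<dots> = D' S (\<lambda>_. u) (\<lambda>y. Edag S z y *v (R z y *v s z y)) x - (1 / z) *s (Mm x u *v (Edag S z x
        *v (R z x *v s z x)))"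
      unfolding D'_R[OF sm x z, symmetric] D'_Edag[OF R_smooth[OF sm] x] M_Edag_commute[OF x]
      by (simp add: matrix_vector_mult_diff_distrib matrix_vec_smult)
    also have "\<dots> = D_tilde_M S u (\<lambda>w y. phi S d k w y *v s w y) z x"
      by (simp add: D_tilde_M_def phi_vec Phi_def Mm_mult)
    finally show ?thesis .
  qed
next
  fix s z x assume s: "s \<in> smooth_sections \<Omega>" and x: "x \<in> \<Omega>" and z: "z \<noteq> (0::complex)"
  note sm = section_smooth(1)[OF s, of z]
  let ?v = "s z x"
  let ?E = "Edag S z x"
  have "smooth_on \<Omega> (\<lambda>y. phi S d k z y *v s z y)"
    by (intro smooth_on_matrix_vector op sm smooth_on_slice_snd[OF op phi_smooth])
  then have Q: "Q_op S d (\<lambda>y. phi S d k z y *v s z y) x = 0"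
    by (rule tate[OF _ x])
  have dz: "del_z (\<lambda>w y. phi S d k w y *v s w y) z x =
      U_dag S x (?E *v (R z x *v ?v)) + ?E *v (R' z x *v ?v) + ?E *v (R z x *v del_z s z x)"
  proof -
    have "del_z (\<lambda>w y. phi S d k w y *v s w y) z x =
       (Edag' S z x ** R z x + Edag S z x ** R' z x) *v ?v + phi S d k z x *v del_z s z x"
      by (rule del_z_matrix(1)) (rule phi_DERIV[OF x], rule section_smooth(2)[OF s x])
    then show ?thesis
      by (simp add: matrix_vector_mult_add_rdistrib matrix_vector_mul_assoc[symmetric] Edag'_vec[OF x] phi_vec)
  qed
  have UE: "Um x *v (?E *v w) = ?E *v (Um x *v w)" for w
    using M_Edag_commute[OF x] by (simp add: Umat_def)
  \<comment> \<open>This is \<open>R_ode\<close> with \<open>U\<close> in place of \<open>W\<close>,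
    the scalar \<open>half_tr\<close> dropping out of the commutator.\<close>
  have rw: "R z x *v ((1 / z) *s (Um x *v ?v) - Vm x *v ?v) =
      z *s (R' z x *v ?v) + (1 / z) *s (Um x *v (R z x *v ?v))"
    using R_ode[OF x z, of ?v]
    by (simp add: Umat_Wmat matrix_vector_right_distrib matrix_vector_mult_diff_distrib matrix_vec_smult
        vec_eq_iff algebra_simps)
  have "phi S d k z x *v nabla_tilde_z S d s z x =
     ?E *v (R z x *v del_z s z x) + (1 / z) *s (?E *v (R z x *v ((1 / z) *s (Um x *v ?v) - Vm x *v ?v)))"
    by (simp only: nabla_tilde_z_def phi_vec U_op_Umat V_op_Vm[OF x] matrix_vector_right_distrib matrix_vec_smult)
  also have "\<dots> = D_tilde_z S d (\<lambda>w y. phi S d k w y *v s w y) z x"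
    unfolding rw D_tilde_z_def dz Q
    unfolding U_op_Umat phi_vec UE
    using z by (simp add: matrix_vector_right_distrib matrix_vec_smult vec_eq_iff algebra_simps)
  finally show "phi S d k z x *v nabla_tilde_z S d s z x = D_tilde_z S d (\<lambda>w y. phi S d k w y *v s w y) z x" .
qed

end

section \<open>Necessity of the parity condition\<close>

text \<open>On the Taylor coefficients \<open>\<beta> n\<close> of a row solution the equation reads
  \<open>\<beta> n \<circ> (n + V) = \<beta> (n + 1) \<circ> T\<close>. Composing with \<open>n - V\<close> shows that nonzero coefficients would grow
  with \<open>n\<close>, contradicting convergence on the whole plane. So the solution is a polynomial, and
  its leading coefficient of degree \<open>m\<close> forces \<open>m\<^sup>2 = K\<close>.\<close>

lemma entire_system_resonance:
  fixes T V :: "complex^'n::finite^'n" and p :: "'n \<Rightarrow> complex \<Rightarrow> complex"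
  assumes hol: "\<And>j. p j holomorphic_on UNIV"
    and ode: "\<And>b z. z \<noteq> 0 \<Longrightarrow> z\<^sup>2 * (\<Sum>j\<in>UNIV. b $ j * deriv (p j) z) =
        (\<Sum>j\<in>UNIV. (T *v b) $ j * p j z) - z * (\<Sum>j\<in>UNIV. (V *v b) $ j * p j z)"
    and V: "\<And>b. V *v (V *v b) = K *s b"
    and nz: "p j0 0 \<noteq> 0"
  shows "\<exists>m::nat. K = of_nat m ^ 2"
proof -
  define a where "a j n = (deriv ^^ n) (p j) 0 / fact n" for j n
  define \<beta> where "\<beta> n b = (\<Sum>j\<in>UNIV. b $ j * a j n)" for n and b :: "complex^'n"
  have sums: "(\<lambda>n. a j n * z ^ n) sums p j z" for j z
    using holomorphic_power_series[of "p j" 0 "norm z + 1" z] holomorphic_on_subset[OF hol] by (simp add: a_def)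
  have expand: "p j has_fps_expansion Abs_fps (a j)" for j
    by (rule has_fps_expansionI) (simp add: sums)
  have lin: "\<beta> n (b - c) = \<beta> n b - \<beta> n c" "\<beta> n (b + c) = \<beta> n b + \<beta> n c" "\<beta> n (l *s b) = l * \<beta> n b" for n b c l
    by (simp_all add: \<beta>_def algebra_simps sum_subtractf sum.distrib sum_distrib_left)
  have rec: "\<beta> n (of_nat n *s b + V *v b) = \<beta> (Suc n) (T *v b)" for n b
  proof -
    \<comment> \<open>The equation is known for nonzero \<open>z\<close> only; continuity extends it
      to the origin, so that the power series of \<open>q\<close> may be compared with zero.\<close>
    define q where "q z = z * (\<Sum>j\<in>UNIV. (V *v b) $ j * p j z) + z ^ 2 * (\<Sum>j\<in>UNIV. b $ j * deriv (p j) z) -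
        (\<Sum>j\<in>UNIV. (T *v b) $ j * p j z)" for z
    have "continuous_on UNIV q"
      unfolding q_def[abs_def]
      by (intro continuous_intros holomorphic_on_imp_continuous_on hol holomorphic_deriv open_UNIV)
    then have "isCont q 0" by (simp add: continuous_on_eq_continuous_at)
    then have "(q \<longlongrightarrow> q 0) (at 0)" by (simp add: isCont_def)
    moreover have q0: "q z = 0" if "z \<noteq> 0" for z
      using ode[OF that, of b] by (simp add: q_def)
    then have "(q \<longlongrightarrow> 0) (at 0)"
      by (intro tendsto_eventually) (auto simp: eventually_at intro!: exI[of _ 1])
    ultimately have "q 0 = 0" using tendsto_unique[of "at (0::complex)"] by auto
    with q0 have q: "q = (\<lambda>z. 0)" by (metis ext)
    let ?F = "fps_X * (\<Sum>j\<in>UNIV. fps_const ((V *v b) $ j) * Abs_fps (a j)) + fps_X ^ 2 * (\<Sum>j\<in>UNIV. fps_const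
        (b $ j) * fps_deriv (Abs_fps (a j)))
       - (\<Sum>j\<in>UNIV. fps_const ((T *v b) $ j) * Abs_fps (a j))"
    have "q has_fps_expansion ?F"
      unfolding q_def[abs_def]
      by (intro has_fps_expansion_diff has_fps_expansion_add has_fps_expansion_mult has_fps_expansion_sum
          has_fps_expansion_cmult_left has_fps_expansion_deriv expand has_fps_expansion_fps_X
              has_fps_expansion_fps_X_power)
    from fps_nth_fps_expansion[OF this, of "Suc n"]
    have "fps_nth ?F (Suc n) = 0" by (simp add: q)
    moreover have "fps_nth ?F (Suc n) = \<beta> n (V *v b) + of_nat n * \<beta> n b - \<beta> (Suc n) (T *v b)"
      by (cases n) (simp_all add: \<beta>_def fps_sum_nth fps_mult_left_const_nth power2_eq_square mult.assoc
          sum_distrib_left mult_ac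
        del: of_nat_Suc)
    ultimately have "\<beta> n (V *v b) + of_nat n * \<beta> n b - \<beta> (Suc n) (T *v b) = 0" by (simp only:)
    then show ?thesis by (simp add: lin add.commute)
  qed
  have rec2: "(of_nat n ^ 2 - K) * \<beta> n b = \<beta> (Suc n) (T *v (of_nat n *s b - V *v b))" for n b
  proof -
    have "of_nat n *s (of_nat n *s b - V *v b) + V *v (of_nat n *s b - V *v b) = (of_nat n ^ 2 - K) *s b"
      by (simp add: matrix_vector_mult_diff_distrib matrix_vec_smult V vec_eq_iff algebra_simps power2_eq_square)
    then show ?thesis using rec[of n "of_nat n *s b - V *v b"] by (simp add: lin left_diff_distrib)
  qed
  define N where "N n = (\<Sum>j\<in>UNIV. norm (a j n))" for n
  define l1 where "l1 b = (\<Sum>j\<in>UNIV. norm (b $ j))" for b :: "complex^'n"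
  have bound: "norm (\<beta> n b) \<le> N n * l1 b" for n b
  proof -
    have "norm (\<beta> n b) \<le> (\<Sum>j\<in>UNIV. norm (a j n) * norm (b $ j))"
      unfolding \<beta>_def by (rule order_trans[OF norm_sum]) (simp add: norm_mult mult.commute)
    also have "\<dots> \<le> (\<Sum>j\<in>UNIV. N n * norm (b $ j))"
      by (intro sum_mono mult_right_mono) (auto simp: N_def intro: member_le_sum)
    finally show ?thesis by (simp add: l1_def sum_distrib_left)
  qed
  define C where "C = (\<Sum>j\<in>UNIV. l1 (T *v axis j 1)) + (\<Sum>j\<in>UNIV. l1 (T *v (V *v axis j 1)))"
  have l1_pos: "l1 b \<ge> 0" for b by (simp add: l1_def sum_nonneg)
  have N_pos: "N n \<ge> 0" for n by (simp add: N_def sum_nonneg)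
  have C_pos: "C \<ge> 0" by (simp add: C_def sum_nonneg l1_pos)
  have growth: "norm (of_nat n ^ 2 - K) * N n \<le> N (Suc n) * (real n * C + C)" for n
  proof -
    have \<beta>_axis: "\<beta> n (axis j 1) = a j n" for j
      by (simp add: \<beta>_def axis_def if_distrib[of "\<lambda>x. x * _"] sum.delta cong: if_cong)
    have l1_le: "l1 (T *v (of_nat n *s axis j 1 - V *v axis j 1)) \<le> real n * l1 (T *v axis j 1) + l1 (T *v
        (V *v axis j 1))" for j
      unfolding l1_def matrix_vector_mult_diff_distrib matrix_vec_smult sum_distrib_left sum.distrib[symmetric]
    proof (rule sum_mono)
      fix i
      show "norm ((of_nat n *s (T *v axis j 1) - T *v (V *v axis j 1)) $ i)
        \<le> real n * norm ((T *v axis j 1) $ i) + norm ((T *v (V *v axis j 1)) $ i)"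
        using norm_triangle_ineq4[of "of_nat n * (T *v axis j 1) $ i" "(T *v (V *v axis j 1)) $ i"]
        by (simp add: norm_mult)
    qed
    have "norm (of_nat n ^ 2 - K) * N n = (\<Sum>j\<in>UNIV. norm ((of_nat n ^ 2 - K) * \<beta> n (axis j 1)))"
      by (simp add: N_def sum_distrib_left norm_mult \<beta>_axis)
    also have "\<dots> \<le> (\<Sum>j\<in>UNIV. N (Suc n) * (real n * l1 (T *v axis j 1) + l1 (T *v (V *v axis j 1))))"
      unfolding rec2 by (intro sum_mono order_trans[OF bound] mult_left_mono l1_le N_pos)
    also have "\<dots> = N (Suc n) * (real n * (\<Sum>j\<in>UNIV. l1 (T *v axis j 1)) + (\<Sum>j\<in>UNIV. l1 (T *v (V *v axis j 1))))"
      by (simp add: sum_distrib_left sum.distrib distrib_left)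
    also have "\<dots> \<le> N (Suc n) * (real n * C + C)"
      by (intro mult_left_mono N_pos add_mono) (simp_all add: C_def sum_nonneg l1_pos)
    finally show ?thesis .
  qed
  \<comment> \<open>From \<open>n0\<close> on the quadratic factor \<open>n\<^sup>2 - K\<close>
    dominates the linear bound \<open>n C + C\<close>, because
    \<open>n (2 C + norm K + 1) \<le> n\<^sup>2\<close>.\<close>
  obtain n0 where n0: "real n0 \<ge> 2 * C + norm K + 1"
    using real_arch_simple by blast
  have mono: "N n \<le> N (Suc n)" if "n \<ge> n0" for n
  proof -
    have n: "real n \<ge> 2 * C + norm K + 1" using n0 that by linarith
    have n1: "real n \<ge> 1" using n C_pos norm_ge_zero[of K] by linarith
    have "real n * C + C \<le> real n * (2 * C)"
      using mult_right_mono[OF n1 C_pos] by (simp add: mult.commute)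
    moreover have "norm K \<le> real n * norm K" using mult_right_mono[OF n1 norm_ge_zero[of K]] by simp
    moreover have "real n * (2 * C + norm K + 1) \<le> real n * real n"
      using n by (intro mult_left_mono) auto
    ultimately have "real n * C + C + real n \<le> real n ^ 2 - norm K"
      by (simp add: algebra_simps power2_eq_square)
    also have "\<dots> \<le> norm (of_nat n ^ 2 - K)"
      using norm_triangle_ineq2[of "of_nat n ^ 2" K] by (simp add: norm_power)
    finally have le: "real n * C + C + real n \<le> norm (of_nat n ^ 2 - K)" .
    then have pos: "norm (of_nat n ^ 2 - K) > 0"
      using n1 C_pos mult_nonneg_nonneg[of "real n" C] by linarith
    have "norm (of_nat n ^ 2 - K) * N n \<le> N (Suc n) * norm (of_nat n ^ 2 - K)"
      using growth[of n] mult_left_mono[OF _ N_pos, of "real n * C + C" "norm (of_nat n ^ 2 - K)"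
          "Suc n"] le n1 by linarith
    then show ?thesis using pos by (simp add: mult.commute)
  qed
  \<comment> \<open>Convergence at \<open>z = 1\<close> makes the coefficients tend to zero, while
    \<open>N\<close> is nondecreasing from \<open>n0\<close> on; hence \<open>N\<close> vanishes
    there.\<close>
  have "a j \<longlonglongrightarrow> 0" for j
    using summable_LIMSEQ_zero[OF sums_summable[OF sums[of j 1]]] by simp
  then have "N \<longlonglongrightarrow> (\<Sum>j\<in>(UNIV::'n set). 0)"
    unfolding N_def[abs_def] by (intro tendsto_sum tendsto_norm_zero)
  then have N0: "N \<longlonglongrightarrow> 0" by simp
  have zero: "N n = 0" if "n \<ge> n0" for n
  proof -
    have "N n \<le> N (n + i)" for i
      by (induction i) (use mono that in \<open>auto intro: order_trans\<close>)
    then have "N n \<le> 0"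
      using LIMSEQ_le_const[OF LIMSEQ_ignore_initial_segment[OF N0, of n], of "N n"] by (auto simp: add.commute)
    then show ?thesis using N_pos[of n] by simp
  qed
  have a0: "a j0 0 \<noteq> 0" using nz by (simp add: a_def)
  have "finite {n. N n \<noteq> 0}"
    by (rule finite_subset[of _ "{..<n0}"]) (use zero in \<open>auto simp: not_le[symmetric]\<close>)
  moreover have "0 \<in> {n. N n \<noteq> 0}"
    using a0 by (simp add: N_def sum_nonneg_eq_0_iff) blast
  \<comment> \<open>\<open>m\<close> is the degree of the polynomial solution. The value at the
    origin is nonzero, so the set of indices is nonempty, and \<open>growth\<close> at
    \<open>m\<close> has right side zero.\<close>
  ultimately obtain m where m: "N m \<noteq> 0" "\<And>n. n > m \<Longrightarrow> N n = 0"
    using Max_in[of "{n. N n \<noteq> 0}"] Max_ge[of "{n. N n \<noteq> 0}"] by (metis (mono_tags,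
        lifting) empty_iff leD mem_Collect_eq)
  have "norm (of_nat m ^ 2 - K) * N m \<le> 0"
    using growth[of m] m(2)[of "Suc m"] by simp
  then have "of_nat m ^ 2 - K = 0"
    using m(1) N_pos[of m] by (auto simp: mult_le_0_iff)
  then show ?thesis by (intro exI[of _ m]) simp
qed

lemma commutant_2:
  fixes A W :: "complex^2^2"
  assumes "trace W = 0" "\<And>v. A *v (W *v v) = W *v (A *v v)" "\<And>v. W *v (W *v v) = \<delta> *s v" "\<delta> \<noteq> 0"
  obtains a c where "\<And>v. A *v v = a *s v + c *s (W *v v)"
proof -
  let ?A = "A - msc (trace A / 2) (mat 1)"
  have "?A *v v = (trace (?A ** W) / (2 * \<delta>)) *s (W *v v)" for v
    by (rule traceless_commutant[OF _ assms(1) _ assms(3,4)])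
      (simp_all add: trace_sub trace_msc trace_mat_1_2 matrix_vector_mult_diff_rdistrib
          matrix_vector_mult_diff_distrib
         assms(2) matrix_vec_smult)
  then have "A *v v = (trace A / 2) *s v + (trace (?A ** W) / (2 * \<delta>)) *s (W *v v)" for v
    by (simp add: matrix_vector_mult_diff_rdistrib algebra_simps)
  then show ?thesis by (rule that)
qed

section \<open>The obstruction at a single point\<close>

context tate_chart
begin

lemma Um_Udag_commute: "x \<in> \<Omega> \<Longrightarrow> Um x *v (U_dag S x v) = U_dag S x (Um x *v v)"
  using M_Udag_commute[of x "E x" v] by (simp add: Umat_def)

text \<open>\<open>P = W + r\<close> kills the eigenline of \<open>W\<close> for \<open>- r\<close>.
  Applied after \<open>\<phi>\<close>, it replaces the left actions of \<open>U\<close> and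
  \<open>U\<^sup>\<dagger>\<close>, both polynomials in \<open>W\<close>, by the scalars
  \<open>u\<close> and \<open>\<mu>\<close>. What remains is a row solution to which
  \<open>entire_system_resonance\<close> applies.\<close>

lemma gauge_imp_even:
  assumes hol: "holo_iso_on \<Omega> S \<phi>" and int: "intertwines_on \<Omega> d S \<phi>" and x: "x \<in> \<Omega>"
  shows "\<exists>m::nat. d\<^sup>2 / 4 = of_nat m ^ 2"
proof -
  define r where "r = csqrt (\<delta> x)"
  have r: "r * r = \<delta> x" by (simp add: r_def power2_eq_square[symmetric])
  define P where "P v = Wm x *v v + r *s v" for v
  define Ud where "Ud = msc (cnj (half_tr S x)) (mat 1) + Wdag S x"
  have Ud: "U_dag S x v = Ud *v v" for v
    by (simp add: Ud_def U_dag_Wdag[OF x] matrix_vector_mult_add_rdistrib)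
  have "Ud *v (Wm x *v v) = Wm x *v (Ud *v v)" for v
    using Um_Udag_commute[OF x, of v] unfolding Ud Umat_Wmat
    by (simp add: matrix_vector_right_distrib matrix_vec_smult)
  then obtain a c where ac: "\<And>v. Ud *v v = a *s v + c *s (Wm x *v v)"
    using commutant_2[OF trace_Wmat _ Wmat_square disc_nonzero[OF x], of Ud] by metis
  define \<mu> where "\<mu> = a + c * r"
  define u where "u = half_tr S x + r"
  have P_lin: "P (v + w) = P v + P w" "P (v - w) = P v - P w" "P (l *s v) = l *s P v" for v w l
    by (simp_all add: P_def matrix_vector_right_distrib matrix_vector_mult_diff_distrib matrix_vec_smult
        vec_eq_iff algebra_simps)
  have PW: "P (Wm x *v v) = r *s P v" for v
    by (simp add: P_def Wmat_square r[symmetric] vec_eq_iff algebra_simps)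
  have PU: "P (Um x *v v) = u *s P v" for v
    by (simp add: Umat_Wmat P_lin PW u_def vec_eq_iff algebra_simps)
  have PUd: "P (Ud *v v) = \<mu> *s P v" for v
    by (simp add: ac P_lin PW \<mu>_def vec_eq_iff algebra_simps)
  have inv: "invertible (\<phi> z x)" for z
    using hol x by (simp add: holo_iso_on_def)
  have sm: "smooth_on (UNIV \<times> \<Omega>) (\<lambda>(z, x). \<phi> z x)"
    using hol by (simp add: holo_iso_on_def)
  define q where "q b z = \<phi> z x *v b" for b z
  define q' where "q' b z = del_z (\<lambda>w y. \<phi> w y *v b) z x" for b z
  have const_sec: "(\<lambda>z x. b) \<in> smooth_sections \<Omega>" for b
    by (simp add: smooth_sections_def case_prod_unfold)
  have H: "\<forall>s\<in>smooth_sections \<Omega>. \<forall>z. \<forall>x\<in>\<Omega>. \<phi> z x *v delbar_z s z x = delbar_z (\<lambda>w y. \<phi> w y *v s w y) z x"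
    using hol unfolding holo_iso_on_def by blast
  \<comment> \<open>On constant sections the condition on \<open>delbar_z\<close> is the
    Cauchy-Riemann equation, so the real derivative \<open>?D\<close> is complex linear.\<close>
  have qd: "((\<lambda>z. q b z $ i) has_field_derivative q' b z $ i) (at z)" for b z i
  proof -
    have "smooth_on UNIV (\<lambda>z. \<phi> z x *v b)"
      by (intro smooth_on_matrix_vector open_UNIV smooth_on_slice_fst[OF op sm x] smooth_on_const)
    then have "smooth_on UNIV (\<lambda>z. q b z $ i)"
      unfolding q_def by (rule smooth_on_component[OF open_UNIV])
    then have fd: "((\<lambda>z. q b z $ i) has_derivative frechet_derivative (\<lambda>z. q b z $ i) (at z)) (at z)"
        (is "(_ has_derivative ?D) _")
      by (rule smooth_on_has_derivative) simp
    have "delbar_z (\<lambda>w y. \<phi> w y *v b) z x = \<phi> z x *v delbar_z (\<lambda>z x. b) z x"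
      using bspec[OF H const_sec[of b]] x by simp
    also have "\<dots> = 0" by (simp add: delbar_z_def zero_vec_def[symmetric])
    finally have "?D 1 + \<i> * ?D \<i> = 0"
      by (simp add: delbar_z_def q_def vec_eq_iff)
    moreover have "w = \<i> * c" if "c + \<i> * w = 0" for c w :: complex
    proof -
      from that have "\<i> * (c + \<i> * w) = 0" by simp
      then have "\<i> * c - w = 0" by (simp add: distrib_left)
      then show ?thesis by simp
    qed
    ultimately have Di: "?D \<i> = \<i> * ?D 1" by blast
    have lin: "?D h = ?D 1 * h" for h
    proof -
      have l: "linear ?D" using fd has_derivative_linear by blast
      have "?D h = ?D (Re h *\<^sub>R 1 + Im h *\<^sub>R \<i>)" by (rule arg_cong) (simp add: complex_eq_iff)
      also have "\<dots> = Re h *\<^sub>R ?D 1 + Im h *\<^sub>R ?D \<i>"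
        by (simp only: linear_add[OF l] linear_scale[OF l])
      also have "\<dots> = ?D 1 * (of_real (Re h) + \<i> * of_real (Im h))"
        by (simp add: Di scaleR_conv_of_real algebra_simps)
      finally show ?thesis by (simp flip: complex_eq)
    qed
    have D1: "q' b z $ i = ?D 1"
      by (simp add: q'_def q_def[symmetric] del_z_def Di mult.assoc[symmetric])
    have "?D = (*) (q' b z $ i)" unfolding D1 by (rule ext) (rule lin)
    then show ?thesis
      using fd unfolding has_field_derivative_def by (simp only:)
  qed
  have q_ode: "q' b z = (1 / z) *s ((1 / z) *s q (Um x *v b) z - q (Vm x *v b) z) - (1 / z) *s ((1 / z) *s
      (Um x *v q b z)) + Ud *v q b z"
    if z: "z \<noteq> 0" for b z
  proof -
    have "smooth_on \<Omega> (\<lambda>y. \<phi> z y *v b)"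
      by (intro smooth_on_matrix_vector op smooth_on_slice_snd[OF op sm] smooth_on_const)
    then have Q: "Q_op S d (\<lambda>y. \<phi> z y *v b) x = 0" by (rule tate[OF _ x])
    have "\<phi> z x *v nabla_tilde_z S d (\<lambda>z x. b) z x = D_tilde_z S d (\<lambda>w y. \<phi> w y *v b) z x"
      using int const_sec[of b] x z unfolding intertwines_on_def by blast
    moreover have "del_z (\<lambda>z x. b) z x = 0" by (simp add: del_z_def zero_vec_def[symmetric])
    ultimately have "(1 / z) *s ((1 / z) *s q (Um x *v b) z - q (Vm x *v b) z) =
        q' b z + (1 / z) *s ((1 / z) *s (Um x *v q b z) - z *s (Ud *v q b z))"
      unfolding D_tilde_z_def Q nabla_tilde_z_def U_op_Umat V_op_Vm[OF x] Ud q_def q'_def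
      by (simp only: matrix_vec_smult matrix_vector_mult_diff_distrib add_0_left diff_zero)
    then show ?thesis using z by (simp add: vec_eq_iff algebra_simps)
  qed
  \<comment> \<open>If \<open>P\<close> vanished, so would its trace \<open>2 r\<close>,
    contradicting \<open>r * r = \<delta> x\<close> with \<open>\<delta> x\<close> nonzero.\<close>
  have "\<exists>v i. P v $ i \<noteq> 0"
  proof (rule ccontr)
    assume "\<not> ?thesis"
    then have "(Wm x + msc r (mat 1)) *v v = 0 *v v" for v
      by (simp add: P_def vec_eq_iff matrix_vector_mult_add_rdistrib)
    then have "Wm x + msc r (mat 1) = 0" by (simp add: matrix_eq)
    then have "trace (Wm x + msc r (mat 1)) = 0" by (simp add: trace_2)
    then have "r = 0" by (simp add: trace_add trace_msc trace_mat_1_2 trace_Wmat)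
    then show False using r disc_nonzero[OF x] by simp
  qed
  then obtain v0 i where v0: "P v0 $ i \<noteq> 0" by blast
  \<comment> \<open>The exponential cancels the term with \<open>U\<^sup>\<dagger>\<close>, which
    acts on the row as \<open>\<mu>\<close>.\<close>
  define \<rho> where "\<rho> b z = exp (- \<mu> * z) * P (q b z) $ i" for b z
  have \<rho>_lin: "\<rho> b z = (\<Sum>j\<in>UNIV. b $ j * \<rho> (axis j 1) z)" for b z
  proof -
    have "b = b$1 *s axis 1 1 + b$2 *s axis 2 1"
      by (simp add: vec_eq_iff forall_2 axis_def)
    then have "q b z = b$1 *s q (axis 1 1) z + b$2 *s q (axis 2 1) z"
      unfolding q_def by (metis matrix_vector_right_distrib matrix_vec_smult)
    then show ?thesis by (simp add: \<rho>_def P_lin sum_2 algebra_simps)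
  qed
  have \<rho>_deriv: "(\<rho> b has_field_derivative exp (- \<mu> * z) * P (q' b z) $ i - \<mu> * \<rho> b z) (at z)" for b z
  proof -
    have "((\<lambda>z. P (q b z) $ i) has_field_derivative P (q' b z) $ i) (at z)"
      unfolding P_def matrix_vector_mult_def
      by (simp add: sum_2) (auto intro!: derivative_eq_intros qd)
    then show ?thesis unfolding \<rho>_def[abs_def]
      by (auto intro!: derivative_eq_intros simp: algebra_simps)
  qed
  have \<rho>_ode: "z\<^sup>2 * deriv (\<rho> b) z = \<rho> ((Um x - msc u (mat 1)) *v b) z - z * \<rho> (Vm x *v b) z" if z: "z \<noteq> 0" for b z
  proof -
    have q_diff: "q ((Um x - msc u (mat 1)) *v b) z = q (Um x *v b) z - u *s q b z"
      by (simp add: q_def matrix_vector_mult_diff_rdistrib matrix_vector_mult_diff_distrib matrix_vec_smult)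
    have "P (q' b z) = (1 / z) *s ((1 / z) *s P (q (Um x *v b) z) - P (q (Vm x *v b) z)) - (1 / z) *s ((1 /
        z) *s (u *s P (q b z))) + \<mu> *s P (q b z)"
      unfolding q_ode[OF z] P_lin PU PUd ..
    then have E: "P (q' b z) $ i = 1 / z * (1 / z * P (q (Um x *v b) z) $ i - P (q (Vm x *v b) z) $ i)
        - 1 / z * (1 / z * (u * P (q b z) $ i)) + \<mu> * P (q b z) $ i"
      by (simp only: vector_minus_component vector_add_component vector_smult_component)
    have "z\<^sup>2 * (P (q' b z) $ i) =
        P (q (Um x *v b) z) $ i - z * (P (q (Vm x *v b) z) $ i) - u * (P (q b z) $ i) + z\<^sup>2 * (\<mu> * (P (q b z) $ i))"
      unfolding E using z by (simp add: field_simps power2_eq_square)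
    then have "z\<^sup>2 * (exp (- \<mu> * z) * P (q' b z) $ i - \<mu> * \<rho> b z)
      = exp (- \<mu> * z) * (P (q (Um x *v b) z) $ i - z * (P (q (Vm x *v b) z) $ i) - u * (P (q b z) $ i))"
      unfolding \<rho>_def by algebra
    then show ?thesis
      unfolding DERIV_imp_deriv[OF \<rho>_deriv]
      unfolding \<rho>_def q_diff P_lin
      by (simp add: algebra_simps)
  qed
  have hol_\<rho>: "\<rho> b holomorphic_on UNIV" for b
    using \<rho>_deriv unfolding holomorphic_on_def field_differentiable_def by blast
  have deriv_lin: "deriv (\<rho> b) z = (\<Sum>j\<in>UNIV. b $ j * deriv (\<rho> (axis j 1)) z)" for b z
  proof -
    have d: "(\<rho> b has_field_derivative deriv (\<rho> b) z) (at z)" for b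
      using \<rho>_deriv DERIV_imp_deriv by metis
    have "((\<lambda>z. \<Sum>j\<in>UNIV. b $ j * \<rho> (axis j 1) z) has_field_derivative (\<Sum>j\<in>UNIV. b $ j * deriv (\<rho> (axis j 1))
        z)) (at z)"
      by (intro DERIV_sum DERIV_cmult d)
    then have "(\<rho> b has_field_derivative (\<Sum>j\<in>UNIV. b $ j * deriv (\<rho> (axis j 1)) z)) (at z)"
      by (subst (asm) \<rho>_lin[symmetric])
    then show ?thesis by (rule DERIV_imp_deriv)
  qed
  \<comment> \<open>Invertibility of \<open>\<phi>\<close> at \<open>z = 0\<close> puts
    \<open>v0\<close> in its range, so the row does not vanish at the origin.\<close>
  have "\<exists>b. q b 0 = v0"
    using inv[of 0] unfolding q_def
    by (metis invertible_def matrix_vector_mul_assoc matrix_vector_mul_lid)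
  then obtain b0 where "q b0 0 = v0" by blast
  then have "\<rho> b0 0 \<noteq> 0" using v0 by (simp add: \<rho>_def)
  then obtain j0 where j0: "\<rho> (axis j0 1) 0 \<noteq> 0"
    using \<rho>_lin[of b0 0] by (metis (no_types, lifting) mult_zero_right sum.neutral)
  show ?thesis
  proof (rule entire_system_resonance[where p = "\<lambda>j. \<rho> (axis j 1)" and T = "Um x - msc u (mat 1)" and V = "Vm x",
        OF _ _ _ j0])
    fix b z assume "z \<noteq> (0::complex)"
    from \<rho>_ode[OF this, of b]
    show "z\<^sup>2 * (\<Sum>j\<in>UNIV. b $ j * deriv (\<rho> (axis j 1)) z) =
        (\<Sum>j\<in>UNIV. ((Um x - msc u (mat 1)) *v b) $ j * \<rho> (axis j 1) z) - z * (\<Sum>j\<in>UNIV. (Vm x *v b) $ j * \<rho>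
            (axis j 1) z)"
      unfolding \<rho>_lin[symmetric] deriv_lin[symmetric] .
  qed (simp_all add: hol_\<rho> V_square[OF x] j0)
qed

end

section \<open>Gluing\<close>

lemma trace_similar:
  fixes A B J :: "complex^'n::finite^'n"
  assumes "invertible J" "A ** J = J ** B"
  shows "trace A = trace B"
proof -
  obtain K where K: "J ** K = mat 1" "K ** J = mat 1"
    using assms(1) by (auto simp: invertible_def)
  have "trace A = trace ((A ** J) ** K)"
    by (simp add: matrix_mul_assoc[symmetric] K)
  also have "\<dots> = trace (K ** (J ** B))"
    unfolding assms(2) by (rule trace_mul_sym)
  also have "\<dots> = trace B" by (simp add: matrix_mul_assoc K)
  finally show ?thesis .
qed

lemma holo_fields_frechet_linear:
  assumes "F \<in> holo_fields V" "x \<in> V"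
  shows "Vector_Spaces.linear (*s) (*s) (frechet_derivative F (at x))"
proof -
  let ?D = "\<lambda>c. frechet_derivative (\<lambda>y. F y $ c) (at x)"
  note h = holo_onD[OF holo_fieldsD[OF assms(1)] assms(2)]
  have "((\<lambda>y. \<Sum>c\<in>UNIV. axis c (F y $ c)) has_derivative (\<lambda>v. \<Sum>c\<in>UNIV. axis c (?D c v))) (at x)"
    by (intro has_derivative_sum bounded_linear.has_derivative[OF bounded_linear_axis] h(1))
  then have "(F has_derivative (\<lambda>v. \<Sum>c\<in>UNIV. axis c (?D c v))) (at x)"
    unfolding axis_eq_basis_sum[symmetric] .
  then have D: "frechet_derivative F (at x) v $ c = ?D c v" for v c
    by (simp add: frechet_eq axis_def)
  have "linear (?D c)" for c using h(1) has_derivative_linear by blast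
  then show ?thesis
    by unfold_locales (simp_all add: vec_eq_iff D h(2) linear_add)
qed

text \<open>All ingredients except \<open>V\<close> are transported algebraically. \<open>V\<close>
  involves derivatives and Christoffel coefficients, so its naturality is taken from uniqueness: the
  pulled back operator is skew as well and has the same value on \<open>e\<close>, hence the
  difference \<open>N\<close> is zero.\<close>

lemma phi_natural:
  assumes t1: "tate_chart \<Omega>1 d S1" and t2: "tate_chart \<Omega>2 d S2" and x: "x \<in> \<Omega>1" and y: "y \<in> \<Omega>2"
    and J: "Vector_Spaces.linear (*s) (*s) J"
    and g: "\<And>u v. pairing S2 y (J u) (J v) = pairing S1 x u v"
    and m: "\<And>u v. mult S2 y (J u) (J v) = J (mult S1 x u v)"
    and e: "unit_field S2 y = J (unit_field S1 x)"
    and E: "euler S2 y = J (euler S1 x)"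
    and \<kappa>: "\<And>u. kappa S2 y (J u) = J (kappa S1 x u)"
  shows "phi S2 d k z y *v J v = J (phi S1 d k z x *v v)"
proof -
  interpret c1: tate_chart \<Omega>1 d S1 by fact
  interpret c2: tate_chart \<Omega>2 d S2 by fact
  define Jm where "Jm = matrix J"
  have Jm: "J v = Jm *v v" for v unfolding Jm_def by (rule matrix_works[OF J, symmetric])
  \<comment> \<open>\<open>J\<close> preserves a nondegenerate form and is therefore
    injective.\<close>
  have "inj ((*v) Jm)"
  proof (rule injI)
    fix u u' assume "Jm *v u = Jm *v u'"
    then have "pairing S1 x w u = pairing S1 x w u'" for w
      using g[of w u] g[of w u'] by (simp add: Jm)
    then show "u = u'"
      using bil_nondeg[OF c1.metric_inv[OF x]] by (simp add: pairing_bil)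
  qed
  then have invJ: "invertible Jm"
    by (simp add: invertible_left_inverse matrix_left_invertible_injective)
  then obtain Ji where Ji: "Jm ** Ji = mat 1" "Ji ** Jm = mat 1"
    by (auto simp: invertible_def)
  have JiJ: "Ji *v (Jm *v v) = v" "Jm *v (Ji *v v) = v" for v
    by (simp_all add: matrix_vector_mul_assoc Ji)
  have U: "Umat S2 y *v (Jm *v v) = Jm *v (Umat S1 x *v v)" for v
    using m[of "euler S1 x" v] by (simp add: E[symmetric] c1.Mm_mult c2.Mm_mult Umat_def Jm[symmetric])
  have "Umat S2 y ** Jm = Jm ** Umat S1 x"
    by (simp add: matrix_eq matrix_vector_mul_assoc[symmetric] U)
  then have t: "half_tr S2 y = half_tr S1 x"
    using trace_similar[OF invJ] by (simp add: half_tr_def)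
  have W: "Wmat S2 y *v (Jm *v v) = Jm *v (Wmat S1 x *v v)" for v
    using U[of v] by (simp add: Umat_Wmat t matrix_vector_right_distrib matrix_vec_smult)
  have "(Wmat S2 y ** Wmat S2 y) ** Jm = Jm ** (Wmat S1 x ** Wmat S1 x)"
    by (simp add: matrix_eq matrix_vector_mul_assoc[symmetric] W)
  then have s: "disc S2 y = disc S1 x"
    using trace_similar[OF invJ] by (simp add: disc_def)
  define N where "N = Ji ** Vmat S2 d y ** Jm - Vmat S1 d x"
  have N: "N *v v = Ji *v (Vmat S2 d y *v (Jm *v v)) - Vmat S1 d x *v v" for v
    by (simp add: N_def matrix_vector_mult_diff_rdistrib matrix_vector_mul_assoc[symmetric])
  have gJ: "bil (metric S1 x) u v = bil (metric S2 y) (Jm *v u) (Jm *v v)" for u v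
    using g by (simp add: pairing_bil Jm)
  have "bil (metric S1 x) (N *v u) v = - bil (metric S1 x) u (N *v v)" for u v
  proof -
    have "bil (metric S1 x) (Ji *v (Vmat S2 d y *v (Jm *v u))) v =
        - bil (metric S1 x) u (Ji *v (Vmat S2 d y *v (Jm *v v)))"
      unfolding gJ JiJ by (rule c2.V_skew[OF y])
    then show ?thesis by (simp add: N bil_diff c1.V_skew[OF x, of u v])
  qed
  then have sk: "skew2 (metric S1 x) N"
    by unfold_locales (simp_all add: c1.metric_sym c1.metric_inv x)
  have "N *v unit_field S1 x = 0"
    using c2.V_e[OF y] by (simp add: N e Jm c1.V_e[OF x] matrix_vec_smult JiJ)
  then have "N = 0" using skew2.zero[OF sk] c1.e_nonzero[OF x] by blast
  then have V: "Vmat S2 d y *v (Jm *v v) = Jm *v (Vmat S1 d x *v v)" for v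
  proof -
    have "Ji *v (Vmat S2 d y *v (Jm *v v)) = Vmat S1 d x *v v"
      using N[of v] \<open>N = 0\<close> by simp
    then have "Jm *v (Ji *v (Vmat S2 d y *v (Jm *v v))) = Jm *v (Vmat S1 d x *v v)" by simp
    then show ?thesis by (simp add: JiJ)
  qed
  have R: "Rmat S2 d k z y *v (Jm *v v) = Jm *v (Rmat S1 d k z x *v v)" for v
    by (simp add: Rmat_vec s W V matrix_vector_mult_diff_distrib matrix_vec_smult)
  have Wd: "Wdag S2 y *v (Jm *v v) = Jm *v (Wdag S1 x *v v)" for v
    using \<kappa> by (simp add: Wdag_kappa Jm W)
  have "Edag S2 z y *v (Jm *v v) = Jm *v (Edag S1 z x *v v)" for v
    by (simp add: Edag_def s t Wd matrix_vector_mult_add_rdistrib matrix_vector_right_distrib matrix_vec_smult)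
  then show ?thesis
    by (simp add: phi_def Jm matrix_vector_mul_assoc[symmetric] R)
qed

lemma even_integer_iff: "(\<exists>m::nat. d\<^sup>2 / 4 = (of_nat m :: complex) ^ 2) \<longleftrightarrow> (\<exists>k::int. d = 2 * of_int k)"
proof
  assume "\<exists>m::nat. d\<^sup>2 / 4 = (of_nat m :: complex) ^ 2"
  then obtain m :: nat where "d\<^sup>2 / 4 = (of_nat m :: complex) ^ 2" by blast
  then have "d\<^sup>2 = (2 * of_nat m) ^ 2" by (simp add: field_simps)
  then have "d = 2 * of_nat m \<or> d = - (2 * of_nat m)" by (simp only: power2_eq_iff)
  then have "d = 2 * of_int (int m) \<or> d = 2 * of_int (- int m)" by simp
  then show "\<exists>k::int. d = 2 * of_int k" by blast
next
  assume "\<exists>k::int. d = 2 * of_int k"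
  then obtain k :: int where k: "d = 2 * of_int k" by blast
  have "(of_nat (nat \<bar>k\<bar>) :: complex) ^ 2 = of_int (\<bar>k\<bar>) ^ 2" by (simp add: of_nat_nat)
  also have "\<dots> = of_int (\<bar>k\<bar> ^ 2)" by (simp only: of_int_power)
  also have "\<dots> = (of_int k) ^ 2" by simp
  finally have "d\<^sup>2 / 4 = of_nat (nat \<bar>k\<bar>) ^ 2"
    by (simp add: k power_mult_distrib)
  then show "\<exists>m::nat. d\<^sup>2 / 4 = (of_nat m :: complex) ^ 2" by blast
qed

theorem corollary1p5:
  fixes M :: "'m::{t2_space, second_countable_topology} set"
    and A :: "('i, 'm, 2) atlas"
    and S :: "'i \<Rightarrow> 2 cdv_chart"
    and d :: complex
  assumes "one_connected M"
    and "cdv_plus_structure M A d S"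
    and "semisimple A S"
    and "tate A d S"
    and "\<forall>i. \<forall>x\<in>coord_dom A i. pairing (S i) x (unit_field (S i) x) (unit_field (S i) x) = 0"
    and "\<forall>i. \<forall>x\<in>coord_dom A i. \<forall>u.
           nabla_euler (S i) x u + adjoint_wrt (pairing (S i) x) (nabla_euler (S i) x) u = (2 - d) *s u"
  shows "strongly_potential A d S \<longleftrightarrow> (\<exists>k::int. d = 2 * of_int k)"
proof -
  have cdv: "cdv_structure M A d S"
    using assms(2) by (simp add: cdv_plus_structure_def)
  then have frob: "frobenius_manifold M A d S"
    by (simp add: cdv_structure_def)
  then have mfd: "complex_manifold M A"
    by (simp add: frobenius_manifold_def)
  have chart: "tate_chart (coord_dom A i) d (S i)" for i
  proof
    show "open (coord_dom A i)" using mfd by (simp add: complex_manifold_def)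
    show "cdv_on (coord_dom A i) d (S i)" using cdv by (simp add: cdv_structure_def)
    show "card {l. \<exists>v. v \<noteq> 0 \<and> U_op (S i) x v = l *s v} = 2" if "x \<in> coord_dom A i" for x
      using assms(3) that by (simp add: semisimple_def)
    show "Q_op (S i) d Y x = 0" if "smooth_on (coord_dom A i) Y" "x \<in> coord_dom A i" for Y x
      using assms(4) that by (simp add: tate_def smooth_fields_def)
  qed
  have "strongly_potential A d S \<longleftrightarrow> (\<exists>m::nat. d\<^sup>2 / 4 = of_nat m ^ 2)"
  proof
    assume "strongly_potential A d S"
    then obtain \<phi> where \<phi>: "\<And>i. holo_iso_on (coord_dom A i) (S i) (\<phi> i)"
        "\<And>i. intertwines_on (coord_dom A i) d (S i) (\<phi> i)"
      unfolding strongly_potential_def by blast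
    \<comment> \<open>The parity condition is read off at one point, and nonemptiness of
      \<open>M\<close> is part of \<open>one_connected\<close>.\<close>
    from assms(1) obtain p where "p \<in> M" by (auto simp: one_connected_def)
    then obtain i where "p \<in> chart_dom A i" using mfd by (auto simp: complex_manifold_def)
    then have "chart A i p \<in> coord_dom A i" by (simp add: coord_dom_def)
    then show "\<exists>m::nat. d\<^sup>2 / 4 = of_nat m ^ 2"
      using tate_chart.gauge_imp_even[OF chart \<phi>] by blast
  next
    assume "\<exists>m::nat. d\<^sup>2 / 4 = of_nat m ^ 2"
    then obtain k :: nat where k: "d\<^sup>2 / 4 = of_nat k ^ 2" by blast
    \<comment> \<open>The constant \<open>d\<close> is common to all charts, so one \<open>k\<close>
      serves everywhere and the local matrices are given by the same formula.\<close>
    have even: "tate_even (coord_dom A i) d (S i) k" for i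
      unfolding tate_even_def tate_even_axioms_def using chart k by simp
    have glue: "phi (S j) d k z (transition A i j x) *v d_transition A i j x v =
        d_transition A i j x (phi (S i) d k z x *v v)"
      if x: "x \<in> overlap A i j" for i j z x v
    proof (rule phi_natural[OF chart chart])
      from x obtain p where p: "p \<in> chart_dom A i" "p \<in> chart_dom A j" "x = chart A i p"
        by (auto simp: overlap_def)
      then show "x \<in> coord_dom A i" by (simp add: coord_dom_def)
      have "inv_into (chart_dom A i) (chart A i) x = p"
        using mfd p unfolding complex_manifold_def homeomorphism_def by blast
      then show "transition A i j x \<in> coord_dom A j"
        using p by (simp add: transition_def coord_dom_def)
      show "Vector_Spaces.linear (*s) (*s) (d_transition A i j x)"
        unfolding d_transition_def
        by (rule holo_fields_frechet_linear[OF _ x]) (use mfd in \<open>simp add: complex_manifold_def\<close>)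
      show "pairing (S j) (transition A i j x) (d_transition A i j x u) (d_transition A i j x w) =
          pairing (S i) x u w"
        "mult (S j) (transition A i j x) (d_transition A i j x u) (d_transition A i j x w) =
            d_transition A i j x (mult (S i) x u w)"
        "unit_field (S j) (transition A i j x) = d_transition A i j x (unit_field (S i) x)"
        "euler (S j) (transition A i j x) = d_transition A i j x (euler (S i) x)" for u w
        using frob x by (simp_all add: frobenius_manifold_def Let_def)
      show "kappa (S j) (transition A i j x) (d_transition A i j x u) = d_transition A i j x (kappa (S i) x u)" for u
        using cdv x by (simp add: cdv_structure_def)
    qed
    show "strongly_potential A d S"
      unfolding strongly_potential_def
      by (rule exI[of _ "\<lambda>i. phi (S i) d k"])
         (auto simp: tate_even.phi_holo_iso[OF even] tate_even.phi_intertwines[OF even] glue)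
  qed
  then show ?thesis by (simp only: even_integer_iff)
qed

end
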